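(* (i) $\mathsf{M}_\lambda$ is a simple $\mathcal{H}$-module for any $\lambda\in\Lambda=T/q^{\mathbf Y}$. Moreover, the set $\{\mathsf{M}_\lambda,\ \lambda\in\Lambda\}$ is a complete collection of (the isomorphism classes of) simple objects of the category $\mathcal{M}(\mathcal{H},\mathcal{A})$. (ii) Any object of the category $\mathcal{M}^{ss}(\mathcal{H},\mathcal{A})$ is isomorphic to a finite direct sum of modules of the form $\mathsf{M}_\lambda$, $\lambda\in\Lambda$ (repetitions allowed); in particular, the category $\mathcal{M}^{ss}(\mathcal{H},\mathcal{A})$ is semisimple. (iii) Any object of the category $\mathcal{M}(\mathcal{H},\mathcal{A})$ has finite length.
   Context: Let $\mathbf X,\mathbf Y$ be lattices (free abelian groups of finite rank) with a non-degenerate pairing $\langle\,,\rangle:\mathbf X\times\mathbf Y\to\frac1n\mathbb Z$, where $n$ is a positive integer. Fix $q\in\mathbb C^*$, not a root of unity, together with an $n$-th root $q^{1/n}$, and put $q^{a/n}:=(q^{1/n})^a$ for $a\in\mathbb Z$. The quantum torus $\mathcal H$ is the $\mathbb C$-algebra with $\mathbb C$-basis $\{e^xe^y : x\in\mathbf X,y\in\mathbf Y\}$, containing the group algebras $\mathbb C\mathbf X$ (spanned by the $e^x$) and $\mathbb C\mathbf Y$ (spanned by the $e^y$) as commutative subalgebras, with commutation relations $e^xe^y=q^{\langle x,y\rangle}e^ye^x$. Put $\mathcal A:=\mathbb C\mathbf X\subset\mathcal H$. Let $T:=\mathrm{Hom}(\mathbf X,\mathbb C^* )$ (a complex torus); $x\in\mathbf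 X$ is viewed as a function $t\mapsto x(t)$ on $T$. For $y\in\mathbf Y$ let $q^y\in T$ be defined by $x(q^y)=q^{\langle x,y\rangle}$ for all $x\in\mathbf X$. This identifies $\mathbf Y$ with a subgroup $q^{\mathbf Y}\subset T$. Put $\Lambda:=T/q^{\mathbf Y}$. For $\lambda\in T$, $\mathsf{M}_\lambda$ is the $\mathcal H$-module with $\mathbb C$-basis $\{v_\mu : \mu\in\lambda\cdot q^{\mathbf Y}\subset T\}$ and action $e^y(v_\mu)=v_{\mu\cdot q^y}$, $e^x(v_\mu)=x(\mu)v_\mu$. Up to isomorphism it depends only on the image of $\lambda$ in $\Lambda$. For a $\mathbb C$-algebra $H$ with a commutative subalgebra $A$: $\mathcal M(H,A)$ is the category of finitely generated $H$-modules $M$ on which $A$ acts locally finitely, i.e. $\dim_{\mathbb C}A\cdot m<\infty$ for every $m\in M$; $\mathcal M^{ss}(H,A)$ is the full subcategory of those $M$ with $M=\bigoplus_\alpha M(\alpha)$ and $\dim_{\mathbb C}M(\alpha)<\infty$ for all $\alpha$, where $\alpha$ runs over algebra homomorphisms $A\to\mathbb C$ (weights) and $M(\alpha)=\{m\in M : am=\alpha(a)m\ \forall a\in A\}$. *)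

theory Defs
  imports
    Complex_Main
    "HOL-Algebra.Module"
    "HOL-Algebra.QuotRing"
    "HOL-Algebra.Free_Abelian_Groups"
begin

section \<open>Left modules over a not necessarily commutative ring\<close>

text \<open>The library locale \<^locale>\<open>module\<close> asks for a commutative ring of scalars. The following
  is the same list of axioms over an arbitrary ring; the record type and the locale
  \<^locale>\<open>submodule\<close> of the library are reused. The ring fields \<open>mult\<close> and \<open>one\<close> of a module record
  play no role.\<close>

locale left_module = R?: ring R + M?: abelian_group M
  for R :: "'h ring" (structure) and M :: "('h, 'm) module" (structure) +
  assumes smult_closed:
      "\<lbrakk>a \<in> carrier R; x \<in> carrier M\<rbrakk> \<Longrightarrow> a \<odot>\<^bsub>M\<^esub> x \<in> carrier M"
    and smult_l_distr:
      "\<lbrakk>a \<in> carrier R; b \<in> carrier R; x \<in> carrier M\<rbrakk> \<Longrightarrow>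
        (a \<oplus>\<^bsub>R\<^esub> b) \<odot>\<^bsub>M\<^esub> x = a \<odot>\<^bsub>M\<^esub> x \<oplus>\<^bsub>M\<^esub> b \<odot>\<^bsub>M\<^esub> x"
    and smult_r_distr:
      "\<lbrakk>a \<in> carrier R; x \<in> carrier M; y \<in> carrier M\<rbrakk> \<Longrightarrow>
        a \<odot>\<^bsub>M\<^esub> (x \<oplus>\<^bsub>M\<^esub> y) = a \<odot>\<^bsub>M\<^esub> x \<oplus>\<^bsub>M\<^esub> a \<odot>\<^bsub>M\<^esub> y"
    and smult_assoc1:
      "\<lbrakk>a \<in> carrier R; b \<in> carrier R; x \<in> carrier M\<rbrakk> \<Longrightarrow>
        (a \<otimes>\<^bsub>R\<^esub> b) \<odot>\<^bsub>M\<^esub> x = a \<odot>\<^bsub>M\<^esub> (b \<odot>\<^bsub>M\<^esub> x)"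
    and smult_one: "x \<in> carrier M \<Longrightarrow> \<one>\<^bsub>R\<^esub> \<odot>\<^bsub>M\<^esub> x = x"

definition module_isomorphic :: "'h ring \<Rightarrow> ('h, 'm) module \<Rightarrow> ('h, 'k) module \<Rightarrow> bool" where
  "module_isomorphic R M N \<longleftrightarrow>
    (\<exists>\<phi>. bij_betw \<phi> (carrier M) (carrier N) \<and>
      (\<forall>x\<in>carrier M. \<forall>y\<in>carrier M. \<phi> (x \<oplus>\<^bsub>M\<^esub> y) = \<phi> x \<oplus>\<^bsub>N\<^esub> \<phi> y) \<and>
      (\<forall>a\<in>carrier R. \<forall>x\<in>carrier M. \<phi> (a \<odot>\<^bsub>M\<^esub> x) = a \<odot>\<^bsub>N\<^esub> \<phi> x))"

definition finitely_generated :: "'h ring \<Rightarrow> ('h, 'm) module \<Rightarrow> bool" where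
  "finitely_generated R M \<longleftrightarrow>
    (\<exists>S. finite S \<and> S \<subseteq> carrier M \<and> (\<forall>N. submodule N R M \<and> S \<subseteq> N \<longrightarrow> N = carrier M))"

text \<open>A full subcategory of the category of modules is given by a predicate \<open>C\<close> selecting its
  objects. Subobjects are the submodules that again satisfy \<open>C\<close>: in the categories below
  a cyclic submodule of an object is an object, so monomorphisms are injective.\<close>

definition simple_object ::
  "'h ring \<Rightarrow> (('h, 'm) module \<Rightarrow> bool) \<Rightarrow> ('h, 'm) module \<Rightarrow> bool" where
  "simple_object R C M \<longleftrightarrow>
    C M \<and> carrier M \<noteq> {\<zero>\<^bsub>M\<^esub>} \<and>
    (\<forall>N. submodule N R M \<and> C (M\<lparr>carrier := N\<rparr>) \<longrightarrow> N = {\<zero>\<^bsub>M\<^esub>} \<or> N = carrier M)"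

definition simple_module :: "'h ring \<Rightarrow> ('h, 'm) module \<Rightarrow> bool" where
  "simple_module R M \<longleftrightarrow>
    left_module R M \<and> carrier M \<noteq> {\<zero>\<^bsub>M\<^esub>} \<and>
    (\<forall>N. submodule N R M \<longrightarrow> N = {\<zero>\<^bsub>M\<^esub>} \<or> N = carrier M)"

definition finite_direct_sum ::
  "nat \<Rightarrow> (nat \<Rightarrow> ('h, 'm) module) \<Rightarrow> ('h, nat \<Rightarrow> 'm) module" where
  "finite_direct_sum k Ms =
    \<lparr>carrier = (\<Pi>\<^sub>E i\<in>{..<k}. carrier (Ms i)),
     monoid.mult = (\<lambda>_ _. undefined), monoid.one = undefined,
     ring.zero = (\<lambda>i\<in>{..<k}. \<zero>\<^bsub>Ms i\<^esub>),
     ring.add = (\<lambda>f g. \<lambda>i\<in>{..<k}. f i \<oplus>\<^bsub>Ms i\<^esub> g i),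
     module.smult = (\<lambda>a f. \<lambda>i\<in>{..<k}. a \<odot>\<^bsub>Ms i\<^esub> f i)\<rparr>"

definition semisimple_category :: "'h ring \<Rightarrow> (('h, 'm) module \<Rightarrow> bool) \<Rightarrow> bool" where
  "semisimple_category R C \<longleftrightarrow>
    (\<forall>M. C M \<longrightarrow> (\<exists>k Ms. (\<forall>i<k. simple_object R C (Ms i)) \<and>
        module_isomorphic R M (finite_direct_sum k Ms)))"

text \<open>As for \<^const>\<open>FactRing\<close>, the quotient has the additive cosets of \<open>N\<close> as elements.\<close>

definition quotient_module :: "('h, 'm) module \<Rightarrow> 'm set \<Rightarrow> ('h, 'm set) module" where
  "quotient_module M N =
    \<lparr>carrier = a_rcosets\<^bsub>M\<^esub> N,
     monoid.mult = (\<lambda>_ _. undefined), monoid.one = undefined,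
     ring.zero = N, ring.add = set_add M,
     module.smult = (\<lambda>a K. \<Union>x\<in>K. N +>\<^bsub>M\<^esub> (a \<odot>\<^bsub>M\<^esub> x))\<rparr>"

definition finite_length :: "'h ring \<Rightarrow> ('h, 'm) module \<Rightarrow> bool" where
  "finite_length R M \<longleftrightarrow>
    (\<exists>(k::nat) N. N 0 = {\<zero>\<^bsub>M\<^esub>} \<and> N k = carrier M \<and>
      (\<forall>i\<le>k. submodule (N i) R M) \<and>
      (\<forall>i<k. N i \<subseteq> N (Suc i) \<and>
        simple_module R (quotient_module (M\<lparr>carrier := N (Suc i)\<rparr>) (N i))))"


section \<open>The categories M(H,A) and M^ss(H,A)\<close>

text \<open>The complex algebra structure of \<open>H\<close> is given by the map \<open>\<iota> c = c 1\<^sub>H\<close>. The following says that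
  the complex subspace \<open>V\<close> of \<open>M\<close> is spanned by a finite subset.\<close>

definition finite_dim ::
  "(complex \<Rightarrow> 'h) \<Rightarrow> ('h, 'm) module \<Rightarrow> 'm set \<Rightarrow> bool" where
  "finite_dim \<iota> M V \<longleftrightarrow>
    (\<exists>S. finite S \<and> S \<subseteq> V \<and>
      (\<forall>v\<in>V. \<exists>c. v = (\<Oplus>\<^bsub>M\<^esub>s\<in>S. \<iota> (c s) \<odot>\<^bsub>M\<^esub> s)))"

definition category_M ::
  "'h ring \<Rightarrow> (complex \<Rightarrow> 'h) \<Rightarrow> 'h set \<Rightarrow> ('h, 'm) module \<Rightarrow> bool" where
  "category_M H \<iota> A M \<longleftrightarrow>
    left_module H M \<and> finitely_generated H M \<and>
    (\<forall>m\<in>carrier M. finite_dim \<iota> M ((\<lambda>a. a \<odot>\<^bsub>M\<^esub> m) ` A))"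

text \<open>Weights are taken to be extensional, so that each algebra homomorphism from \<open>A\<close> to the complex
  numbers is counted once.\<close>

definition weights :: "'h ring \<Rightarrow> (complex \<Rightarrow> 'h) \<Rightarrow> 'h set \<Rightarrow> ('h \<Rightarrow> complex) set" where
  "weights H \<iota> A =
    {\<alpha> \<in> extensional A.
      (\<forall>a\<in>A. \<forall>b\<in>A. \<alpha> (a \<oplus>\<^bsub>H\<^esub> b) = \<alpha> a + \<alpha> b \<and> \<alpha> (a \<otimes>\<^bsub>H\<^esub> b) = \<alpha> a * \<alpha> b) \<and>
      (\<forall>c. \<alpha> (\<iota> c) = c)}"

definition weight_space ::
  "(complex \<Rightarrow> 'h) \<Rightarrow> 'h set \<Rightarrow> ('h, 'm) module \<Rightarrow> ('h \<Rightarrow> complex) \<Rightarrow> 'm set" where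
  "weight_space \<iota> A M \<alpha> = {m \<in> carrier M. \<forall>a\<in>A. a \<odot>\<^bsub>M\<^esub> m = \<iota> (\<alpha> a) \<odot>\<^bsub>M\<^esub> m}"

definition is_internal_direct_sum ::
  "('h, 'm) module \<Rightarrow> 'i set \<Rightarrow> ('i \<Rightarrow> 'm set) \<Rightarrow> bool" where
  "is_internal_direct_sum M I V \<longleftrightarrow>
    (\<forall>i\<in>I. subgroup (V i) (add_monoid M)) \<and>
    (\<forall>m\<in>carrier M. \<exists>!f. f \<in> (\<Pi>\<^sub>E i\<in>I. V i) \<and> finite {i\<in>I. f i \<noteq> \<zero>\<^bsub>M\<^esub>} \<and>
      m = (\<Oplus>\<^bsub>M\<^esub>i\<in>{i\<in>I. f i \<noteq> \<zero>\<^bsub>M\<^esub>}. f i))"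

definition category_Mss ::
  "'h ring \<Rightarrow> (complex \<Rightarrow> 'h) \<Rightarrow> 'h set \<Rightarrow> ('h, 'm) module \<Rightarrow> bool" where
  "category_Mss H \<iota> A M \<longleftrightarrow>
    category_M H \<iota> A M \<and>
    is_internal_direct_sum M (weights H \<iota> A) (weight_space \<iota> A M) \<and>
    (\<forall>\<alpha>\<in>weights H \<iota> A. finite_dim \<iota> M (weight_space \<iota> A M \<alpha>))"


section \<open>Lattices and the quantum torus\<close>

definition free_of_finite_rank :: "'x::ab_group_add itself \<Rightarrow> bool" where
  "free_of_finite_rank _ \<longleftrightarrow>
    (\<exists>r. \<lparr>carrier = (UNIV :: 'x set), monoid.mult = (+), monoid.one = 0\<rparr> \<cong> free_Abelian_group {..<r::nat})"

definition nondegenerate_pairing ::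
  "nat \<Rightarrow> ('x::ab_group_add \<Rightarrow> 'y::ab_group_add \<Rightarrow> rat) \<Rightarrow> bool" where
  "nondegenerate_pairing n B \<longleftrightarrow>
    (\<forall>x y. \<exists>a::int. B x y = of_int a / of_nat n) \<and>
    (\<forall>x x' y. B (x + x') y = B x y + B x' y) \<and>
    (\<forall>x y y'. B x (y + y') = B x y + B x y') \<and>
    (\<forall>x. (\<forall>y. B x y = 0) \<longrightarrow> x = 0) \<and>
    (\<forall>y. (\<forall>x. B x y = 0) \<longrightarrow> y = 0)"

text \<open>Throughout, \<open>r\<close> is the chosen \<open>n\<close>-th root of \<open>q\<close>. For \<open>s = a / n\<close> with \<open>a\<close> an integer,
  \<open>q_pow n r s\<close> is \<open>r powi a\<close>; it is only used for such \<open>s\<close>.\<close>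

definition q_pow :: "nat \<Rightarrow> complex \<Rightarrow> rat \<Rightarrow> complex" where
  "q_pow n r s = r powi \<lfloor>of_nat n * s\<rfloor>"

text \<open>The basis element \<open>e\<^sup>x e\<^sup>y\<close> is \<open>Poly_Mapping.single (x, y) 1\<close>. By the commutation relation,
  the product of \<open>e\<^sup>x e\<^sup>y\<close> and \<open>e\<^sup>u e\<^sup>v\<close> is \<open>q_pow n r (- B u y)\<close> times \<open>e\<^sup>x\<^sup>+\<^sup>u e\<^sup>y\<^sup>+\<^sup>v\<close>.\<close>

definition quantum_torus ::
  "nat \<Rightarrow> complex \<Rightarrow> ('x::ab_group_add \<Rightarrow> 'y::ab_group_add \<Rightarrow> rat) \<Rightarrow>
    (('x \<times> 'y) \<Rightarrow>\<^sub>0 complex) ring" where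
  "quantum_torus n r B =
    \<lparr>carrier = UNIV,
     monoid.mult = (\<lambda>f g. \<Sum>(x, y)\<in>Poly_Mapping.keys f. \<Sum>(u, v)\<in>Poly_Mapping.keys g.
       Poly_Mapping.single (x + u, y + v)
         (Poly_Mapping.lookup f (x, y) * Poly_Mapping.lookup g (u, v) * q_pow n r (- B u y))),
     monoid.one = Poly_Mapping.single (0, 0) 1,
     ring.zero = 0,
     ring.add = (+)\<rparr>"

lemma quantum_torus_mult_basis:
  "Poly_Mapping.single (x, y) 1 \<otimes>\<^bsub>quantum_torus n r B\<^esub> Poly_Mapping.single (u, v) 1 =
    Poly_Mapping.single (x + u, y + v) (q_pow n r (- B u y))"
  by (simp add: quantum_torus_def)

definition qt_scalar :: "complex \<Rightarrow> (('x::ab_group_add \<times> 'y::ab_group_add) \<Rightarrow>\<^sub>0 complex)" where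
  "qt_scalar c = Poly_Mapping.single (0, 0) c"

text \<open>The span of the \<open>e\<^sup>x = e\<^sup>x e\<^sup>0\<close>.\<close>

definition group_algebra_X :: "(('x::ab_group_add \<times> 'y::ab_group_add) \<Rightarrow>\<^sub>0 complex) set" where
  "group_algebra_X = {f. Poly_Mapping.keys f \<subseteq> UNIV \<times> {0}}"

definition torus_T :: "('x::ab_group_add \<Rightarrow> complex) monoid" where
  "torus_T =
    \<lparr>carrier = {t. (\<forall>x. t x \<noteq> 0) \<and> (\<forall>x x'. t (x + x') = t x * t x')},
     monoid.mult = (\<lambda>s t x. s x * t x),
     monoid.one = (\<lambda>_. 1)\<rparr>"

definition q_exp ::
  "nat \<Rightarrow> complex \<Rightarrow> ('x \<Rightarrow> 'y \<Rightarrow> rat) \<Rightarrow> 'y \<Rightarrow> 'x \<Rightarrow> complex" where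
  "q_exp n r B y = (\<lambda>x. q_pow n r (B x y))"

definition Lambda ::
  "nat \<Rightarrow> complex \<Rightarrow> ('x::ab_group_add \<Rightarrow> 'y::ab_group_add \<Rightarrow> rat) \<Rightarrow> ('x \<Rightarrow> complex) set monoid" where
  "Lambda n r B = torus_T Mod range (q_exp n r B)"


section \<open>The modules indexed by Lambda\<close>

text \<open>A finitely supported function \<open>f\<close> on \<open>T\<close> stands for the sum of the \<open>f(\<mu>) v\<^sub>\<mu>\<close>. The two operators
  below are the actions of \<open>e\<^sup>x\<close> and of \<open>e\<^sup>y\<close>.\<close>

definition act_X ::
  "'x \<Rightarrow> (('x \<Rightarrow> complex) \<Rightarrow>\<^sub>0 complex) \<Rightarrow> (('x \<Rightarrow> complex) \<Rightarrow>\<^sub>0 complex)" where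
  "act_X x f = (\<Sum>\<mu>\<in>Poly_Mapping.keys f. Poly_Mapping.single \<mu> (\<mu> x * Poly_Mapping.lookup f \<mu>))"

definition act_Y ::
  "nat \<Rightarrow> complex \<Rightarrow> ('x::ab_group_add \<Rightarrow> 'y \<Rightarrow> rat) \<Rightarrow> 'y \<Rightarrow>
    (('x \<Rightarrow> complex) \<Rightarrow>\<^sub>0 complex) \<Rightarrow> (('x \<Rightarrow> complex) \<Rightarrow>\<^sub>0 complex)" where
  "act_Y n r B y f =
    (\<Sum>\<mu>\<in>Poly_Mapping.keys f.
      Poly_Mapping.single (\<mu> \<otimes>\<^bsub>torus_T\<^esub> q_exp n r B y) (Poly_Mapping.lookup f \<mu>))"

lemma act_X_basis: "act_X x (Poly_Mapping.single \<mu> 1) = Poly_Mapping.single \<mu> (\<mu> x)"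
  by (simp add: act_X_def)

lemma act_Y_basis:
  "act_Y n r B y (Poly_Mapping.single \<mu> 1) =
    Poly_Mapping.single (\<mu> \<otimes>\<^bsub>torus_T\<^esub> q_exp n r B y) 1"
  by (simp add: act_Y_def)

text \<open>An element \<open>L\<close> of \<^const>\<open>Lambda\<close> is a coset of the subgroup \<open>q\<^sup>Y\<close> of \<open>T\<close>, that is, the set of
  indices of the basis of the module attached to any representative of \<open>L\<close>.\<close>

definition module_M ::
  "nat \<Rightarrow> complex \<Rightarrow> ('x::ab_group_add \<Rightarrow> 'y::ab_group_add \<Rightarrow> rat) \<Rightarrow> ('x \<Rightarrow> complex) set \<Rightarrow>
    (('x \<times> 'y) \<Rightarrow>\<^sub>0 complex, ('x \<Rightarrow> complex) \<Rightarrow>\<^sub>0 complex) module" where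
  "module_M n r B L =
    \<lparr>carrier = {f. Poly_Mapping.keys f \<subseteq> L},
     monoid.mult = (\<lambda>_ _. undefined), monoid.one = undefined,
     ring.zero = 0, ring.add = (+),
     module.smult = (\<lambda>h f. \<Sum>(x, y)\<in>Poly_Mapping.keys h.
       Poly_Mapping.map ((*) (Poly_Mapping.lookup h (x, y))) (act_X x (act_Y n r B y f)))\<rparr>"

end

theory Submission
  imports Defs "HOL-Computational_Algebra.Fundamental_Theorem_Algebra"
begin

text \<open>Everything rests on one computation. Let \<open>K\<close> be a submodule of an \<open>H\<close>-module and let \<open>v\<close> be a
  vector outside \<open>K\<close> that is a weight vector modulo \<open>K\<close>: \<open>e\<^sup>x v - t(x) v \<in> K\<close> for all \<open>x\<close>. Modulo \<open>K\<close>,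
  every \<open>h v\<close> is a combination of the vectors \<open>e\<^sup>y v\<close>, which have the weights \<open>x \<mapsto> t(x) q\<^bsup>\<langle>x,y\<rangle>\<^esup>\<close>. Since
  \<open>q\<close> is not a root of unity and the pairing is non-degenerate, these weights are pairwise different,
  and vectors of different weights are independent. So whether \<open>h v\<close> lies in \<open>K\<close> depends on \<open>h\<close> and \<open>t\<close>
  only, neither on \<open>K\<close> nor on the module (lemma \<open>smult_mem_iff_red_zero\<close>).

  Comparing two submodules by means of this criterion gives what is needed about weight vectors. If \<open>v\<close>
  is a weight vector modulo \<open>N\<close>, then \<open>N\<close> is a maximal submodule of \<open>N + H v\<close>. If \<open>v\<close> is a weight vector
  outside \<open>N\<close>, then \<open>H v\<close> meets \<open>N\<close> only in zero. A nonzero weight vector generates a simple module,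
  and as its annihilator is determined by the weight, this module is the one attached to the class of
  the weight in \<open>\<Lambda>\<close>.

  Weight vectors exist modulo any proper submodule \<open>N\<close>: for \<open>w\<close> outside \<open>N\<close> the finite dimensional space
  \<open>A w\<close> contains a common eigenvector modulo \<open>N\<close> of the commutative algebra \<open>A\<close> (lemma
  \<open>eigenvector_exists\<close>). For a simple object and \<open>N = 0\<close> this completes (i).

  For (ii) and (iii) a submodule \<open>N\<close>, starting from zero, is enlarged to \<open>N + H v\<close> as long as it is
  proper. In (iii) the vector \<open>v\<close> is a weight vector modulo \<open>N\<close>, so each step adds a simple factor to
  a composition series. In (ii) it is a weight component of a generator and an honest weight vector,
  so each step adds a simple direct summand. The process stops because all the vectors \<open>v\<close> can be taken
  from one finite dimensional space, and they are linearly independent (lemma \<open>ascending_induct\<close>).\<close>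

section \<open>Modules over a noncommutative ring\<close>

context left_module
begin

lemma smult_l_null [simp]: "x \<in> carrier M \<Longrightarrow> \<zero> \<odot>\<^bsub>M\<^esub> x = \<zero>\<^bsub>M\<^esub>"
proof -
  assume x: "x \<in> carrier M"
  have "\<zero> \<odot>\<^bsub>M\<^esub> x = \<zero> \<odot>\<^bsub>M\<^esub> x \<oplus>\<^bsub>M\<^esub> \<zero> \<odot>\<^bsub>M\<^esub> x"
    using x smult_l_distr[of \<zero> \<zero> x] by simp
  then show ?thesis
    using x smult_closed[of \<zero> x] by (metis M.add.r_cancel_one R.zero_closed)
qed

lemma smult_r_null [simp]: "a \<in> carrier R \<Longrightarrow> a \<odot>\<^bsub>M\<^esub> \<zero>\<^bsub>M\<^esub> = \<zero>\<^bsub>M\<^esub>"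
proof -
  assume a: "a \<in> carrier R"
  have "a \<odot>\<^bsub>M\<^esub> \<zero>\<^bsub>M\<^esub> = a \<odot>\<^bsub>M\<^esub> \<zero>\<^bsub>M\<^esub> \<oplus>\<^bsub>M\<^esub> a \<odot>\<^bsub>M\<^esub> \<zero>\<^bsub>M\<^esub>"
    using a smult_r_distr[of a "\<zero>\<^bsub>M\<^esub>" "\<zero>\<^bsub>M\<^esub>"] by simp
  then show ?thesis
    using a smult_closed[of a "\<zero>\<^bsub>M\<^esub>"] by (metis M.add.r_cancel_one M.zero_closed)
qed

lemma smult_l_minus:
  assumes "a \<in> carrier R" "x \<in> carrier M"
  shows "(\<ominus> a) \<odot>\<^bsub>M\<^esub> x = \<ominus>\<^bsub>M\<^esub> (a \<odot>\<^bsub>M\<^esub> x)"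
proof -
  have "(\<ominus> a) \<odot>\<^bsub>M\<^esub> x \<oplus>\<^bsub>M\<^esub> a \<odot>\<^bsub>M\<^esub> x = \<zero>\<^bsub>M\<^esub>"
    using assms smult_l_distr[of "\<ominus> a" a x] by (simp add: R.l_neg)
  then show ?thesis
    using assms M.minus_equality smult_closed by (metis R.a_inv_closed)
qed

lemma smult_r_minus:
  assumes "a \<in> carrier R" "x \<in> carrier M"
  shows "a \<odot>\<^bsub>M\<^esub> (\<ominus>\<^bsub>M\<^esub> x) = \<ominus>\<^bsub>M\<^esub> (a \<odot>\<^bsub>M\<^esub> x)"
proof -
  have "a \<odot>\<^bsub>M\<^esub> (\<ominus>\<^bsub>M\<^esub> x) \<oplus>\<^bsub>M\<^esub> a \<odot>\<^bsub>M\<^esub> x = \<zero>\<^bsub>M\<^esub>"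
    using assms smult_r_distr[of a "\<ominus>\<^bsub>M\<^esub> x" x] by (simp add: M.l_neg)
  then show ?thesis
    using assms M.minus_equality smult_closed by (metis M.a_inv_closed)
qed

lemma smult_r_diff:
  assumes "a \<in> carrier R" "x \<in> carrier M" "y \<in> carrier M"
  shows "a \<odot>\<^bsub>M\<^esub> (x \<ominus>\<^bsub>M\<^esub> y) = a \<odot>\<^bsub>M\<^esub> x \<ominus>\<^bsub>M\<^esub> a \<odot>\<^bsub>M\<^esub> y"
  using assms by (simp add: a_minus_def smult_r_distr smult_r_minus)

lemma smult_l_diff:
  assumes "a \<in> carrier R" "b \<in> carrier R" "x \<in> carrier M"
  shows "(a \<ominus> b) \<odot>\<^bsub>M\<^esub> x = a \<odot>\<^bsub>M\<^esub> x \<ominus>\<^bsub>M\<^esub> b \<odot>\<^bsub>M\<^esub> x"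
  using assms by (simp add: a_minus_def smult_l_distr smult_l_minus)

lemma smult_finsum:
  assumes "a \<in> carrier R" "f \<in> I \<rightarrow> carrier M"
  shows "a \<odot>\<^bsub>M\<^esub> (\<Oplus>\<^bsub>M\<^esub>i\<in>I. f i) = (\<Oplus>\<^bsub>M\<^esub>i\<in>I. a \<odot>\<^bsub>M\<^esub> f i)"
  using assms
proof (induction I rule: infinite_finite_induct)
  case (insert i I)
  then show ?case
    by (simp add: Pi_iff smult_r_distr smult_closed)
qed (simp_all add: M.finsum_infinite)

lemma diff_eq_zero_iff:
  assumes "x \<in> carrier M" "y \<in> carrier M"
  shows "x \<ominus>\<^bsub>M\<^esub> y = \<zero>\<^bsub>M\<^esub> \<longleftrightarrow> x = y"
proof
  assume "x \<ominus>\<^bsub>M\<^esub> y = \<zero>\<^bsub>M\<^esub>"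
  then have "\<ominus>\<^bsub>M\<^esub> (\<ominus>\<^bsub>M\<^esub> y) = x"
    using assms by (intro M.minus_equality) (simp_all add: a_minus_def)
  then show "x = y"
    using assms by simp
qed (use assms in \<open>simp add: a_minus_def M.r_neg\<close>)

lemma diff_zero [simp]: "x \<in> carrier M \<Longrightarrow> x \<ominus>\<^bsub>M\<^esub> \<zero>\<^bsub>M\<^esub> = x"
  using M.minus_equality[of "\<zero>\<^bsub>M\<^esub>" "\<zero>\<^bsub>M\<^esub>"] by (simp add: a_minus_def)

lemma add_diff_cancel_left:
  assumes "x \<in> carrier M" "y \<in> carrier M"
  shows "x \<oplus>\<^bsub>M\<^esub> y \<ominus>\<^bsub>M\<^esub> x = y"
  using assms by (simp add: a_minus_def M.a_comm[of x y] M.a_assoc M.r_neg)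

lemma submodule_iff:
  "submodule N R M \<longleftrightarrow> N \<subseteq> carrier M \<and> \<zero>\<^bsub>M\<^esub> \<in> N \<and> (\<forall>x\<in>N. \<forall>y\<in>N. x \<oplus>\<^bsub>M\<^esub> y \<in> N) \<and>
     (\<forall>a\<in>carrier R. \<forall>x\<in>N. a \<odot>\<^bsub>M\<^esub> x \<in> N)"
proof
  assume "submodule N R M"
  then show "N \<subseteq> carrier M \<and> \<zero>\<^bsub>M\<^esub> \<in> N \<and> (\<forall>x\<in>N. \<forall>y\<in>N. x \<oplus>\<^bsub>M\<^esub> y \<in> N) \<and>
     (\<forall>a\<in>carrier R. \<forall>x\<in>N. a \<odot>\<^bsub>M\<^esub> x \<in> N)"
    unfolding submodule_def submodule_axioms_def subgroup_def by auto
next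
  assume N: "N \<subseteq> carrier M \<and> \<zero>\<^bsub>M\<^esub> \<in> N \<and> (\<forall>x\<in>N. \<forall>y\<in>N. x \<oplus>\<^bsub>M\<^esub> y \<in> N) \<and>
     (\<forall>a\<in>carrier R. \<forall>x\<in>N. a \<odot>\<^bsub>M\<^esub> x \<in> N)"
  have "\<ominus>\<^bsub>M\<^esub> x \<in> N" if "x \<in> N" for x
  proof -
    have "(\<ominus> \<one>) \<odot>\<^bsub>M\<^esub> x \<in> N"
      using N that by simp
    moreover have "x \<in> carrier M"
      using N that by blast
    ultimately show ?thesis
      by (simp add: smult_l_minus smult_one)
  qed
  then show "submodule N R M"
    using N unfolding submodule_def submodule_axioms_def
    by (auto intro!: M.add.subgroupI simp: a_inv_def)
qed

lemma submodule_subset: "submodule N R M \<Longrightarrow> x \<in> N \<Longrightarrow> x \<in> carrier M"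
  by (auto simp: submodule_iff)

lemma submodule_minus:
  assumes "submodule N R M" "x \<in> N" "y \<in> N"
  shows "x \<ominus>\<^bsub>M\<^esub> y \<in> N"
proof -
  have y: "(\<ominus> \<one>) \<odot>\<^bsub>M\<^esub> y \<in> N"
    using assms by (simp add: submodule_iff)
  then have "\<ominus>\<^bsub>M\<^esub> y \<in> N"
    using assms by (simp add: smult_l_minus smult_one submodule_subset)
  then show ?thesis
    using assms by (simp add: a_minus_def submodule_iff)
qed

lemma zero_submodule: "submodule {\<zero>\<^bsub>M\<^esub>} R M"
  by (simp add: submodule_iff)

lemma sum_submodule:
  assumes "submodule N R M" "submodule K R M"
  shows "submodule (N <+>\<^bsub>M\<^esub> K) R M"
  unfolding submodule_iff
proof (intro conjI ballI)
  show "N <+>\<^bsub>M\<^esub> K \<subseteq> carrier M"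
    using assms by (auto simp: set_add_def' submodule_iff)
  have "\<zero>\<^bsub>M\<^esub> = \<zero>\<^bsub>M\<^esub> \<oplus>\<^bsub>M\<^esub> \<zero>\<^bsub>M\<^esub>"
    by simp
  then show "\<zero>\<^bsub>M\<^esub> \<in> N <+>\<^bsub>M\<^esub> K"
    using assms unfolding set_add_def' submodule_iff by blast
next
  fix x y assume "x \<in> N <+>\<^bsub>M\<^esub> K" "y \<in> N <+>\<^bsub>M\<^esub> K"
  then obtain n k n' k' where x: "x = n \<oplus>\<^bsub>M\<^esub> k" "y = n' \<oplus>\<^bsub>M\<^esub> k'"
      and in_NK: "n \<in> N" "k \<in> K" "n' \<in> N" "k' \<in> K"
    by (auto simp: set_add_def')
  have "n \<in> carrier M" "k \<in> carrier M" "n' \<in> carrier M" "k' \<in> carrier M"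
    using in_NK assms by (auto simp: submodule_iff)
  then have "x \<oplus>\<^bsub>M\<^esub> y = (n \<oplus>\<^bsub>M\<^esub> n') \<oplus>\<^bsub>M\<^esub> (k \<oplus>\<^bsub>M\<^esub> k')"
    using x by (simp add: M.a_ac)
  then show "x \<oplus>\<^bsub>M\<^esub> y \<in> N <+>\<^bsub>M\<^esub> K"
    using assms in_NK unfolding set_add_def' submodule_iff by blast
next
  fix a x assume a: "a \<in> carrier R" and "x \<in> N <+>\<^bsub>M\<^esub> K"
  then obtain n k where x: "x = n \<oplus>\<^bsub>M\<^esub> k" and in_NK: "n \<in> N" "k \<in> K"
    by (auto simp: set_add_def')
  then have "a \<odot>\<^bsub>M\<^esub> x = a \<odot>\<^bsub>M\<^esub> n \<oplus>\<^bsub>M\<^esub> a \<odot>\<^bsub>M\<^esub> k"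
    using assms a by (simp add: smult_r_distr submodule_subset)
  then show "a \<odot>\<^bsub>M\<^esub> x \<in> N <+>\<^bsub>M\<^esub> K"
    using assms in_NK a unfolding set_add_def' submodule_iff by blast
qed

lemma subset_sum_left:
  assumes "submodule N R M" "submodule K R M"
  shows "N \<subseteq> N <+>\<^bsub>M\<^esub> K"
proof
  fix n assume n: "n \<in> N"
  then have "n = n \<oplus>\<^bsub>M\<^esub> \<zero>\<^bsub>M\<^esub>"
    using assms submodule_subset by simp
  then show "n \<in> N <+>\<^bsub>M\<^esub> K"
    using assms n unfolding set_add_def' submodule_iff by blast
qed

lemma subset_sum_right:
  assumes "submodule N R M" "submodule K R M"
  shows "K \<subseteq> N <+>\<^bsub>M\<^esub> K"
proof
  fix n assume n: "n \<in> K"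
  then have "n = \<zero>\<^bsub>M\<^esub> \<oplus>\<^bsub>M\<^esub> n"
    using assms submodule_subset by simp
  then show "n \<in> N <+>\<^bsub>M\<^esub> K"
    using assms n unfolding set_add_def' submodule_iff by blast
qed

definition cyclic :: "'m \<Rightarrow> 'm set" where
  "cyclic v = (\<lambda>a. a \<odot>\<^bsub>M\<^esub> v) ` carrier R"

lemma cyclic_submodule: "v \<in> carrier M \<Longrightarrow> submodule (cyclic v) R M"
  unfolding submodule_iff cyclic_def
proof (intro conjI ballI; (elim imageE)?)
  assume v: "v \<in> carrier M"
  show "(\<lambda>a. a \<odot>\<^bsub>M\<^esub> v) ` carrier R \<subseteq> carrier M"
    using v by (auto simp: smult_closed)
  show "\<zero>\<^bsub>M\<^esub> \<in> (\<lambda>a. a \<odot>\<^bsub>M\<^esub> v) ` carrier R"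
    using v by (intro image_eqI[of _ _ \<zero>]) auto
next
  fix x y a b assume "v \<in> carrier M" "x = a \<odot>\<^bsub>M\<^esub> v" "y = b \<odot>\<^bsub>M\<^esub> v" "a \<in> carrier R" "b \<in> carrier R"
  then show "x \<oplus>\<^bsub>M\<^esub> y \<in> (\<lambda>a. a \<odot>\<^bsub>M\<^esub> v) ` carrier R"
    by (intro image_eqI[of _ _ "a \<oplus> b"]) (auto simp: smult_l_distr)
next
  fix x a b assume "v \<in> carrier M" "x = b \<odot>\<^bsub>M\<^esub> v" "a \<in> carrier R" "b \<in> carrier R"
  then show "a \<odot>\<^bsub>M\<^esub> x \<in> (\<lambda>a. a \<odot>\<^bsub>M\<^esub> v) ` carrier R"
    by (intro image_eqI[of _ _ "a \<otimes> b"]) (auto simp: smult_assoc1)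
qed

lemma cyclic_self: "v \<in> carrier M \<Longrightarrow> v \<in> cyclic v"
  unfolding cyclic_def by (rule image_eqI[of _ _ \<one>]) (auto simp: smult_one)

lemma cyclic_least: "submodule N R M \<Longrightarrow> v \<in> N \<Longrightarrow> cyclic v \<subseteq> N"
  by (auto simp: cyclic_def submodule_iff)


subsection \<open>Submodules as modules\<close>

lemma left_module_restrict:
  assumes N: "submodule N R M"
  shows "left_module R (M\<lparr>carrier := N\<rparr>)"
proof -
  have "\<exists>y\<in>N. y \<oplus>\<^bsub>M\<^esub> x = \<zero>\<^bsub>M\<^esub>" if "x \<in> N" for x
  proof
    have "\<zero>\<^bsub>M\<^esub> \<ominus>\<^bsub>M\<^esub> x \<in> N"
      using that N submodule_minus[of N "\<zero>\<^bsub>M\<^esub>" x] by (simp add: submodule_iff)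
    then show "\<ominus>\<^bsub>M\<^esub> x \<in> N"
      using that N by (simp add: a_minus_def submodule_subset)
    show "\<ominus>\<^bsub>M\<^esub> x \<oplus>\<^bsub>M\<^esub> x = \<zero>\<^bsub>M\<^esub>"
      using that N by (simp add: M.l_neg submodule_subset)
  qed
  moreover note sub = submodule_subset[OF N]
  ultimately have "abelian_group (M\<lparr>carrier := N\<rparr>)"
    using N
  proof (intro abelian_groupI, goal_cases)
    case (3 x y z)
    then show ?case
      by (simp add: M.a_assoc)
  next
    case (4 x y)
    then show ?case
      by (simp add: M.a_comm)
  qed (simp_all add: submodule_iff)
  moreover have "left_module_axioms R (M\<lparr>carrier := N\<rparr>)"
    using N
    by unfold_locales (auto simp: submodule_iff subset_iff smult_l_distr smult_r_distr smult_assoc1 smult_one)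
  ultimately show ?thesis
    by (intro left_module.intro R.ring_axioms)
qed

lemma submodule_restrict_iff:
  assumes N: "submodule N R M"
  shows "submodule K R (M\<lparr>carrier := N\<rparr>) \<longleftrightarrow> submodule K R M \<and> K \<subseteq> N"
proof -
  interpret N: left_module R "M\<lparr>carrier := N\<rparr>"
    by (rule left_module_restrict[OF N])
  show ?thesis
    using N by (auto simp: N.submodule_iff submodule_iff)
qed

lemma finsum_restrict:
  assumes N: "submodule N R M" and "f \<in> I \<rightarrow> N"
  shows "finsum (M\<lparr>carrier := N\<rparr>) f I = finsum M f I"
proof -
  interpret N: left_module R "M\<lparr>carrier := N\<rparr>"
    by (rule left_module_restrict[OF N])
  show ?thesis
    using assms(2)
  proof (induction I rule: infinite_finite_induct)
    case (insert i I)
    then have "f \<in> I \<rightarrow> carrier M" "f i \<in> carrier M"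
      using submodule_subset[OF N] by auto
    then show ?case
      using insert by (simp add: Pi_iff)
  qed (simp_all add: M.finsum_infinite N.M.finsum_infinite)
qed

lemma submodule_finsum:
  assumes N: "submodule N R M" and "f \<in> I \<rightarrow> N"
  shows "finsum M f I \<in> N"
  using assms(2)
proof (induction I rule: infinite_finite_induct)
  case (insert i I)
  then have "f \<in> I \<rightarrow> carrier M" "f i \<in> carrier M"
    using submodule_subset[OF N] by auto
  then show ?case
    using insert N by (simp add: Pi_iff submodule_iff)
qed (use N in \<open>simp_all add: M.finsum_infinite submodule_iff\<close>)


subsection \<open>Maximal submodules, composition series\<close>

text \<open>The submodules of the quotient correspond to the submodules between \<open>N\<close> and \<open>M\<close>.\<close>

lemma simple_quotient:
  assumes N: "submodule N R M" and proper: "N \<noteq> carrier M"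
    and maximal: "\<And>K. submodule K R M \<Longrightarrow> N \<subseteq> K \<Longrightarrow> K = N \<or> K = carrier M"
  shows "simple_module R (quotient_module M N)"
proof -
  interpret abelian_subgroup N M
    using N M.a_comm_group
    by (intro abelian_subgroupI3 additive_subgroup.intro M.abelian_group_axioms)
      (auto simp: submodule_def)
  let ?Q = "quotient_module M N" and ?p = "\<lambda>x. N +>\<^bsub>M\<^esub> x"
  have carrier_Q: "carrier ?Q = ?p ` carrier M"
    by (auto simp: quotient_module_def A_RCOSETS_def')
  have zero_Q: "\<zero>\<^bsub>?Q\<^esub> = ?p \<zero>\<^bsub>M\<^esub>"
    using N by (simp add: quotient_module_def M.a_coset_add_zero submodule_iff)
  have add_Q: "?p x \<oplus>\<^bsub>?Q\<^esub> ?p y = ?p (x \<oplus>\<^bsub>M\<^esub> y)" if "x \<in> carrier M" "y \<in> carrier M" for x y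
    using that by (simp add: quotient_module_def a_rcos_sum)
  have p_eq: "?p x = ?p y \<longleftrightarrow> x \<ominus>\<^bsub>M\<^esub> y \<in> N" if "x \<in> carrier M" "y \<in> carrier M" for x y
  proof -
    have "?p x = ?p y \<longleftrightarrow> x \<in> ?p y"
    proof
      assume "?p x = ?p y"
      then show "x \<in> ?p y"
        using a_rcos_self[OF that(1)] by simp
    next
      assume "x \<in> ?p y"
      from a_repr_independence'[OF this that(2)] show "?p x = ?p y"
        by (rule sym)
    qed
    then show ?thesis
      using a_rcos_module[OF that(2,1)] by (simp add: a_minus_def)
  qed
  have smult_Q: "a \<odot>\<^bsub>?Q\<^esub> ?p x = ?p (a \<odot>\<^bsub>M\<^esub> x)" if a: "a \<in> carrier R" and x: "x \<in> carrier M" for a x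
  proof -
    have "?p (a \<odot>\<^bsub>M\<^esub> y) = ?p (a \<odot>\<^bsub>M\<^esub> x)" if "y \<in> ?p x" for y
    proof -
      have y: "y \<in> carrier M"
        using that x a_elemrcos_carrier by blast
      have "y \<ominus>\<^bsub>M\<^esub> x \<in> N"
        using that unfolding a_rcos_module[OF x y] a_minus_def .
      then have "a \<odot>\<^bsub>M\<^esub> (y \<ominus>\<^bsub>M\<^esub> x) \<in> N"
        using N a by (simp add: submodule_iff)
      then show ?thesis
        using a x y p_eq[of "a \<odot>\<^bsub>M\<^esub> y" "a \<odot>\<^bsub>M\<^esub> x"] by (simp add: smult_r_diff smult_closed)
    qed
    then have "(\<Union>y\<in>?p x. ?p (a \<odot>\<^bsub>M\<^esub> y)) = ?p (a \<odot>\<^bsub>M\<^esub> x)"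
      using a_rcos_self[OF x] by blast
    then show ?thesis
      by (simp add: quotient_module_def)
  qed
  have "abelian_group ?Q"
  proof (rule abelian_groupI)
    fix X assume "X \<in> carrier ?Q"
    then obtain x where x: "x \<in> carrier M" "X = ?p x"
      by (auto simp: carrier_Q)
    then have "?p (\<ominus>\<^bsub>M\<^esub> x) \<oplus>\<^bsub>?Q\<^esub> X = \<zero>\<^bsub>?Q\<^esub>"
      by (simp add: add_Q zero_Q M.l_neg)
    then show "\<exists>Y\<in>carrier ?Q. Y \<oplus>\<^bsub>?Q\<^esub> X = \<zero>\<^bsub>?Q\<^esub>"
      using x by (auto simp: carrier_Q)
  qed (auto simp: carrier_Q zero_Q add_Q M.a_ac)
  then have module_Q: "left_module R ?Q"
    by (intro left_module.intro R.ring_axioms left_module_axioms.intro)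
      (auto simp: carrier_Q add_Q smult_Q smult_closed smult_l_distr smult_r_distr smult_assoc1 smult_one)
  then interpret Q: left_module R ?Q .
  obtain x where x: "x \<in> carrier M" "x \<notin> N"
    using N proper by (auto simp: submodule_iff)
  have "carrier ?Q \<noteq> {\<zero>\<^bsub>?Q\<^esub>}"
  proof
    assume "carrier ?Q = {\<zero>\<^bsub>?Q\<^esub>}"
    then have "?p x = ?p \<zero>\<^bsub>M\<^esub>"
      using x by (auto simp: carrier_Q zero_Q)
    then show False
      using x by (simp add: p_eq)
  qed
  moreover have "K = {\<zero>\<^bsub>?Q\<^esub>} \<or> K = carrier ?Q" if K: "submodule K R ?Q" for K
  proof -
    let ?K = "{x \<in> carrier M. ?p x \<in> K}"
    have K_image: "K = ?p ` ?K"
      using K by (auto simp: Q.submodule_iff carrier_Q)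
    have p_add: "?p (x \<oplus>\<^bsub>M\<^esub> y) \<in> K" if "x \<in> ?K" "y \<in> ?K" for x y
      using K that by (simp flip: add_Q add: Q.submodule_iff)
    have p_smult: "?p (a \<odot>\<^bsub>M\<^esub> x) \<in> K" if "a \<in> carrier R" "x \<in> ?K" for a x
      using K that by (simp flip: smult_Q add: Q.submodule_iff)
    have N_K: "N \<subseteq> ?K"
    proof
      fix y assume "y \<in> N"
      then have "y \<in> carrier M" "?p y = \<zero>\<^bsub>?Q\<^esub>"
        using N p_eq[of y "\<zero>\<^bsub>M\<^esub>"] unfolding zero_Q by (auto simp: submodule_iff)
      then show "y \<in> ?K"
        using K by (simp add: Q.submodule_iff)
    qed
    have zero_K: "\<zero>\<^bsub>M\<^esub> \<in> ?K"
    proof (rule subsetD[OF N_K])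
      show "\<zero>\<^bsub>M\<^esub> \<in> N"
        using N by (simp add: submodule_iff)
    qed
    have "submodule ?K R M"
      unfolding submodule_iff
    proof (intro conjI ballI)
      show "?K \<subseteq> carrier M"
        by blast
      show "\<zero>\<^bsub>M\<^esub> \<in> ?K"
        by (rule zero_K)
      show "x \<oplus>\<^bsub>M\<^esub> y \<in> ?K" if "x \<in> ?K" "y \<in> ?K" for x y
        using p_add that by simp
      show "a \<odot>\<^bsub>M\<^esub> x \<in> ?K" if "a \<in> carrier R" "x \<in> ?K" for a x
        using p_smult that smult_closed by simp
    qed
    then consider "?K = N" | "?K = carrier M"
      using maximal N_K by blast
    then show ?thesis
    proof cases
      case 1
      have "?p y = \<zero>\<^bsub>?Q\<^esub>" if "y \<in> N" for y
        using that N p_eq[of y "\<zero>\<^bsub>M\<^esub>"] unfolding zero_Q by (auto simp: submodule_iff)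
      moreover have "N \<noteq> {}"
        using N unfolding submodule_iff by blast
      ultimately have "?p ` N = {\<zero>\<^bsub>?Q\<^esub>}"
        by blast
      then show ?thesis
        using K_image 1 by simp
    next
      case 2
      then show ?thesis
        using K_image carrier_Q by simp
    qed
  qed
  ultimately show ?thesis
    using module_Q by (simp add: simple_module_def)
qed

definition has_composition_series :: "'m set \<Rightarrow> bool" where
  "has_composition_series N \<longleftrightarrow>
    (\<exists>(k::nat) Ns. Ns 0 = {\<zero>\<^bsub>M\<^esub>} \<and> Ns k = N \<and> (\<forall>i\<le>k. submodule (Ns i) R M) \<and>
      (\<forall>i<k. Ns i \<subseteq> Ns (Suc i) \<and>
        simple_module R (quotient_module (M\<lparr>carrier := Ns (Suc i)\<rparr>) (Ns i))))"

lemma finite_length_iff: "finite_length R M \<longleftrightarrow> has_composition_series (carrier M)"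
  by (simp add: finite_length_def has_composition_series_def)

lemma has_composition_series_zero: "has_composition_series {\<zero>\<^bsub>M\<^esub>}"
  unfolding has_composition_series_def
  by (rule exI[of _ 0], rule exI[of _ "\<lambda>_. {\<zero>\<^bsub>M\<^esub>}"]) (simp add: zero_submodule)

lemma has_composition_series_extend:
  assumes series: "has_composition_series N" and N': "submodule N' R M" and sub: "N \<subset> N'"
    and maximal: "\<And>K. submodule K R M \<Longrightarrow> N \<subseteq> K \<Longrightarrow> K \<subseteq> N' \<Longrightarrow> K = N \<or> K = N'"
  shows "has_composition_series N'"
proof -
  obtain k Ns where Ns: "Ns 0 = {\<zero>\<^bsub>M\<^esub>}" "Ns k = N" "\<forall>i\<le>k. submodule (Ns i) R M"
      "\<forall>i<k. Ns i \<subseteq> Ns (Suc i) \<and>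
        simple_module R (quotient_module (M\<lparr>carrier := Ns (Suc i)\<rparr>) (Ns i))"
    using series by (auto simp: has_composition_series_def)
  interpret N': left_module R "M\<lparr>carrier := N'\<rparr>"
    by (rule left_module_restrict[OF N'])
  have "simple_module R (quotient_module (M\<lparr>carrier := N'\<rparr>) N)"
    using Ns sub maximal
    by (intro N'.simple_quotient) (auto simp: submodule_restrict_iff[OF N'])
  then have "\<forall>i<Suc k. (Ns(Suc k := N')) i \<subseteq> (Ns(Suc k := N')) (Suc i) \<and>
        simple_module R (quotient_module (M\<lparr>carrier := (Ns(Suc k := N')) (Suc i)\<rparr>) ((Ns(Suc k := N')) i))"
    using Ns sub by (auto simp: less_Suc_eq)
  then show ?thesis
    unfolding has_composition_series_def using Ns N'
    by (intro exI[of _ "Suc k"] exI[of _ "Ns(Suc k := N')"]) (auto simp: le_Suc_eq)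
qed

end


subsection \<open>Isomorphisms\<close>

lemma module_isomorphic_trans:
  assumes "module_isomorphic R M N" "module_isomorphic R N K"
  shows "module_isomorphic R M K"
proof -
  obtain \<phi> where bij: "bij_betw \<phi> (carrier M) (carrier N)"
    and hom: "\<forall>x\<in>carrier M. \<forall>y\<in>carrier M. \<phi> (x \<oplus>\<^bsub>M\<^esub> y) = \<phi> x \<oplus>\<^bsub>N\<^esub> \<phi> y"
      "\<forall>a\<in>carrier R. \<forall>x\<in>carrier M. \<phi> (a \<odot>\<^bsub>M\<^esub> x) = a \<odot>\<^bsub>N\<^esub> \<phi> x"
    using assms(1) unfolding module_isomorphic_def by blast
  obtain \<psi> where bij': "bij_betw \<psi> (carrier N) (carrier K)"
    and hom': "\<forall>x\<in>carrier N. \<forall>y\<in>carrier N. \<psi> (x \<oplus>\<^bsub>N\<^esub> y) = \<psi> x \<oplus>\<^bsub>K\<^esub> \<psi> y"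
      "\<forall>a\<in>carrier R. \<forall>x\<in>carrier N. \<psi> (a \<odot>\<^bsub>N\<^esub> x) = a \<odot>\<^bsub>K\<^esub> \<psi> x"
    using assms(2) unfolding module_isomorphic_def by blast
  have "\<phi> x \<in> carrier N" if "x \<in> carrier M" for x
    using that bij by (auto simp: bij_betw_def)
  then show ?thesis
    unfolding module_isomorphic_def using bij_betw_trans[OF bij bij'] hom hom'
    by (intro exI[of _ "\<psi> \<circ> \<phi>"]) auto
qed

text \<open>Both modules are the quotient of \<open>R\<close> by the common annihilator of the generators.\<close>

lemma cyclic_modules_isomorphic:
  assumes "left_module R M" "left_module R N" and v: "v \<in> carrier M" and w: "w \<in> carrier N"
    and "left_module.cyclic R M v = carrier M" and "left_module.cyclic R N w = carrier N"
    and ann: "\<And>a. a \<in> carrier R \<Longrightarrow> a \<odot>\<^bsub>M\<^esub> v = \<zero>\<^bsub>M\<^esub> \<longleftrightarrow> a \<odot>\<^bsub>N\<^esub> w = \<zero>\<^bsub>N\<^esub>"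
  shows "module_isomorphic R M N"
proof -
  interpret M: left_module R M by fact
  interpret N: left_module R N by fact
  have M_eq: "carrier M = (\<lambda>a. a \<odot>\<^bsub>M\<^esub> v) ` carrier R"
    and N_eq: "carrier N = (\<lambda>a. a \<odot>\<^bsub>N\<^esub> w) ` carrier R"
    using assms(5,6) by (simp_all add: M.cyclic_def N.cyclic_def)
  have eq_iff: "a \<odot>\<^bsub>M\<^esub> v = b \<odot>\<^bsub>M\<^esub> v \<longleftrightarrow> a \<odot>\<^bsub>N\<^esub> w = b \<odot>\<^bsub>N\<^esub> w" if "a \<in> carrier R" "b \<in> carrier R" for a b
  proof -
    have "a \<odot>\<^bsub>M\<^esub> v = b \<odot>\<^bsub>M\<^esub> v \<longleftrightarrow> (a \<ominus>\<^bsub>R\<^esub> b) \<odot>\<^bsub>M\<^esub> v = \<zero>\<^bsub>M\<^esub>"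
      using that v by (simp add: M.smult_l_diff M.smult_closed M.diff_eq_zero_iff)
    also have "\<dots> \<longleftrightarrow> (a \<ominus>\<^bsub>R\<^esub> b) \<odot>\<^bsub>N\<^esub> w = \<zero>\<^bsub>N\<^esub>"
      using that by (intro ann) simp
    also have "\<dots> \<longleftrightarrow> a \<odot>\<^bsub>N\<^esub> w = b \<odot>\<^bsub>N\<^esub> w"
      using that w by (simp add: N.smult_l_diff N.smult_closed N.diff_eq_zero_iff)
    finally show ?thesis .
  qed
  define \<phi> where "\<phi> m = (SOME a. a \<in> carrier R \<and> a \<odot>\<^bsub>M\<^esub> v = m) \<odot>\<^bsub>N\<^esub> w" for m
  have \<phi>: "\<phi> (a \<odot>\<^bsub>M\<^esub> v) = a \<odot>\<^bsub>N\<^esub> w" if "a \<in> carrier R" for a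
  proof -
    have "\<exists>b. b \<in> carrier R \<and> b \<odot>\<^bsub>M\<^esub> v = a \<odot>\<^bsub>M\<^esub> v"
      using that by blast
    from someI_ex[OF this] show ?thesis
      unfolding \<phi>_def using that eq_iff by blast
  qed
  have "bij_betw \<phi> (carrier M) (carrier N)"
    unfolding bij_betw_def inj_on_def M_eq N_eq by (auto simp: \<phi> eq_iff image_image)
  moreover have "\<phi> (x \<oplus>\<^bsub>M\<^esub> y) = \<phi> x \<oplus>\<^bsub>N\<^esub> \<phi> y" if xy: "x \<in> carrier M" "y \<in> carrier M" for x y
  proof -
    obtain a b where "a \<in> carrier R" "b \<in> carrier R" "x = a \<odot>\<^bsub>M\<^esub> v" "y = b \<odot>\<^bsub>M\<^esub> v"
      using xy unfolding M_eq by blast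
    then show ?thesis
      using v w \<phi>[of "a \<oplus>\<^bsub>R\<^esub> b"] by (simp add: \<phi> M.smult_l_distr N.smult_l_distr)
  qed
  moreover have "\<phi> (a \<odot>\<^bsub>M\<^esub> x) = a \<odot>\<^bsub>N\<^esub> \<phi> x" if ax: "a \<in> carrier R" "x \<in> carrier M" for a x
  proof -
    obtain b where "b \<in> carrier R" "x = b \<odot>\<^bsub>M\<^esub> v"
      using ax unfolding M_eq by blast
    then show ?thesis
      using ax v w \<phi>[of "a \<otimes>\<^bsub>R\<^esub> b"] by (simp add: \<phi> M.smult_assoc1 N.smult_assoc1)
  qed
  ultimately show ?thesis
    unfolding module_isomorphic_def by blast
qed

lemma finite_direct_sum_cong:
  assumes "\<And>i. i < k \<Longrightarrow> module_isomorphic R (Ms i) (Ns i)"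
  shows "module_isomorphic R (finite_direct_sum k Ms) (finite_direct_sum k Ns)"
proof -
  have "\<exists>\<phi>. bij_betw \<phi> (carrier (Ms i)) (carrier (Ns i)) \<and>
      (\<forall>x\<in>carrier (Ms i). \<forall>y\<in>carrier (Ms i). \<phi> (x \<oplus>\<^bsub>Ms i\<^esub> y) = \<phi> x \<oplus>\<^bsub>Ns i\<^esub> \<phi> y) \<and>
      (\<forall>a\<in>carrier R. \<forall>x\<in>carrier (Ms i). \<phi> (a \<odot>\<^bsub>Ms i\<^esub> x) = a \<odot>\<^bsub>Ns i\<^esub> \<phi> x)" if "i < k" for i
    using assms[OF that] by (simp add: module_isomorphic_def)
  then obtain \<phi> where \<phi>: "\<And>i. i < k \<Longrightarrow> bij_betw (\<phi> i) (carrier (Ms i)) (carrier (Ns i)) \<and>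
      (\<forall>x\<in>carrier (Ms i). \<forall>y\<in>carrier (Ms i). \<phi> i (x \<oplus>\<^bsub>Ms i\<^esub> y) = \<phi> i x \<oplus>\<^bsub>Ns i\<^esub> \<phi> i y) \<and>
      (\<forall>a\<in>carrier R. \<forall>x\<in>carrier (Ms i). \<phi> i (a \<odot>\<^bsub>Ms i\<^esub> x) = a \<odot>\<^bsub>Ns i\<^esub> \<phi> i x)"
    by metis
  have \<phi>_in: "\<phi> i x \<in> carrier (Ns i)" if "i < k" "x \<in> carrier (Ms i)" for i x
    using \<phi>[OF that(1)] that(2) by (blast dest: bij_betwE)
  let ?\<Phi> = "\<lambda>f. \<lambda>i\<in>{..<k}. \<phi> i (f i)"
  have "bij_betw ?\<Phi> (\<Pi>\<^sub>E i\<in>{..<k}. carrier (Ms i)) (\<Pi>\<^sub>E i\<in>{..<k}. carrier (Ns i))"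
  proof (rule bij_betw_byWitness[where f' = "\<lambda>g. \<lambda>i\<in>{..<k}. the_inv_into (carrier (Ms i)) (\<phi> i) (g i)"])
    show "\<forall>f\<in>\<Pi>\<^sub>E i\<in>{..<k}. carrier (Ms i). (\<lambda>i\<in>{..<k}. the_inv_into (carrier (Ms i)) (\<phi> i) (?\<Phi> f i)) = f"
      using \<phi> by (auto simp: fun_eq_iff restrict_def PiE_iff extensional_def bij_betw_def the_inv_into_f_f)
    show "\<forall>g\<in>\<Pi>\<^sub>E i\<in>{..<k}. carrier (Ns i). ?\<Phi> (\<lambda>i\<in>{..<k}. the_inv_into (carrier (Ms i)) (\<phi> i) (g i)) = g"
      using \<phi> by (auto simp: fun_eq_iff restrict_def PiE_iff extensional_def bij_betw_def f_the_inv_into_f)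
    show "?\<Phi> ` (\<Pi>\<^sub>E i\<in>{..<k}. carrier (Ms i)) \<subseteq> (\<Pi>\<^sub>E i\<in>{..<k}. carrier (Ns i))"
      using \<phi>_in by (auto simp: PiE_iff)
    show "(\<lambda>g. \<lambda>i\<in>{..<k}. the_inv_into (carrier (Ms i)) (\<phi> i) (g i)) ` (\<Pi>\<^sub>E i\<in>{..<k}. carrier (Ns i))
        \<subseteq> (\<Pi>\<^sub>E i\<in>{..<k}. carrier (Ms i))"
      using \<phi> by (auto simp: PiE_iff bij_betw_def intro!: the_inv_into_into)
  qed
  then show ?thesis
    unfolding module_isomorphic_def using \<phi>
    by (intro exI[of _ ?\<Phi>]) (auto simp: finite_direct_sum_def fun_eq_iff restrict_def PiE_iff)
qed


subsection \<open>Internal direct sums\<close>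

context left_module
begin

text \<open>The families in the domain of the sum map are those in the carrier of a \<^const>\<open>finite_direct_sum\<close>.\<close>

definition is_direct_sum :: "'m set \<Rightarrow> nat \<Rightarrow> (nat \<Rightarrow> 'm set) \<Rightarrow> bool" where
  "is_direct_sum N k U \<longleftrightarrow> (\<forall>i<k. submodule (U i) R M) \<and>
     bij_betw (\<lambda>f. \<Oplus>\<^bsub>M\<^esub>i\<in>{..<k}. f i) (\<Pi>\<^sub>E i\<in>{..<k}. U i) N"

lemma is_direct_sum_zero: "is_direct_sum {\<zero>\<^bsub>M\<^esub>} 0 U"
  by (simp add: is_direct_sum_def bij_betw_def)

lemma is_direct_sum_extend:
  assumes N: "submodule N R M" and V: "submodule V R M" and disjoint: "N \<inter> V = {\<zero>\<^bsub>M\<^esub>}"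
    and U: "is_direct_sum N k U"
  shows "is_direct_sum (N <+>\<^bsub>M\<^esub> V) (Suc k) (U(k := V))"
proof -
  let ?s = "\<lambda>k f. \<Oplus>\<^bsub>M\<^esub>i\<in>{..<k}. f i"
  let ?P = "\<Pi>\<^sub>E i\<in>{..<Suc k}. (U(k := V)) i"
  have bij: "bij_betw (?s k) (\<Pi>\<^sub>E i\<in>{..<k}. U i) N" and sub_U: "\<And>i. i < k \<Longrightarrow> submodule (U i) R M"
    using U by (auto simp: is_direct_sum_def)
  have f_in: "f i \<in> carrier M" if "f \<in> ?P" "i \<le> k" for f i
  proof -
    have "f i \<in> (if i = k then V else U i)"
      using PiE_mem[OF that(1), of i] that(2) by simp
    then show ?thesis
      using that(2) sub_U[of i] V by (cases "i = k") (auto intro: submodule_subset)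
  qed
  have fk: "f k \<in> V" if "f \<in> ?P" for f
    using PiE_mem[OF that, of k] by simp
  have res: "restrict f {..<k} \<in> (\<Pi>\<^sub>E i\<in>{..<k}. U i)" if "f \<in> ?P" for f
  proof -
    have "f i \<in> U i" if "i < k" for i
      using PiE_mem[OF \<open>f \<in> ?P\<close>, of i] that by simp
    then show ?thesis
      by simp
  qed
  have res_sum: "?s k (restrict f {..<k}) = ?s k f" if "f \<in> ?P" for f
    using that f_in by (intro M.finsum_cong') auto
  have sum_N: "?s k f \<in> N" if "f \<in> ?P" for f
    using bij res[OF that] res_sum[OF that] by (metis bij_betwE)
  have sum_Suc: "?s (Suc k) f = f k \<oplus>\<^bsub>M\<^esub> ?s k f" if "f \<in> ?P" for f
    using that f_in by (simp add: lessThan_Suc)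
  have "inj_on (?s (Suc k)) ?P"
  proof (rule inj_onI)
    fix f g assume f: "f \<in> ?P" and g: "g \<in> ?P" and eq: "?s (Suc k) f = ?s (Suc k) g"
    have carr: "f k \<in> carrier M" "g k \<in> carrier M" "?s k f \<in> carrier M" "?s k g \<in> carrier M"
      using f g f_in sum_N submodule_subset[OF N] by auto
    have eq': "f k \<oplus>\<^bsub>M\<^esub> ?s k f = g k \<oplus>\<^bsub>M\<^esub> ?s k g"
      using eq f g by (simp add: sum_Suc)
    have "f k \<ominus>\<^bsub>M\<^esub> g k = (f k \<oplus>\<^bsub>M\<^esub> ?s k f) \<ominus>\<^bsub>M\<^esub> (g k \<oplus>\<^bsub>M\<^esub> ?s k f)"
      using carr by (simp add: a_minus_def M.minus_add M.a_ac M.r_neg2 M.r_neg1 M.r_neg)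
    also have "\<dots> = ?s k g \<ominus>\<^bsub>M\<^esub> ?s k f"
      unfolding eq' using carr by (simp add: a_minus_def M.minus_add M.a_ac M.r_neg2 M.r_neg1 M.r_neg)
    finally have diff: "f k \<ominus>\<^bsub>M\<^esub> g k = ?s k g \<ominus>\<^bsub>M\<^esub> ?s k f" .
    have "f k \<ominus>\<^bsub>M\<^esub> g k \<in> V" "?s k g \<ominus>\<^bsub>M\<^esub> ?s k f \<in> N"
      using f g fk sum_N submodule_minus[OF V] submodule_minus[OF N] by auto
    then have "f k \<ominus>\<^bsub>M\<^esub> g k = \<zero>\<^bsub>M\<^esub>" "?s k g \<ominus>\<^bsub>M\<^esub> ?s k f = \<zero>\<^bsub>M\<^esub>"
      using disjoint diff by auto
    then have k_eq: "f k = g k" and "?s k g = ?s k f"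
      using carr by (simp_all add: diff_eq_zero_iff)
    then have "?s k (restrict f {..<k}) = ?s k (restrict g {..<k})"
      using f g res_sum by simp
    then have "restrict f {..<k} = restrict g {..<k}"
      using inj_onD[OF bij_betw_imp_inj_on[OF bij]] res[OF f] res[OF g] by blast
    then have "f i = g i" if "i < k" for i
      using that by (metis lessThan_iff restrict_apply')
    then show "f = g"
      using k_eq f g by (intro PiE_ext[of f "{..<Suc k}" _ g]) (auto simp: less_Suc_eq)
  qed
  moreover have "?s (Suc k) ` ?P = N <+>\<^bsub>M\<^esub> V"
  proof
    show "?s (Suc k) ` ?P \<subseteq> N <+>\<^bsub>M\<^esub> V"
    proof
      fix m assume "m \<in> ?s (Suc k) ` ?P"
      then obtain f where f: "f \<in> ?P" "m = ?s (Suc k) f"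
        by blast
      then have "m = ?s k f \<oplus>\<^bsub>M\<^esub> f k"
        using f_in sum_N submodule_subset[OF N] sum_Suc M.a_comm by simp
      then show "m \<in> N <+>\<^bsub>M\<^esub> V"
        using f fk sum_N unfolding set_add_def' by blast
    qed
    show "N <+>\<^bsub>M\<^esub> V \<subseteq> ?s (Suc k) ` ?P"
    proof
      fix m assume "m \<in> N <+>\<^bsub>M\<^esub> V"
      then obtain n v where m: "n \<in> N" "v \<in> V" "m = n \<oplus>\<^bsub>M\<^esub> v"
        by (auto simp: set_add_def')
      obtain f where f: "f \<in> (\<Pi>\<^sub>E i\<in>{..<k}. U i)" "n = ?s k f"
        using bij m by (auto simp: bij_betw_def)
      have fv: "f(k := v) \<in> ?P"
        using f m by (auto simp: PiE_iff extensional_def less_Suc_eq)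
      have "?s k (f(k := v)) = ?s k f"
      proof (rule M.finsum_cong')
        show "f \<in> {..<k} \<rightarrow> carrier M"
          using f sub_U by (auto simp: PiE_iff intro: submodule_subset)
      qed auto
      then have "?s (Suc k) (f(k := v)) = m"
        using fv f m submodule_subset[OF N] submodule_subset[OF V] sum_Suc[OF fv] M.a_comm by simp
      then show "m \<in> ?s (Suc k) ` ?P"
        using fv by blast
    qed
  qed
  ultimately show ?thesis
    using sub_U V by (auto simp: is_direct_sum_def bij_betw_def less_Suc_eq)
qed

lemma is_direct_sum_isomorphic:
  assumes "is_direct_sum (carrier M) k U"
  shows "module_isomorphic R M (finite_direct_sum k (\<lambda>i. M\<lparr>carrier := U i\<rparr>))"
proof -
  let ?s = "\<lambda>f. \<Oplus>\<^bsub>M\<^esub>i\<in>{..<k}. f i"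
  let ?S = "finite_direct_sum k (\<lambda>i. M\<lparr>carrier := U i\<rparr>)"
  have bij: "bij_betw ?s (carrier ?S) (carrier M)" and sub: "\<And>i. i < k \<Longrightarrow> submodule (U i) R M"
    using assms by (auto simp: is_direct_sum_def finite_direct_sum_def)
  let ?\<psi> = "the_inv_into (carrier ?S) ?s"
  have inj: "inj_on ?s (carrier ?S)" and im: "?s ` carrier ?S = carrier M"
    using bij by (auto simp: bij_betw_def)
  have \<psi>: "?\<psi> (?s f) = f" if "f \<in> carrier ?S" for f
    using that inj by (intro the_inv_into_f_f)
  have in_U: "f i \<in> U i" if "f \<in> carrier ?S" "i < k" for f i
    using that by (auto simp: finite_direct_sum_def)
  have in_M: "f i \<in> carrier M" if "f \<in> carrier ?S" "i < k" for f i
    using in_U[OF that] sub[OF that(2)] submodule_subset by blast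
  have "?\<psi> (?s f \<oplus>\<^bsub>M\<^esub> ?s g) = ?\<psi> (?s f) \<oplus>\<^bsub>?S\<^esub> ?\<psi> (?s g)"
    if fg: "f \<in> carrier ?S" "g \<in> carrier ?S" for f g
  proof -
    have closed: "f \<oplus>\<^bsub>?S\<^esub> g \<in> carrier ?S"
      using fg sub by (auto simp: finite_direct_sum_def submodule_iff PiE_iff)
    have "?s (f \<oplus>\<^bsub>?S\<^esub> g) = (\<Oplus>\<^bsub>M\<^esub>i\<in>{..<k}. f i \<oplus>\<^bsub>M\<^esub> g i)"
      using fg in_M by (intro M.finsum_cong') (auto simp: finite_direct_sum_def)
    also have "\<dots> = ?s f \<oplus>\<^bsub>M\<^esub> ?s g"
      using fg in_M by (intro M.finsum_addf) auto
    finally show ?thesis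
      using fg closed \<psi> by metis
  qed
  moreover have "?\<psi> (a \<odot>\<^bsub>M\<^esub> ?s f) = a \<odot>\<^bsub>?S\<^esub> ?\<psi> (?s f)"
    if a: "a \<in> carrier R" and f: "f \<in> carrier ?S" for a f
  proof -
    have closed: "a \<odot>\<^bsub>?S\<^esub> f \<in> carrier ?S"
      using a f sub by (auto simp: finite_direct_sum_def submodule_iff PiE_iff)
    have "?s (a \<odot>\<^bsub>?S\<^esub> f) = (\<Oplus>\<^bsub>M\<^esub>i\<in>{..<k}. a \<odot>\<^bsub>M\<^esub> f i)"
      using a f in_M by (intro M.finsum_cong') (auto simp: finite_direct_sum_def smult_closed)
    also have "\<dots> = a \<odot>\<^bsub>M\<^esub> ?s f"
      using a f in_M by (intro smult_finsum[symmetric]) auto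
    finally show ?thesis
      using f closed \<psi> by metis
  qed
  moreover have "bij_betw ?\<psi> (carrier M) (carrier ?S)"
    using bij by (rule bij_betw_the_inv_into)
  ultimately show ?thesis
    unfolding module_isomorphic_def im[symmetric] by blast
qed

end


section \<open>Modules over a complex algebra\<close>

text \<open>Elimination: an equation in which some unknown occurs is solved for that unknown, and the unknown is
  substituted in the other equations.\<close>

lemma underdetermined_system:
  fixes a :: "'i \<Rightarrow> 's \<Rightarrow> complex"
  assumes "finite S" "finite I" "card S < card I"
  shows "\<exists>d. (\<exists>i\<in>I. d i \<noteq> 0) \<and> (\<forall>s\<in>S. (\<Sum>i\<in>I. d i * a i s) = 0)"
  using assms
proof (induction S arbitrary: I a rule: finite_induct)
  case empty
  then have "I \<noteq> {}"
    by auto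
  then show ?case
    by (intro exI[of _ "\<lambda>_. 1"]) auto
next
  case (insert s S)
  show ?case
  proof (cases "\<forall>i\<in>I. a i s = 0")
    case True
    obtain d where "\<exists>i\<in>I. d i \<noteq> 0" "\<forall>t\<in>S. (\<Sum>i\<in>I. d i * a i t) = 0"
      using insert.IH[of I a] insert.prems insert.hyps by auto
    then show ?thesis
      using True by (intro exI[of _ d]) auto
  next
    case False
    then obtain j where j: "j \<in> I" "a j s \<noteq> 0"
      by blast
    let ?I = "I - {j}"
    define b where "b i t = a i t - a i s / a j s * a j t" for i t
    have "card S < card ?I"
      using insert.prems insert.hyps j by auto
    then obtain d where d: "\<exists>i\<in>?I. d i \<noteq> 0" "\<forall>t\<in>S. (\<Sum>i\<in>?I. d i * b i t) = 0"
      using insert.IH[of ?I b] insert.prems by auto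
    define d' where "d' = d(j := - (\<Sum>i\<in>?I. d i * a i s) / a j s)"
    have sum_d': "(\<Sum>i\<in>I. d' i * a i t) = d' j * a j t + (\<Sum>i\<in>?I. d i * a i t)" for t
    proof -
      have "(\<Sum>i\<in>I. d' i * a i t) = d' j * a j t + (\<Sum>i\<in>?I. d' i * a i t)"
        using insert.prems j by (intro sum.remove) auto
      also have "(\<Sum>i\<in>?I. d' i * a i t) = (\<Sum>i\<in>?I. d i * a i t)"
        by (intro sum.cong) (auto simp: d'_def)
      finally show ?thesis .
    qed
    have "(\<Sum>i\<in>I. d' i * a i t) = 0" if "t \<in> S" for t
    proof -
      have "0 = (\<Sum>i\<in>?I. d i * b i t)"
        using d that by auto
      also have "\<dots> = (\<Sum>i\<in>?I. d i * a i t) - (\<Sum>i\<in>?I. d i * a i s) / a j s * a j t"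
        by (simp add: b_def algebra_simps sum_subtractf sum_distrib_left sum_divide_distrib)
      finally show ?thesis
        unfolding sum_d' by (simp add: d'_def)
    qed
    moreover have "(\<Sum>i\<in>I. d' i * a i s) = 0"
      unfolding sum_d' using j by (simp add: d'_def)
    moreover have "\<exists>i\<in>I. d' i \<noteq> 0"
      using d by (auto simp: d'_def)
    ultimately show ?thesis
      by (intro exI[of _ d']) auto
  qed
qed

locale algebra_module = left_module R M
  for R :: "'h ring" (structure) and M :: "('h, 'm) module" (structure) +
  fixes \<iota> :: "complex \<Rightarrow> 'h"
  assumes scalar_closed [simp]: "\<iota> c \<in> carrier R"
    and scalar_add: "\<iota> (c + d) = \<iota> c \<oplus> \<iota> d"
    and scalar_mult: "\<iota> (c * d) = \<iota> c \<otimes> \<iota> d"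
    and scalar_one: "\<iota> 1 = \<one>"
    and scalar_central: "a \<in> carrier R \<Longrightarrow> \<iota> c \<otimes> a = a \<otimes> \<iota> c"
begin

abbreviation cscale :: "complex \<Rightarrow> 'm \<Rightarrow> 'm" (infixr \<open>\<cdot>\<close> 75) where
  "c \<cdot> v \<equiv> \<iota> c \<odot>\<^bsub>M\<^esub> v"

lemma cscale_closed [simp]: "v \<in> carrier M \<Longrightarrow> c \<cdot> v \<in> carrier M"
  by (simp add: smult_closed)

lemma scalar_zero: "\<iota> 0 = \<zero>"
proof -
  have "\<iota> 0 \<oplus> \<iota> 0 = \<iota> 0"
    using scalar_add[of 0 0] by simp
  then show ?thesis
    by (simp add: R.add.l_cancel_one)
qed

lemma cscale_zero [simp]: "v \<in> carrier M \<Longrightarrow> 0 \<cdot> v = \<zero>\<^bsub>M\<^esub>"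
  by (simp add: scalar_zero)

lemma cscale_one [simp]: "v \<in> carrier M \<Longrightarrow> 1 \<cdot> v = v"
  by (simp add: scalar_one smult_one)

lemma cscale_add: "v \<in> carrier M \<Longrightarrow> (c + d) \<cdot> v = c \<cdot> v \<oplus>\<^bsub>M\<^esub> d \<cdot> v"
  by (simp add: scalar_add smult_l_distr)

lemma cscale_cscale [simp]: "v \<in> carrier M \<Longrightarrow> c \<cdot> d \<cdot> v = (c * d) \<cdot> v"
  by (simp add: scalar_mult smult_assoc1)

lemma cscale_uminus: "v \<in> carrier M \<Longrightarrow> (- c) \<cdot> v = \<ominus>\<^bsub>M\<^esub> (c \<cdot> v)"
proof -
  assume v: "v \<in> carrier M"
  have "(- c) \<cdot> v \<oplus>\<^bsub>M\<^esub> c \<cdot> v = \<zero>\<^bsub>M\<^esub>"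
    using cscale_add[OF v, of "- c" c] v by simp
  then show ?thesis
    using v by (metis M.minus_equality cscale_closed)
qed

lemma cscale_diff: "v \<in> carrier M \<Longrightarrow> (c - d) \<cdot> v = c \<cdot> v \<ominus>\<^bsub>M\<^esub> d \<cdot> v"
  using cscale_add[of v c "- d"] by (simp add: cscale_uminus a_minus_def)

lemma smult_cscale: "a \<in> carrier R \<Longrightarrow> v \<in> carrier M \<Longrightarrow> a \<odot>\<^bsub>M\<^esub> c \<cdot> v = c \<cdot> (a \<odot>\<^bsub>M\<^esub> v)"
  by (metis scalar_central scalar_closed smult_assoc1)

definition subspace :: "'m set \<Rightarrow> bool" where
  "subspace V \<longleftrightarrow> V \<subseteq> carrier M \<and> \<zero>\<^bsub>M\<^esub> \<in> V \<and> (\<forall>x\<in>V. \<forall>y\<in>V. x \<oplus>\<^bsub>M\<^esub> y \<in> V) \<and>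
     (\<forall>c. \<forall>x\<in>V. c \<cdot> x \<in> V)"

lemma submodule_subspace: "submodule N R M \<Longrightarrow> subspace N"
  by (auto simp: submodule_iff subspace_def)

lemma subspace_finsum:
  assumes "subspace V" "f \<in> I \<rightarrow> V"
  shows "finsum M f I \<in> V"
  using assms(2)
proof (induction I rule: infinite_finite_induct)
  case (insert i I)
  then have "f \<in> I \<rightarrow> carrier M" "f i \<in> carrier M"
    using assms(1) by (auto simp: subspace_def)
  then show ?case
    using insert assms(1) by (simp add: Pi_iff subspace_def)
qed (use assms(1) in \<open>simp_all add: M.finsum_infinite subspace_def\<close>)

lemma subspace_diff:
  assumes "subspace V" "x \<in> V" "y \<in> V"
  shows "x \<ominus>\<^bsub>M\<^esub> y \<in> V"
proof -
  have "x \<in> carrier M" "y \<in> carrier M"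
    using assms by (auto simp: subspace_def)
  then have "x \<ominus>\<^bsub>M\<^esub> y = x \<oplus>\<^bsub>M\<^esub> (- 1) \<cdot> y"
    by (simp add: a_minus_def cscale_uminus)
  then show ?thesis
    using assms by (simp add: subspace_def)
qed

lemma subspace_cscale_iff:
  assumes V: "subspace V" and "x \<in> carrier M" "c \<noteq> 0"
  shows "c \<cdot> x \<in> V \<longleftrightarrow> x \<in> V"
proof
  assume "c \<cdot> x \<in> V"
  then have "(1 / c) \<cdot> c \<cdot> x \<in> V"
    using V by (simp add: subspace_def del: cscale_cscale)
  then show "x \<in> V"
    using assms by simp
qed (use V in \<open>simp add: subspace_def\<close>)

definition lin :: "'m set \<Rightarrow> 'm set" where
  "lin S = range (\<lambda>c. \<Oplus>\<^bsub>M\<^esub>s\<in>S. c s \<cdot> s)"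

lemma finite_dim_iff: "finite_dim \<iota> M V \<longleftrightarrow> (\<exists>S. finite S \<and> S \<subseteq> V \<and> V \<subseteq> lin S)"
  by (auto simp: finite_dim_def lin_def image_iff subset_iff)

lemma lin_I: "v = (\<Oplus>\<^bsub>M\<^esub>s\<in>S. c s \<cdot> s) \<Longrightarrow> v \<in> lin S"
  by (simp add: lin_def)

lemma subspace_lin:
  assumes S: "S \<subseteq> carrier M"
  shows "subspace (lin S)"
  unfolding subspace_def
proof (intro conjI ballI allI)
  show "lin S \<subseteq> carrier M"
    using S by (auto simp: lin_def intro!: M.finsum_closed)
  have "(\<Oplus>\<^bsub>M\<^esub>s\<in>S. 0 \<cdot> s) = (\<Oplus>\<^bsub>M\<^esub>s\<in>S. \<zero>\<^bsub>M\<^esub>)"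
    using S by (intro M.finsum_cong') auto
  then show "\<zero>\<^bsub>M\<^esub> \<in> lin S"
    unfolding lin_def by (auto simp: image_iff intro!: exI[of _ "\<lambda>_. 0"])
next
  fix x y assume "x \<in> lin S" "y \<in> lin S"
  then obtain c d where xy: "x = (\<Oplus>\<^bsub>M\<^esub>s\<in>S. c s \<cdot> s)" "y = (\<Oplus>\<^bsub>M\<^esub>s\<in>S. d s \<cdot> s)"
    by (auto simp: lin_def)
  have "(\<Oplus>\<^bsub>M\<^esub>s\<in>S. (c s + d s) \<cdot> s) = (\<Oplus>\<^bsub>M\<^esub>s\<in>S. c s \<cdot> s \<oplus>\<^bsub>M\<^esub> d s \<cdot> s)"
    using S by (intro M.finsum_cong') (auto simp: cscale_add)
  also have "\<dots> = x \<oplus>\<^bsub>M\<^esub> y"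
    unfolding xy using S by (intro M.finsum_addf) auto
  finally show "x \<oplus>\<^bsub>M\<^esub> y \<in> lin S"
    by (intro lin_I[of _ "\<lambda>s. c s + d s"]) simp
next
  fix c x assume "x \<in> lin S"
  then obtain d where x: "x = (\<Oplus>\<^bsub>M\<^esub>s\<in>S. d s \<cdot> s)"
    by (auto simp: lin_def)
  have "(\<Oplus>\<^bsub>M\<^esub>s\<in>S. (c * d s) \<cdot> s) = (\<Oplus>\<^bsub>M\<^esub>s\<in>S. c \<cdot> d s \<cdot> s)"
    using S by (intro M.finsum_cong') auto
  also have "\<dots> = c \<cdot> x"
    unfolding x using S by (intro smult_finsum[symmetric]) auto
  finally show "c \<cdot> x \<in> lin S"
    by (intro lin_I[of _ "\<lambda>s. c * d s"]) simp
qed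

lemma lin_superset:
  assumes "finite S" "S \<subseteq> carrier M" "v \<in> S"
  shows "v \<in> lin S"
proof -
  have "(\<Oplus>\<^bsub>M\<^esub>s\<in>S. (if s = v then 1 else 0) \<cdot> s) = (\<Oplus>\<^bsub>M\<^esub>s\<in>S. if v = s then s else \<zero>\<^bsub>M\<^esub>)"
    using assms by (intro M.finsum_cong') auto
  also have "\<dots> = v"
    using assms by (intro M.add.finprod_singleton) auto
  finally show ?thesis
    by (intro lin_I[of _ "\<lambda>s. if s = v then 1 else 0"]) simp
qed

lemma lin_least: "subspace V \<Longrightarrow> S \<subseteq> V \<Longrightarrow> lin S \<subseteq> V"
  by (auto simp: lin_def subspace_def intro!: subspace_finsum)

lemma lin_mono:
  assumes "finite S'" "S \<subseteq> S'" "S' \<subseteq> carrier M"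
  shows "lin S \<subseteq> lin S'"
  using assms by (intro lin_least subspace_lin) (auto intro: lin_superset)

lemma finsum_combine:
  assumes "finite I" "S \<subseteq> carrier M"
  shows "(\<Oplus>\<^bsub>M\<^esub>i\<in>I. d i \<cdot> (\<Oplus>\<^bsub>M\<^esub>s\<in>S. c i s \<cdot> s)) = (\<Oplus>\<^bsub>M\<^esub>s\<in>S. (\<Sum>i\<in>I. d i * c i s) \<cdot> s)"
  using assms(1)
proof induction
  case empty
  have "(\<Oplus>\<^bsub>M\<^esub>s\<in>S. 0 \<cdot> s) = (\<Oplus>\<^bsub>M\<^esub>s\<in>S. \<zero>\<^bsub>M\<^esub>)"
    using assms by (intro M.finsum_cong') auto
  then show ?case
    by simp
next
  case (insert i I)
  have closed: "(\<Oplus>\<^bsub>M\<^esub>s\<in>S. e s \<cdot> s) \<in> carrier M" for e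
    using assms by (intro M.finsum_closed) auto
  have "(\<Oplus>\<^bsub>M\<^esub>j\<in>insert i I. d j \<cdot> (\<Oplus>\<^bsub>M\<^esub>s\<in>S. c j s \<cdot> s)) =
      d i \<cdot> (\<Oplus>\<^bsub>M\<^esub>s\<in>S. c i s \<cdot> s) \<oplus>\<^bsub>M\<^esub> (\<Oplus>\<^bsub>M\<^esub>s\<in>S. (\<Sum>i\<in>I. d i * c i s) \<cdot> s)"
    using insert closed by simp
  also have "d i \<cdot> (\<Oplus>\<^bsub>M\<^esub>s\<in>S. c i s \<cdot> s) = (\<Oplus>\<^bsub>M\<^esub>s\<in>S. d i \<cdot> c i s \<cdot> s)"
    using assms by (intro smult_finsum) auto
  also have "\<dots> \<oplus>\<^bsub>M\<^esub> (\<Oplus>\<^bsub>M\<^esub>s\<in>S. (\<Sum>i\<in>I. d i * c i s) \<cdot> s) =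
      (\<Oplus>\<^bsub>M\<^esub>s\<in>S. d i \<cdot> c i s \<cdot> s \<oplus>\<^bsub>M\<^esub> (\<Sum>i\<in>I. d i * c i s) \<cdot> s)"
    using assms by (intro M.finsum_addf[symmetric]) auto
  also have "\<dots> = (\<Oplus>\<^bsub>M\<^esub>s\<in>S. (\<Sum>i\<in>insert i I. d i * c i s) \<cdot> s)"
    using assms insert by (intro M.finsum_cong') (auto simp: cscale_add)
  finally show ?case .
qed

text \<open>Dimension theory reduced to what is needed: a chain of subspaces that grows at each step by a vector
  \<open>v i\<close> of the finitely spanned space \<open>lin S\<close> cannot go on forever.\<close>

lemma no_infinite_chain:
  assumes S: "finite S" "S \<subseteq> carrier M" and W: "\<And>i. subspace (W i)" "\<And>i. W i \<subseteq> W (Suc i)"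
    and v: "\<And>i::nat. v i \<in> W (Suc i)" "\<And>i. v i \<notin> W i" "\<And>i. v i \<in> lin S"
  shows False
proof -
  have "\<exists>c. v i = (\<Oplus>\<^bsub>M\<^esub>s\<in>S. c s \<cdot> s)" for i
    using v(3)[of i] by (auto simp: lin_def)
  then obtain c where c: "v i = (\<Oplus>\<^bsub>M\<^esub>s\<in>S. c i s \<cdot> s)" for i
    by metis
  let ?I = "{..card S}"
  obtain d where d: "\<exists>i\<in>?I. d i \<noteq> 0" "\<forall>s\<in>S. (\<Sum>i\<in>?I. d i * c i s) = 0"
    using underdetermined_system[of S ?I c] S by auto
  let ?J = "{i \<in> ?I. d i \<noteq> 0}"
  \<comment> \<open>In a linear relation between the \<open>v i\<close>, the term with the largest index lies in the
    subspace that contains all the earlier vectors, which is impossible.\<close>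
  define j where "j = Max ?J"
  have "j \<in> ?J"
    unfolding j_def using d by (intro Max_in) auto
  then have j: "j \<in> ?I" "d j \<noteq> 0"
    by auto
  have above_j: "d i = 0" if "i \<in> ?I" "i > j" for i
  proof (rule ccontr)
    assume "d i \<noteq> 0"
    then have "i \<le> j"
      unfolding j_def using that by (intro Max_ge) auto
    then show False
      using that by simp
  qed
  have v_M: "v i \<in> carrier M" for i
    using v(1)[of i] W(1)[of "Suc i"] by (auto simp: subspace_def)
  have "(\<Oplus>\<^bsub>M\<^esub>i\<in>?I. d i \<cdot> v i) = (\<Oplus>\<^bsub>M\<^esub>s\<in>S. (\<Sum>i\<in>?I. d i * c i s) \<cdot> s)"
    unfolding c using S by (intro finsum_combine) auto
  also have "\<dots> = (\<Oplus>\<^bsub>M\<^esub>s\<in>S. \<zero>\<^bsub>M\<^esub>)"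
    using d S by (intro M.finsum_cong') auto
  finally have "(\<Oplus>\<^bsub>M\<^esub>i\<in>insert j (?I - {j}). d i \<cdot> v i) = \<zero>\<^bsub>M\<^esub>"
    using j by (simp add: insert_absorb)
  then have zero: "d j \<cdot> v j \<oplus>\<^bsub>M\<^esub> (\<Oplus>\<^bsub>M\<^esub>i\<in>?I - {j}. d i \<cdot> v i) = \<zero>\<^bsub>M\<^esub>"
    using v_M by (subst (asm) M.finsum_insert) auto
  have mono: "W i \<subseteq> W k" if "i \<le> k" for i k
    using W(2) that by (rule lift_Suc_mono_le)
  have rest: "(\<Oplus>\<^bsub>M\<^esub>i\<in>?I - {j}. d i \<cdot> v i) \<in> W j"
  proof (intro subspace_finsum W(1) Pi_I)
    fix i assume i: "i \<in> ?I - {j}"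
    show "d i \<cdot> v i \<in> W j"
    proof (cases "i < j")
      case True
      then have "v i \<in> W j"
        using v(1)[of i] mono[of "Suc i" j] by auto
      then show ?thesis
        using W(1)[of j] by (simp add: subspace_def)
    next
      case False
      then have "d i = 0"
        using i above_j[of i] by auto
      then show ?thesis
        using v_M W(1)[of j] by (simp add: subspace_def)
    qed
  qed
  let ?r = "\<Oplus>\<^bsub>M\<^esub>i\<in>?I - {j}. d i \<cdot> v i"
  have r_M: "?r \<in> carrier M"
    using rest W(1)[of j] by (auto simp: subspace_def)
  have "d j \<cdot> v j = \<ominus>\<^bsub>M\<^esub> ?r"
    using zero v_M r_M M.minus_equality[of "d j \<cdot> v j" ?r] by simp
  also have "\<dots> = \<zero>\<^bsub>M\<^esub> \<ominus>\<^bsub>M\<^esub> ?r"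
    using r_M by (simp add: a_minus_def)
  finally have "d j \<cdot> v j \<in> W j"
    using rest W(1)[of j] subspace_diff[of "W j" "\<zero>\<^bsub>M\<^esub>" ?r] by (simp add: subspace_def)
  then have "v j \<in> W j"
    using subspace_cscale_iff[OF W(1) v_M j(2)] by simp
  then show False
    using v(2) by blast
qed

text \<open>The termination argument in the form of an induction rule: to reach \<open>V\<close>, it is enough to be able to
  enlarge every other subspace satisfying \<open>P\<close> by some vector of \<open>lin S\<close>.\<close>

lemma ascending_induct [consumes 2, case_names subspace start extend]:
  assumes S: "finite S" "S \<subseteq> carrier M" and sub: "\<And>W. P W \<Longrightarrow> subspace W"
    and start: "P W0"
    and extend: "\<And>W. P W \<Longrightarrow> W \<noteq> V \<Longrightarrow> \<exists>W' v. P W' \<and> W \<subseteq> W' \<and> v \<in> W' \<and> v \<notin> W \<and> v \<in> lin S"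
  shows "P V"
proof (rule ccontr)
  assume "\<not> P V"
  then have not_V: "W \<noteq> V" if "P W" for W
    using that by auto
  have step: "\<exists>W'. P W' \<and> (W \<subseteq> W' \<and> (\<exists>v. v \<in> W' \<and> v \<notin> W \<and> v \<in> lin S))" if "P W" for W
    using extend[OF that not_V[OF that]] that by blast
  have "\<exists>W. \<forall>i. P (W i) \<and> (W i \<subseteq> W (Suc i) \<and> (\<exists>v. v \<in> W (Suc i) \<and> v \<notin> W i \<and> v \<in> lin S))"
  proof (rule dependent_nat_choice[of "\<lambda>_. P"])
    show "\<exists>W. P W"
      using start by (rule exI)
  qed (rule step)
  then obtain W where W: "\<And>i. P (W i)"
      "\<And>i. W i \<subseteq> W (Suc i) \<and> (\<exists>v. v \<in> W (Suc i) \<and> v \<notin> W i \<and> v \<in> lin S)"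
    by blast
  then obtain v where v: "\<And>i. v i \<in> W (Suc i) \<and> v i \<notin> W i \<and> v i \<in> lin S"
    by metis
  show False
    using no_infinite_chain[OF S, of W v] W v sub by blast
qed

lemma finite_dim_subspace:
  assumes S: "finite S" "S \<subseteq> carrier M" and V: "subspace V" "V \<subseteq> lin S"
  shows "finite_dim \<iota> M V"
proof -
  define P where "P W \<longleftrightarrow> (\<exists>F. finite F \<and> F \<subseteq> V \<and> W = lin F)" for W
  have V_M: "V \<subseteq> carrier M"
    using V by (auto simp: subspace_def)
  have "P V"
    using S
  proof (induction rule: ascending_induct)
    case (subspace W)
    then show ?case
      using V_M by (auto simp: P_def intro!: subspace_lin)
  next
    case start
    show "P (lin {})"
      by (auto simp: P_def)
  next
    case (extend W)
    then obtain F where F: "finite F" "F \<subseteq> V" "W = lin F"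
      by (auto simp: P_def)
    then obtain v where v: "v \<in> V" "v \<notin> W"
      using extend(2) lin_least[OF V(1) F(2)] by blast
    have "P (lin (insert v F))"
      unfolding P_def using F v by (intro exI[of _ "insert v F"]) auto
    moreover have "W \<subseteq> lin (insert v F)"
      unfolding F(3) using F v V_M by (intro lin_mono) auto
    moreover have "v \<in> lin (insert v F)"
      using F v V_M by (intro lin_superset) auto
    ultimately show ?case
      using v V by blast
  qed
  then show ?thesis
    unfolding P_def finite_dim_iff by blast
qed


subsection \<open>Separation of weights\<close>

text \<open>Vectors of different weights are independent, in a form relative to \<open>K\<close>. The operator \<open>a - \<alpha>\<^sub>j(a)\<close> kills
  the \<open>j\<close>-th vector modulo \<open>K\<close> and multiplies the \<open>i\<close>-th one by \<open>\<alpha>\<^sub>i(a) - \<alpha>\<^sub>j(a)\<close>, so it shortens the sum by one term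
  while the \<open>i\<close>-th term survives if \<open>a\<close> separates \<open>\<alpha>\<^sub>i\<close> from \<open>\<alpha>\<^sub>j\<close>.\<close>

lemma weights_separated:
  assumes K: "submodule K R M" and A: "A \<subseteq> carrier R" and I: "finite I"
    and distinct: "\<And>i j. i \<in> I \<Longrightarrow> j \<in> I \<Longrightarrow> i \<noteq> j \<Longrightarrow> \<exists>a\<in>A. \<alpha> i a \<noteq> \<alpha> j a"
    and w: "w \<in> I \<rightarrow> carrier M"
    and weight: "\<And>i a. i \<in> I \<Longrightarrow> a \<in> A \<Longrightarrow> a \<odot>\<^bsub>M\<^esub> w i \<ominus>\<^bsub>M\<^esub> \<alpha> i a \<cdot> w i \<in> K"
    and sum: "(\<Oplus>\<^bsub>M\<^esub>i\<in>I. w i) \<in> K"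
    and "i \<in> I"
  shows "w i \<in> K"
  using I distinct w weight sum \<open>i \<in> I\<close>
proof (induction I arbitrary: w i rule: finite_induct)
  case (insert j I)
  have w_M: "w i \<in> carrier M" if "i \<in> insert j I" for i
    using insert.prems(2) that by auto
  have K_M: "x \<in> carrier M" if "x \<in> K" for x
    using that submodule_subset[OF K] by blast
  have K_sub: "subspace K"
    by (rule submodule_subspace[OF K])
  have others: "w i \<in> K" if i: "i \<in> I" for i
  proof -
    have "i \<noteq> j"
      using i insert.hyps by auto
    then obtain a where a: "a \<in> A" "\<alpha> i a \<noteq> \<alpha> j a"
      using insert.prems(1)[of i j] i by auto
    have aR: "a \<in> carrier R"
      using a A by auto
    let ?c = "\<lambda>l. \<alpha> l a - \<alpha> j a"
    define u where "u l = a \<odot>\<^bsub>M\<^esub> w l \<ominus>\<^bsub>M\<^esub> \<alpha> j a \<cdot> w l" for l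
    have u_M: "u l \<in> carrier M" if "l \<in> insert j I" for l
      using that w_M aR by (simp add: u_def smult_closed)
    have u_K: "u l \<ominus>\<^bsub>M\<^esub> ?c l \<cdot> w l \<in> K" if "l \<in> insert j I" for l
    proof -
      have "u l \<ominus>\<^bsub>M\<^esub> ?c l \<cdot> w l = a \<odot>\<^bsub>M\<^esub> w l \<ominus>\<^bsub>M\<^esub> \<alpha> l a \<cdot> w l"
        using that w_M[OF that] aR
        by (simp add: u_def cscale_diff smult_closed a_minus_def M.minus_add M.a_ac M.r_neg2 M.r_neg1)
      then show ?thesis
        using insert.prems(3)[OF that a(1)] by simp
    qed
    have "(\<Oplus>\<^bsub>M\<^esub>l\<in>insert j I. u l) \<in> K"
    proof -
      have "(\<Oplus>\<^bsub>M\<^esub>l\<in>insert j I. u l \<oplus>\<^bsub>M\<^esub> \<alpha> j a \<cdot> w l) = (\<Oplus>\<^bsub>M\<^esub>l\<in>insert j I. a \<odot>\<^bsub>M\<^esub> w l)"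
        using w_M aR
        by (intro M.finsum_cong')
          (auto simp: u_def smult_closed a_minus_def M.a_assoc M.l_neg)
      then have "(\<Oplus>\<^bsub>M\<^esub>l\<in>insert j I. u l) \<oplus>\<^bsub>M\<^esub> (\<Oplus>\<^bsub>M\<^esub>l\<in>insert j I. \<alpha> j a \<cdot> w l) =
          (\<Oplus>\<^bsub>M\<^esub>l\<in>insert j I. a \<odot>\<^bsub>M\<^esub> w l)"
        using w_M u_M by (subst M.finsum_addf[symmetric]) auto
      also have "(\<Oplus>\<^bsub>M\<^esub>l\<in>insert j I. \<alpha> j a \<cdot> w l) = \<alpha> j a \<cdot> (\<Oplus>\<^bsub>M\<^esub>l\<in>insert j I. w l)"
        using w_M by (intro smult_finsum[symmetric]) auto
      also have "(\<Oplus>\<^bsub>M\<^esub>l\<in>insert j I. a \<odot>\<^bsub>M\<^esub> w l) = a \<odot>\<^bsub>M\<^esub> (\<Oplus>\<^bsub>M\<^esub>l\<in>insert j I. w l)"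
        using w_M aR by (intro smult_finsum[symmetric]) auto
      finally have eq: "(\<Oplus>\<^bsub>M\<^esub>l\<in>insert j I. u l) \<oplus>\<^bsub>M\<^esub> \<alpha> j a \<cdot> (\<Oplus>\<^bsub>M\<^esub>l\<in>insert j I. w l) =
          a \<odot>\<^bsub>M\<^esub> (\<Oplus>\<^bsub>M\<^esub>l\<in>insert j I. w l)" .
      have sum_u: "(\<Oplus>\<^bsub>M\<^esub>l\<in>insert j I. u l) \<in> carrier M"
        using u_M by (intro M.finsum_closed) auto
      let ?s = "\<Oplus>\<^bsub>M\<^esub>l\<in>insert j I. w l"
      have s: "?s \<in> K" "a \<odot>\<^bsub>M\<^esub> ?s \<in> K" "\<alpha> j a \<cdot> ?s \<in> K"
        using insert.prems(4) K aR by (auto simp: submodule_iff)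
      then have "(\<Oplus>\<^bsub>M\<^esub>l\<in>insert j I. u l) = a \<odot>\<^bsub>M\<^esub> ?s \<ominus>\<^bsub>M\<^esub> \<alpha> j a \<cdot> ?s"
        unfolding eq[symmetric] using sum_u K_M
        by (simp add: a_minus_def M.a_assoc M.r_neg)
      then show ?thesis
        using submodule_minus[OF K s(2,3)] by simp
    qed
    moreover have "(\<Oplus>\<^bsub>M\<^esub>l\<in>insert j I. u l) =
        (\<Oplus>\<^bsub>M\<^esub>l\<in>insert j I. u l \<ominus>\<^bsub>M\<^esub> ?c l \<cdot> w l) \<oplus>\<^bsub>M\<^esub> (\<Oplus>\<^bsub>M\<^esub>l\<in>insert j I. ?c l \<cdot> w l)"
    proof -
      have "(\<Oplus>\<^bsub>M\<^esub>l\<in>insert j I. u l) =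
          (\<Oplus>\<^bsub>M\<^esub>l\<in>insert j I. (u l \<ominus>\<^bsub>M\<^esub> ?c l \<cdot> w l) \<oplus>\<^bsub>M\<^esub> ?c l \<cdot> w l)"
        using w_M u_M by (intro M.finsum_cong') (auto simp: a_minus_def M.a_assoc M.l_neg)
      also have "\<dots> = (\<Oplus>\<^bsub>M\<^esub>l\<in>insert j I. u l \<ominus>\<^bsub>M\<^esub> ?c l \<cdot> w l) \<oplus>\<^bsub>M\<^esub> (\<Oplus>\<^bsub>M\<^esub>l\<in>insert j I. ?c l \<cdot> w l)"
        using w_M u_M by (intro M.finsum_addf) auto
      finally show ?thesis .
    qed
    moreover have diff_K: "(\<Oplus>\<^bsub>M\<^esub>l\<in>insert j I. u l \<ominus>\<^bsub>M\<^esub> ?c l \<cdot> w l) \<in> K"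
      by (intro submodule_finsum[OF K] Pi_I u_K)
    moreover have "(\<Oplus>\<^bsub>M\<^esub>l\<in>insert j I. ?c l \<cdot> w l) = (\<Oplus>\<^bsub>M\<^esub>l\<in>I. ?c l \<cdot> w l)"
    proof -
      have "(\<Oplus>\<^bsub>M\<^esub>l\<in>I. ?c l \<cdot> w l) \<in> carrier M"
        using w_M by (intro M.finsum_closed) auto
      then show ?thesis
        using insert.hyps w_M by (subst M.finsum_insert) auto
    qed
    moreover have "(\<Oplus>\<^bsub>M\<^esub>l\<in>I. ?c l \<cdot> w l) \<in> carrier M"
      using w_M by (intro M.finsum_closed) auto
    ultimately have sum_I: "(\<Oplus>\<^bsub>M\<^esub>l\<in>I. ?c l \<cdot> w l) \<in> K"
      using submodule_minus[OF K, of "\<Oplus>\<^bsub>M\<^esub>l\<in>insert j I. u l" "\<Oplus>\<^bsub>M\<^esub>l\<in>insert j I. u l \<ominus>\<^bsub>M\<^esub> ?c l \<cdot> w l"] K_M[OF diff_K]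
      by (simp add: add_diff_cancel_left)
    have "?c i \<cdot> w i \<in> K"
    proof (rule insert.IH)
      show "\<exists>a\<in>A. \<alpha> l a \<noteq> \<alpha> m a" if "l \<in> I" "m \<in> I" "l \<noteq> m" for l m
        using insert.prems(1) that by auto
      show "(\<lambda>l. ?c l \<cdot> w l) \<in> I \<rightarrow> carrier M"
        using w_M by auto
      fix l b assume l: "l \<in> I" and b: "b \<in> A"
      then have bR: "b \<in> carrier R" and wl: "w l \<in> carrier M"
        using A w_M by auto
      have "?c l \<cdot> (b \<odot>\<^bsub>M\<^esub> w l \<ominus>\<^bsub>M\<^esub> \<alpha> l b \<cdot> w l) \<in> K"
        using insert.prems(3)[of l b] l b K by (auto simp: submodule_iff)
      moreover have "?c l \<cdot> (b \<odot>\<^bsub>M\<^esub> w l \<ominus>\<^bsub>M\<^esub> \<alpha> l b \<cdot> w l) =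
          b \<odot>\<^bsub>M\<^esub> ?c l \<cdot> w l \<ominus>\<^bsub>M\<^esub> \<alpha> l b \<cdot> ?c l \<cdot> w l"
        using bR wl by (simp add: smult_r_diff smult_cscale[of b] smult_closed mult.commute)
      ultimately show "b \<odot>\<^bsub>M\<^esub> ?c l \<cdot> w l \<ominus>\<^bsub>M\<^esub> \<alpha> l b \<cdot> ?c l \<cdot> w l \<in> K"
        by simp
    qed (use sum_I i in auto)
    then show ?thesis
      using subspace_cscale_iff[OF K_sub, of "w i" "?c i"] w_M[of i] i a by simp
  qed
  have "(\<Oplus>\<^bsub>M\<^esub>i\<in>I. w i) \<in> K"
    using others by (intro submodule_finsum[OF K]) auto
  moreover have "(\<Oplus>\<^bsub>M\<^esub>i\<in>insert j I. w i) = w j \<oplus>\<^bsub>M\<^esub> (\<Oplus>\<^bsub>M\<^esub>i\<in>I. w i)"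
    using insert.hyps w_M by (intro M.finsum_insert) auto
  ultimately have "w j \<oplus>\<^bsub>M\<^esub> (\<Oplus>\<^bsub>M\<^esub>i\<in>I. w i) \<ominus>\<^bsub>M\<^esub> (\<Oplus>\<^bsub>M\<^esub>i\<in>I. w i) \<in> K"
    using insert.prems(4) submodule_minus[OF K] by metis
  then have "w j \<in> K"
    using \<open>(\<Oplus>\<^bsub>M\<^esub>i\<in>I. w i) \<in> K\<close> K_M w_M[of j] by (simp add: a_minus_def M.a_assoc M.r_neg)
  then show ?case
    using others insert.prems(5) by auto
qed simp

end

subsection \<open>Simultaneous eigenvectors\<close>

locale commutative_subalgebra = algebra_module +
  fixes A :: "'a set"
  assumes A_subset: "A \<subseteq> carrier R"
    and A_scalar: "\<iota> c \<in> A"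
    and A_add: "a \<in> A \<Longrightarrow> b \<in> A \<Longrightarrow> a \<oplus> b \<in> A"
    and A_mult: "a \<in> A \<Longrightarrow> b \<in> A \<Longrightarrow> a \<otimes> b \<in> A"
    and A_commute: "a \<in> A \<Longrightarrow> b \<in> A \<Longrightarrow> a \<otimes> b = b \<otimes> a"
begin

definition orbit :: "'b \<Rightarrow> 'b set" where
  "orbit w = (\<lambda>a. a \<odot>\<^bsub>M\<^esub> w) ` A"

lemma A_carrier [simp]: "a \<in> A \<Longrightarrow> a \<in> carrier R"
  using A_subset by blast

lemma A_smult_commute: "a \<in> A \<Longrightarrow> b \<in> A \<Longrightarrow> w \<in> carrier M \<Longrightarrow> a \<odot>\<^bsub>M\<^esub> (b \<odot>\<^bsub>M\<^esub> w) = b \<odot>\<^bsub>M\<^esub> (a \<odot>\<^bsub>M\<^esub> w)"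
  by (metis A_carrier A_commute smult_assoc1)

lemma orbit_smult: "w \<in> carrier M \<Longrightarrow> a \<in> A \<Longrightarrow> u \<in> orbit w \<Longrightarrow> a \<odot>\<^bsub>M\<^esub> u \<in> orbit w"
  unfolding orbit_def by (auto simp: A_mult simp flip: smult_assoc1)

lemma orbit_self: "w \<in> carrier M \<Longrightarrow> w \<in> orbit w"
  using A_scalar[of 1] by (auto simp: orbit_def scalar_one smult_one intro!: image_eqI[of _ _ \<one>])

lemma orbit_subspace: "w \<in> carrier M \<Longrightarrow> subspace (orbit w)"
  unfolding subspace_def
proof (intro conjI ballI allI)
  assume w: "w \<in> carrier M"
  show "orbit w \<subseteq> carrier M"
    using w by (auto simp: orbit_def smult_closed)
  show "\<zero>\<^bsub>M\<^esub> \<in> orbit w"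
    unfolding orbit_def using w A_scalar[of 0] by (intro image_eqI[of _ _ "\<iota> 0"]) auto
  show "c \<cdot> x \<in> orbit w" if "x \<in> orbit w" for c x
    using that w A_scalar by (intro orbit_smult) auto
  fix x y assume "x \<in> orbit w" "y \<in> orbit w"
  then obtain a b where ab: "a \<in> A" "x = a \<odot>\<^bsub>M\<^esub> w" "b \<in> A" "y = b \<odot>\<^bsub>M\<^esub> w"
    by (auto simp: orbit_def)
  then show "x \<oplus>\<^bsub>M\<^esub> y \<in> orbit w"
    unfolding orbit_def using w by (intro image_eqI[of _ _ "a \<oplus> b"]) (auto simp: A_add smult_l_distr)
qed

lemma orbit_closed: "w \<in> carrier M \<Longrightarrow> u \<in> orbit w \<Longrightarrow> u \<in> carrier M"
  using orbit_subspace unfolding subspace_def by blast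

lemma orbit_trans: "w \<in> carrier M \<Longrightarrow> u \<in> orbit w \<Longrightarrow> orbit u \<subseteq> orbit w"
  using orbit_smult by (auto simp: orbit_def[of u])

text \<open>The action of \<open>p(a)\<close> on a vector. The powers of \<open>a\<close> are accumulated in the vector, so that splitting
  off a linear factor of \<open>p\<close> (lemma \<open>peval_linear_factor\<close>) is an induction over the coefficients.\<close>

definition peval :: "'a \<Rightarrow> complex poly \<Rightarrow> 'b \<Rightarrow> 'b" where
  "peval a p = fold_coeffs (\<lambda>c g w. c \<cdot> w \<oplus>\<^bsub>M\<^esub> g (a \<odot>\<^bsub>M\<^esub> w)) p (\<lambda>_. \<zero>\<^bsub>M\<^esub>)"

lemma peval_0 [simp]: "peval a 0 w = \<zero>\<^bsub>M\<^esub>"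
  by (simp add: peval_def)

lemma peval_pCons:
  assumes "a \<in> carrier R" "w \<in> carrier M"
  shows "peval a (pCons c p) w = c \<cdot> w \<oplus>\<^bsub>M\<^esub> peval a p (a \<odot>\<^bsub>M\<^esub> w)"
proof (cases "p = 0 \<and> c = 0")
  case True
  then show ?thesis
    using assms by simp
next
  case False
  then show ?thesis
    by (cases "p = 0") (simp_all add: peval_def)
qed

lemma peval_closed:
  assumes "a \<in> carrier R" "w \<in> carrier M"
  shows "peval a p w \<in> carrier M"
  using assms(2)
  by (induction p arbitrary: w) (use assms(1) in \<open>simp_all add: peval_pCons smult_closed\<close>)

lemma peval_add_const:
  assumes "a \<in> carrier R" "w \<in> carrier M"
  shows "peval a ([:c:] + p) w = c \<cdot> w \<oplus>\<^bsub>M\<^esub> peval a p w"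
proof (cases p)
  case (pCons d q)
  then have "[:c:] + p = pCons (c + d) q"
    by simp
  then show ?thesis
    using assms pCons by (simp only: peval_pCons)
      (simp add: cscale_add M.a_assoc peval_closed smult_closed)
qed

lemma peval_linear_factor:
  assumes "a \<in> carrier R" "w \<in> carrier M"
  shows "peval a ([:- z, 1:] * p) w = peval a p (a \<odot>\<^bsub>M\<^esub> w \<ominus>\<^bsub>M\<^esub> z \<cdot> w)"
  using assms(2)
proof (induction p arbitrary: w)
  case (pCons d p)
  let ?w = "a \<odot>\<^bsub>M\<^esub> w"
  have w: "w \<in> carrier M" "?w \<in> carrier M" "a \<odot>\<^bsub>M\<^esub> ?w \<in> carrier M"
    using pCons assms by (simp_all add: smult_closed)
  have "[:- z, 1:] * pCons d p = pCons (- (z * d)) ([:d:] + [:- z, 1:] * p)"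
    by simp
  then have "peval a ([:- z, 1:] * pCons d p) w =
      (- (z * d)) \<cdot> w \<oplus>\<^bsub>M\<^esub> (d \<cdot> ?w \<oplus>\<^bsub>M\<^esub> peval a ([:- z, 1:] * p) ?w)"
    using assms w by (simp only: peval_pCons peval_add_const)
  also have "peval a ([:- z, 1:] * p) ?w = peval a p (a \<odot>\<^bsub>M\<^esub> ?w \<ominus>\<^bsub>M\<^esub> z \<cdot> ?w)"
    using pCons w by simp
  also have "a \<odot>\<^bsub>M\<^esub> ?w \<ominus>\<^bsub>M\<^esub> z \<cdot> ?w = a \<odot>\<^bsub>M\<^esub> (?w \<ominus>\<^bsub>M\<^esub> z \<cdot> w)"
    using w assms by (simp add: smult_r_diff smult_cscale)
  also have "(- (z * d)) \<cdot> w \<oplus>\<^bsub>M\<^esub> (d \<cdot> ?w \<oplus>\<^bsub>M\<^esub> peval a p (a \<odot>\<^bsub>M\<^esub> (?w \<ominus>\<^bsub>M\<^esub> z \<cdot> w))) =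
      d \<cdot> (?w \<ominus>\<^bsub>M\<^esub> z \<cdot> w) \<oplus>\<^bsub>M\<^esub> peval a p (a \<odot>\<^bsub>M\<^esub> (?w \<ominus>\<^bsub>M\<^esub> z \<cdot> w))"
  proof -
    have "d \<cdot> (?w \<ominus>\<^bsub>M\<^esub> z \<cdot> w) = d \<cdot> ?w \<ominus>\<^bsub>M\<^esub> (z * d) \<cdot> w"
      using w by (simp add: smult_r_diff mult.commute)
    then show ?thesis
      using w assms peval_closed[of a "a \<odot>\<^bsub>M\<^esub> (?w \<ominus>\<^bsub>M\<^esub> z \<cdot> w)" p]
      by (simp add: cscale_uminus a_minus_def M.a_ac smult_closed)
  qed
  also have "\<dots> = peval a (pCons d p) (?w \<ominus>\<^bsub>M\<^esub> z \<cdot> w)"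
    using w assms by (simp add: peval_pCons)
  finally show ?case .
qed (use assms in simp)

lemma peval_combination:
  assumes a: "a \<in> carrier R" and w: "w \<in> carrier M" and S: "S \<subseteq> carrier M"
    and c: "\<And>i. ((\<odot>\<^bsub>M\<^esub>) a ^^ i) w = (\<Oplus>\<^bsub>M\<^esub>s\<in>S. c i s \<cdot> s)"
  shows "peval a p w = (\<Oplus>\<^bsub>M\<^esub>s\<in>S. (\<Sum>i\<le>degree p. coeff p i * c i s) \<cdot> s)"
  using w c
proof (induction p arbitrary: w c)
  case 0
  have "(\<Oplus>\<^bsub>M\<^esub>s\<in>S. 0 \<cdot> s) = (\<Oplus>\<^bsub>M\<^esub>s\<in>S. \<zero>\<^bsub>M\<^esub>)"
    using S by (intro M.finsum_cong') auto
  then show ?case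
    by simp
next
  case (pCons d p)
  have w: "w = (\<Oplus>\<^bsub>M\<^esub>s\<in>S. c 0 s \<cdot> s)"
    using pCons.prems(2)[of 0] by simp
  have "peval a p (a \<odot>\<^bsub>M\<^esub> w) = (\<Oplus>\<^bsub>M\<^esub>s\<in>S. (\<Sum>i\<le>degree p. coeff p i * c (Suc i) s) \<cdot> s)"
  proof (rule pCons.IH)
    show "((\<odot>\<^bsub>M\<^esub>) a ^^ i) (a \<odot>\<^bsub>M\<^esub> w) = (\<Oplus>\<^bsub>M\<^esub>s\<in>S. c (Suc i) s \<cdot> s)" for i
      using pCons.prems(2)[of "Suc i"] by (simp add: funpow_swap1)
  qed (use pCons.prems(1) a in \<open>simp add: smult_closed\<close>)
  then have "peval a (pCons d p) w =
      d \<cdot> (\<Oplus>\<^bsub>M\<^esub>s\<in>S. c 0 s \<cdot> s) \<oplus>\<^bsub>M\<^esub> (\<Oplus>\<^bsub>M\<^esub>s\<in>S. (\<Sum>i\<le>degree p. coeff p i * c (Suc i) s) \<cdot> s)"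
    using pCons.prems(1) a w by (simp add: peval_pCons)
  also have "d \<cdot> (\<Oplus>\<^bsub>M\<^esub>s\<in>S. c 0 s \<cdot> s) = (\<Oplus>\<^bsub>M\<^esub>s\<in>S. d \<cdot> c 0 s \<cdot> s)"
    using S by (intro smult_finsum) auto
  also have "\<dots> \<oplus>\<^bsub>M\<^esub> (\<Oplus>\<^bsub>M\<^esub>s\<in>S. (\<Sum>i\<le>degree p. coeff p i * c (Suc i) s) \<cdot> s) =
      (\<Oplus>\<^bsub>M\<^esub>s\<in>S. d \<cdot> c 0 s \<cdot> s \<oplus>\<^bsub>M\<^esub> (\<Sum>i\<le>degree p. coeff p i * c (Suc i) s) \<cdot> s)"
    using S by (intro M.finsum_addf[symmetric]) auto
  also have "\<dots> = (\<Oplus>\<^bsub>M\<^esub>s\<in>S. (\<Sum>i\<le>degree (pCons d p). coeff (pCons d p) i * c i s) \<cdot> s)"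
  proof (intro M.finsum_cong')
    fix s assume "s \<in> S"
    have "(\<Sum>i\<le>degree (pCons d p). coeff (pCons d p) i * c i s) =
        d * c 0 s + (\<Sum>i\<le>degree p. coeff p i * c (Suc i) s)"
      by (cases "p = 0") (simp_all add: sum.atMost_Suc_shift del: sum.atMost_Suc)
    then show "d \<cdot> c 0 s \<cdot> s \<oplus>\<^bsub>M\<^esub> (\<Sum>i\<le>degree p. coeff p i * c (Suc i) s) \<cdot> s =
        (\<Sum>i\<le>degree (pCons d p). coeff (pCons d p) i * c i s) \<cdot> s"
      using S \<open>s \<in> S\<close> by (auto simp: cscale_add)
  qed (use S in auto)
  finally show ?case .
qed

text \<open>The vectors \<open>a\<^sup>i w\<close> all lie in a finitely spanned space, so finitely many of them are dependent.\<close>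

lemma annihilating_polynomial:
  assumes a: "a \<in> A" and w: "w \<in> carrier M" and fin: "finite_dim \<iota> M (orbit w)"
  shows "\<exists>p. p \<noteq> 0 \<and> peval a p w = \<zero>\<^bsub>M\<^esub>"
proof -
  obtain S where S: "finite S" "S \<subseteq> orbit w" "orbit w \<subseteq> lin S"
    using fin by (auto simp: finite_dim_iff)
  have S_M: "S \<subseteq> carrier M"
    using S orbit_closed[OF w] by blast
  have "((\<odot>\<^bsub>M\<^esub>) a ^^ i) w \<in> orbit w" for i
    by (induction i) (use a w in \<open>simp_all add: orbit_self orbit_smult\<close>)
  then have "\<exists>c. ((\<odot>\<^bsub>M\<^esub>) a ^^ i) w = (\<Oplus>\<^bsub>M\<^esub>s\<in>S. c s \<cdot> s)" for i
    using S(3) unfolding lin_def by blast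
  then obtain c where c: "\<And>i. ((\<odot>\<^bsub>M\<^esub>) a ^^ i) w = (\<Oplus>\<^bsub>M\<^esub>s\<in>S. c i s \<cdot> s)"
    by metis
  let ?I = "{..card S}"
  obtain d where d: "\<exists>i\<in>?I. d i \<noteq> 0" "\<forall>s\<in>S. (\<Sum>i\<in>?I. d i * c i s) = 0"
    using underdetermined_system[of S ?I c] S by auto
  define p where "p = (\<Sum>i\<in>?I. monom (d i) i)"
  have coeff_p: "coeff p i = (if i \<in> ?I then d i else 0)" for i
    by (simp add: p_def coeff_sum if_distrib sum.delta cong: if_cong)
  have "p \<noteq> 0"
    using d coeff_p by (metis coeff_0)
  moreover have "peval a p w = (\<Oplus>\<^bsub>M\<^esub>s\<in>S. (\<Sum>i\<le>degree p. coeff p i * c i s) \<cdot> s)"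
    using a w S_M c by (intro peval_combination) auto
  moreover have "\<dots> = (\<Oplus>\<^bsub>M\<^esub>s\<in>S. \<zero>\<^bsub>M\<^esub>)"
  proof (intro M.finsum_cong')
    fix s assume s: "s \<in> S"
    have "(\<Sum>i\<le>degree p. coeff p i * c i s) = (\<Sum>i\<in>?I. d i * c i s)"
    proof (intro sum.mono_neutral_cong)
      fix i assume "i \<in> ?I - {..degree p}"
      then show "d i * c i s = 0"
        using coeff_eq_0[of p i] coeff_p[of i] by simp
    qed (auto simp: coeff_p)
    then show "(\<Sum>i\<le>degree p. coeff p i * c i s) \<cdot> s = \<zero>\<^bsub>M\<^esub>"
      using d s S_M by auto
  qed auto
  ultimately show ?thesis
    by auto
qed

text \<open>Over the complex numbers \<open>p = (X - z) q\<close>. If \<open>(a - z) w\<close> lies in \<open>N\<close>, then \<open>w\<close> is the required vector;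
  otherwise \<open>w\<close> is replaced by \<open>(a - z) w\<close> and \<open>p\<close> by \<open>q\<close>.\<close>

lemma eigenvector_step:
  assumes N: "submodule N R M" and a: "a \<in> A" and "w \<in> carrier M" "w \<notin> N"
    and "p \<noteq> 0" "peval a p w \<in> N"
  shows "\<exists>u\<in>orbit w. u \<notin> N \<and> (\<exists>z. a \<odot>\<^bsub>M\<^esub> u \<ominus>\<^bsub>M\<^esub> z \<cdot> u \<in> N)"
  using assms(3-)
proof (induction "degree p" arbitrary: p w)
  case 0
  then obtain c where p: "p = [:c:]"
    by (metis degree_eq_zeroE)
  then have "c \<cdot> w \<in> N"
    using 0 a by (simp add: peval_pCons)
  then have "w \<in> N"
    using 0 p subspace_cscale_iff[OF submodule_subspace[OF N], of w c] by simp
  then show ?case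
    using 0 by simp
next
  case (Suc m)
  then have "\<not> constant (poly p)"
    by (simp add: constant_degree)
  then obtain z where "poly p z = 0"
    using fundamental_theorem_of_algebra by blast
  then obtain q where q: "p = [:- z, 1:] * q"
    using poly_eq_0_iff_dvd by (metis dvdE)
  then have "q \<noteq> 0"
    using Suc by auto
  then have deg: "m = degree q"
    using Suc.hyps(2) q by (simp add: degree_mult_eq del: mult_pCons_left)
  let ?w = "a \<odot>\<^bsub>M\<^esub> w \<ominus>\<^bsub>M\<^esub> z \<cdot> w"
  have w_orbit: "?w \<in> orbit w"
    using Suc.prems(1) a
    by (intro subspace_diff orbit_subspace orbit_smult orbit_self A_scalar)
  show ?case
  proof (cases "?w \<in> N")
    case True
    then show ?thesis
      using orbit_self Suc.prems by blast
  next
    case False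
    have "peval a q ?w \<in> N"
      using Suc.prems(1,4) a peval_linear_factor[of a w z q] unfolding q by simp
    then have "\<exists>u\<in>orbit ?w. u \<notin> N \<and> (\<exists>z. a \<odot>\<^bsub>M\<^esub> u \<ominus>\<^bsub>M\<^esub> z \<cdot> u \<in> N)"
      using Suc.hyps(1)[OF deg _ False \<open>q \<noteq> 0\<close>] orbit_closed[OF Suc.prems(1) w_orbit] by blast
    then show ?thesis
      using orbit_trans[OF Suc.prems(1) w_orbit] by blast
  qed
qed

text \<open>Treating the operators one after the other is possible because \<open>A\<close> is commutative: passing from an
  eigenvector \<open>u\<close> of \<open>b\<close> to \<open>h u\<close> with \<open>h \<in> A\<close> keeps the eigenvalue of \<open>b\<close>.\<close>

lemma eigenvector_finite:
  assumes N: "submodule N R M" and "finite F" "F \<subseteq> A" and w: "w \<in> carrier M" "w \<notin> N"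
    and fin: "finite_dim \<iota> M (orbit w)"
  shows "\<exists>u\<in>orbit w. u \<notin> N \<and> (\<forall>a\<in>F. \<exists>z. a \<odot>\<^bsub>M\<^esub> u \<ominus>\<^bsub>M\<^esub> z \<cdot> u \<in> N)"
  using assms(2,3)
proof (induction F rule: finite_induct)
  case empty
  then show ?case
    using w orbit_self by auto
next
  case (insert a F)
  then obtain u where u: "u \<in> orbit w" "u \<notin> N" "\<And>b. b \<in> F \<Longrightarrow> \<exists>z. b \<odot>\<^bsub>M\<^esub> u \<ominus>\<^bsub>M\<^esub> z \<cdot> u \<in> N"
    by auto
  have u_M: "u \<in> carrier M"
    using orbit_closed[OF w(1) u(1)] .
  obtain S where S: "finite S" "S \<subseteq> orbit w" "orbit w \<subseteq> lin S"
    using fin by (auto simp: finite_dim_iff)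
  then have "finite_dim \<iota> M (orbit u)"
    using orbit_trans[OF w(1) u(1)] orbit_closed[OF w(1)] u_M
    by (intro finite_dim_subspace[of S] orbit_subspace) auto
  then obtain p where "p \<noteq> 0" "peval a p u = \<zero>\<^bsub>M\<^esub>"
    using annihilating_polynomial[of a u] insert.prems u_M by auto
  then obtain v z where v: "v \<in> orbit u" "v \<notin> N" "a \<odot>\<^bsub>M\<^esub> v \<ominus>\<^bsub>M\<^esub> z \<cdot> v \<in> N"
    using eigenvector_step[OF N, of a u p] insert.prems u_M u(2) N by (auto simp: submodule_iff)
  obtain h where h: "h \<in> A" "v = h \<odot>\<^bsub>M\<^esub> u"
    using v(1) by (auto simp: orbit_def)
  have "\<exists>z. b \<odot>\<^bsub>M\<^esub> v \<ominus>\<^bsub>M\<^esub> z \<cdot> v \<in> N" if b: "b \<in> F" for b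
  proof -
    obtain z where "b \<odot>\<^bsub>M\<^esub> u \<ominus>\<^bsub>M\<^esub> z \<cdot> u \<in> N"
      using u(3)[OF b] by blast
    then have "h \<odot>\<^bsub>M\<^esub> (b \<odot>\<^bsub>M\<^esub> u \<ominus>\<^bsub>M\<^esub> z \<cdot> u) \<in> N"
      using N h by (simp add: submodule_iff)
    moreover have "h \<odot>\<^bsub>M\<^esub> (b \<odot>\<^bsub>M\<^esub> u \<ominus>\<^bsub>M\<^esub> z \<cdot> u) = b \<odot>\<^bsub>M\<^esub> v \<ominus>\<^bsub>M\<^esub> z \<cdot> v"
      using h b insert.prems u_M A_smult_commute[of h b u]
      by (auto simp: smult_r_diff smult_cscale smult_closed)
    ultimately show ?thesis
      by auto
  qed
  then have "\<forall>b\<in>insert a F. \<exists>z. b \<odot>\<^bsub>M\<^esub> v \<ominus>\<^bsub>M\<^esub> z \<cdot> v \<in> N"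
    using v(3) by auto
  then show ?case
    using v orbit_trans[OF w(1) u(1)] by blast
qed

text \<open>Finitely many operators suffice. If the vectors \<open>f\<^sub>s w\<close> span \<open>A w\<close>, then by commutativity every \<open>a\<close>
  acts on \<open>A w\<close> as a linear combination of the \<open>f\<^sub>s\<close>.\<close>

theorem eigenvector_exists:
  assumes N: "submodule N R M" and w: "w \<in> carrier M" "w \<notin> N"
    and fin: "finite_dim \<iota> M (orbit w)"
  obtains u \<alpha> where "u \<in> orbit w" "u \<notin> N" "\<And>a. a \<in> A \<Longrightarrow> a \<odot>\<^bsub>M\<^esub> u \<ominus>\<^bsub>M\<^esub> \<alpha> a \<cdot> u \<in> N"
proof -
  obtain S where S: "finite S" "S \<subseteq> orbit w" "orbit w \<subseteq> lin S"
    using fin by (auto simp: finite_dim_iff)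
  then have "\<forall>s\<in>S. \<exists>a. a \<in> A \<and> s = a \<odot>\<^bsub>M\<^esub> w"
    by (auto simp: orbit_def)
  then obtain f where f: "\<And>s. s \<in> S \<Longrightarrow> f s \<in> A \<and> s = f s \<odot>\<^bsub>M\<^esub> w"
    by metis
  have "finite (f ` S)" "f ` S \<subseteq> A"
    using S f by auto
  from eigenvector_finite[OF N this w fin]
  obtain u where u: "u \<in> orbit w" "u \<notin> N" "\<And>a. a \<in> f ` S \<Longrightarrow> \<exists>z. a \<odot>\<^bsub>M\<^esub> u \<ominus>\<^bsub>M\<^esub> z \<cdot> u \<in> N"
    by blast
  obtain h where h: "h \<in> A" "u = h \<odot>\<^bsub>M\<^esub> w"
    using u(1) by (auto simp: orbit_def)
  have u_M: "u \<in> carrier M"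
    using orbit_closed[OF w(1) u(1)] .
  \<comment> \<open>With \<open>u = h w\<close>, the vector \<open>a w\<close> belongs to \<open>?L\<close> iff \<open>u\<close> is an eigenvector of \<open>a\<close> modulo \<open>N\<close>.\<close>
  let ?L = "{x \<in> carrier M. \<exists>z. h \<odot>\<^bsub>M\<^esub> x \<ominus>\<^bsub>M\<^esub> z \<cdot> u \<in> N}"
  have "subspace ?L"
    unfolding subspace_def
  proof (intro conjI ballI allI)
    show "\<zero>\<^bsub>M\<^esub> \<in> ?L"
      using N h u_M by (auto simp: submodule_iff intro!: exI[of _ 0])
  next
    fix x y assume "x \<in> ?L" "y \<in> ?L"
    then obtain z z' where *: "x \<in> carrier M" "y \<in> carrier M"
        "h \<odot>\<^bsub>M\<^esub> x \<ominus>\<^bsub>M\<^esub> z \<cdot> u \<in> N" "h \<odot>\<^bsub>M\<^esub> y \<ominus>\<^bsub>M\<^esub> z' \<cdot> u \<in> N"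
      by auto
    then have "(h \<odot>\<^bsub>M\<^esub> x \<ominus>\<^bsub>M\<^esub> z \<cdot> u) \<oplus>\<^bsub>M\<^esub> (h \<odot>\<^bsub>M\<^esub> y \<ominus>\<^bsub>M\<^esub> z' \<cdot> u) \<in> N"
      using N by (auto simp: submodule_iff)
    moreover have "(h \<odot>\<^bsub>M\<^esub> x \<ominus>\<^bsub>M\<^esub> z \<cdot> u) \<oplus>\<^bsub>M\<^esub> (h \<odot>\<^bsub>M\<^esub> y \<ominus>\<^bsub>M\<^esub> z' \<cdot> u) =
        h \<odot>\<^bsub>M\<^esub> (x \<oplus>\<^bsub>M\<^esub> y) \<ominus>\<^bsub>M\<^esub> (z + z') \<cdot> u"
      using * h u_M
      by (simp add: smult_r_distr cscale_add smult_closed a_minus_def M.minus_add M.a_ac)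
    ultimately show "x \<oplus>\<^bsub>M\<^esub> y \<in> ?L"
      using *(1,2) by (intro CollectI conjI exI[of _ "z + z'"]) simp_all
  next
    fix c x assume "x \<in> ?L"
    then obtain z where *: "x \<in> carrier M" "h \<odot>\<^bsub>M\<^esub> x \<ominus>\<^bsub>M\<^esub> z \<cdot> u \<in> N"
      by auto
    then have "c \<cdot> (h \<odot>\<^bsub>M\<^esub> x \<ominus>\<^bsub>M\<^esub> z \<cdot> u) \<in> N"
      using N by (auto simp: submodule_iff)
    moreover have "c \<cdot> (h \<odot>\<^bsub>M\<^esub> x \<ominus>\<^bsub>M\<^esub> z \<cdot> u) = h \<odot>\<^bsub>M\<^esub> c \<cdot> x \<ominus>\<^bsub>M\<^esub> (c * z) \<cdot> u"
      using * h u_M by (simp add: smult_r_diff smult_cscale[of h] smult_closed)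
    ultimately show "c \<cdot> x \<in> ?L"
      using * by auto
  qed auto
  moreover have "S \<subseteq> ?L"
  proof
    fix s assume s: "s \<in> S"
    then obtain z where "f s \<odot>\<^bsub>M\<^esub> u \<ominus>\<^bsub>M\<^esub> z \<cdot> u \<in> N"
      using u(3)[of "f s"] by blast
    moreover have "f s \<odot>\<^bsub>M\<^esub> u = h \<odot>\<^bsub>M\<^esub> s"
      using f[OF s] h w A_smult_commute[of h "f s" w] by simp
    ultimately show "s \<in> ?L"
      using s S orbit_closed[OF w(1)] by auto
  qed
  ultimately have "orbit w \<subseteq> ?L"
    using lin_least S by blast
  then have "\<exists>z. a \<odot>\<^bsub>M\<^esub> u \<ominus>\<^bsub>M\<^esub> z \<cdot> u \<in> N" if a: "a \<in> A" for a
  proof -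
    have "a \<odot>\<^bsub>M\<^esub> w \<in> ?L"
      using \<open>orbit w \<subseteq> ?L\<close> a by (auto simp: orbit_def)
    moreover have "h \<odot>\<^bsub>M\<^esub> (a \<odot>\<^bsub>M\<^esub> w) = a \<odot>\<^bsub>M\<^esub> u"
      using a h w A_smult_commute[of h a w] by simp
    ultimately show ?thesis
      by auto
  qed
  then obtain \<alpha> where "\<And>a. a \<in> A \<Longrightarrow> a \<odot>\<^bsub>M\<^esub> u \<ominus>\<^bsub>M\<^esub> \<alpha> a \<cdot> u \<in> N"
    by metis
  with u that show ?thesis
    by blast
qed

end


section \<open>The quantum torus\<close>

text \<open>Used to reduce identities that are additive in their arguments to basis elements.\<close>

lemma poly_mapping_additive_induct [consumes 1, case_names zero single add]:
  fixes f :: "'a \<Rightarrow>\<^sub>0 'b::comm_monoid_add"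
  assumes "Poly_Mapping.keys f \<subseteq> K"
    and zero: "P 0" and single: "\<And>k c. k \<in> K \<Longrightarrow> P (Poly_Mapping.single k c)"
    and add: "\<And>f g. P f \<Longrightarrow> P g \<Longrightarrow> P (f + g)"
  shows "P f"
proof -
  have sum: "P (\<Sum>k\<in>I. Poly_Mapping.single k (Poly_Mapping.lookup f k))" if "I \<subseteq> K" for I
    using that by (induction I rule: infinite_finite_induct) (auto intro: zero single add)
  have "f = (\<Sum>k\<in>Poly_Mapping.keys f. Poly_Mapping.single k (Poly_Mapping.lookup f k))"
    by (rule poly_mapping_eqI)
      (simp add: lookup_sum lookup_single when_def in_keys_iff)
  then show ?thesis
    using sum[OF assms(1)] by simp
qed

lemma map_times_add:
  fixes f g :: "'a \<Rightarrow>\<^sub>0 complex"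
  shows "Poly_Mapping.map ((*) c) (f + g) = Poly_Mapping.map ((*) c) f + Poly_Mapping.map ((*) c) g"
  by (rule poly_mapping_eqI)
    (auto simp: Poly_Mapping.map.rep_eq lookup_add when_def simp flip: distrib_left)

locale quantum_torus_data =
  fixes n :: nat and r :: complex and B :: "'x::ab_group_add \<Rightarrow> 'y::ab_group_add \<Rightarrow> rat"
  assumes n_pos: "n > 0" and pairing: "nondegenerate_pairing n B"
    and r_nonzero: "r \<noteq> 0" and r_not_root: "\<And>k::nat. k > 0 \<Longrightarrow> r ^ k \<noteq> 1"
begin

abbreviation H where "H \<equiv> quantum_torus n r B"

abbreviation \<beta> :: "'x \<Rightarrow> 'y \<Rightarrow> complex" where
  "\<beta> x y \<equiv> q_exp n r B y x"

abbreviation eX :: "'x \<Rightarrow> ('x \<times> 'y) \<Rightarrow>\<^sub>0 complex" where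
  "eX x \<equiv> Poly_Mapping.single (x, 0) 1"

text \<open>The exponent of the chosen root \<open>r\<close> in \<open>q\<^bsup>\<langle>x,y\<rangle>\<^esup>\<close>.\<close>

definition b :: "'x \<Rightarrow> 'y \<Rightarrow> int" where
  "b x y = \<lfloor>of_nat n * B x y\<rfloor>"

lemma of_int_b: "of_int (b x y) = of_nat n * B x y"
proof -
  obtain a :: int where "B x y = of_int a / of_nat n"
    using pairing unfolding nondegenerate_pairing_def by metis
  then have "of_nat n * B x y = of_int a"
    using n_pos by simp
  then show ?thesis
    by (simp add: b_def)
qed

lemma b_add_left: "b (x + x') y = b x y + b x' y"
proof -
  have "of_int (b (x + x') y) = (of_int (b x y + b x' y) :: rat)"
    using pairing by (simp add: of_int_b nondegenerate_pairing_def algebra_simps)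
  then show ?thesis
    by (simp only: of_int_eq_iff)
qed

lemma b_add_right: "b x (y + y') = b x y + b x y'"
proof -
  have "of_int (b x (y + y')) = (of_int (b x y + b x y') :: rat)"
    using pairing by (simp add: of_int_b nondegenerate_pairing_def algebra_simps)
  then show ?thesis
    by (simp only: of_int_eq_iff)
qed

lemma \<beta>_eq: "\<beta> x y = r powi b x y"
  by (simp add: q_exp_def q_pow_def b_def)

lemma q_pow_uminus: "q_pow n r (- B x y) = inverse (\<beta> x y)"
proof -
  have "\<lfloor>of_nat n * (- B x y)\<rfloor> = \<lfloor>of_int (- b x y) :: rat\<rfloor>"
    by (simp add: of_int_b)
  then show ?thesis
    by (simp add: \<beta>_eq q_pow_def power_int_minus del: floor_minus)
qed

lemma \<beta>_nonzero [simp]: "\<beta> x y \<noteq> 0"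
  using r_nonzero by (simp add: \<beta>_eq)

lemma \<beta>_add_left [simp]: "\<beta> (x + x') y = \<beta> x y * \<beta> x' y"
  using r_nonzero by (simp add: \<beta>_eq b_add_left power_int_add)

lemma \<beta>_add_right [simp]: "\<beta> x (y + y') = \<beta> x y * \<beta> x y'"
  using r_nonzero by (simp add: \<beta>_eq b_add_right power_int_add)

lemma \<beta>_zero_left [simp]: "\<beta> 0 y = 1"
proof -
  have "\<beta> (0 + 0) y = \<beta> 0 y * \<beta> 0 y"
    by (rule \<beta>_add_left)
  then show ?thesis
    by simp
qed

lemma \<beta>_zero_right [simp]: "\<beta> x 0 = 1"
proof -
  have "\<beta> x (0 + 0) = \<beta> x 0 * \<beta> x 0"
    by (rule \<beta>_add_right)
  then show ?thesis
    by simp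
qed

lemma r_powi_eq_one: "r powi k = 1 \<Longrightarrow> k = 0"
proof (rule ccontr)
  assume "r powi k = 1" "k \<noteq> 0"
  then have "r ^ nat \<bar>k\<bar> = 1"
    by (cases "k \<ge> 0") (auto simp: power_int_def inverse_eq_1_iff power_inverse)
  then show False
    using r_not_root \<open>k \<noteq> 0\<close> by simp
qed

text \<open>The map from \<open>Y\<close> to \<open>T\<close> is injective, because the pairing is non-degenerate and \<open>q\<close> is not a root of
  unity.\<close>

lemma \<beta>_separates:
  assumes "y \<noteq> y'"
  shows "\<exists>x. \<beta> x y \<noteq> \<beta> x y'"
proof (rule ccontr)
  assume *: "\<not> (\<exists>x. \<beta> x y \<noteq> \<beta> x y')"
  have "B x (y - y') = 0" for x
  proof -
    have "\<beta> x ((y - y') + y') = \<beta> x (y - y') * \<beta> x y'"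
      by (rule \<beta>_add_right)
    then have "\<beta> x (y - y') = 1"
      using * by simp
    then have "b x (y - y') = 0"
      using r_powi_eq_one by (simp add: \<beta>_eq)
    then show ?thesis
      using of_int_b[of x "y - y'"] n_pos by simp
  qed
  then have "y - y' = 0"
    using pairing unfolding nondegenerate_pairing_def by blast
  then show False
    using assms by simp
qed


subsection \<open>The algebra\<close>

lemma H_simps [simp]:
  "carrier H = UNIV" "\<zero>\<^bsub>H\<^esub> = 0" "\<one>\<^bsub>H\<^esub> = Poly_Mapping.single (0, 0) 1" "f \<oplus>\<^bsub>H\<^esub> g = f + g"
  by (simp_all add: quantum_torus_def)

lemma H_mult_single [simp]:
  "Poly_Mapping.single (x, y) a \<otimes>\<^bsub>H\<^esub> Poly_Mapping.single (u, v) c =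
    Poly_Mapping.single (x + u, y + v) (a * c / \<beta> u y)"
  by (simp add: quantum_torus_def q_pow_uminus divide_inverse)

lemma H_mult_add_left: "(f + g) \<otimes>\<^bsub>H\<^esub> h = f \<otimes>\<^bsub>H\<^esub> h + g \<otimes>\<^bsub>H\<^esub> h"
proof -
  let ?F = "\<lambda>(x, y) c. \<Sum>(u, v)\<in>Poly_Mapping.keys h.
       Poly_Mapping.single (x + u, y + v) (c * Poly_Mapping.lookup h (u, v) * q_pow n r (- B u y))"
  have F: "f \<otimes>\<^bsub>H\<^esub> h = (\<Sum>k\<in>Poly_Mapping.keys f. ?F k (Poly_Mapping.lookup f k))" for f
    by (simp add: quantum_torus_def case_prod_unfold)
  show ?thesis
    unfolding F by (rule setsum_keys_plus_distrib)
      (auto simp: case_prod_unfold algebra_simps single_add sum.distrib)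
qed

lemma H_mult_add_right: "h \<otimes>\<^bsub>H\<^esub> (f + g) = h \<otimes>\<^bsub>H\<^esub> f + h \<otimes>\<^bsub>H\<^esub> g"
proof -
  let ?F = "\<lambda>(u, v) c. \<Sum>(x, y)\<in>Poly_Mapping.keys h.
       Poly_Mapping.single (x + u, y + v) (Poly_Mapping.lookup h (x, y) * c * q_pow n r (- B u y))"
  have F: "h \<otimes>\<^bsub>H\<^esub> f = (\<Sum>k\<in>Poly_Mapping.keys f. ?F k (Poly_Mapping.lookup f k))" for f
    by (simp add: quantum_torus_def case_prod_unfold) (rule sum.swap)
  show ?thesis
    unfolding F by (rule setsum_keys_plus_distrib)
      (auto simp: case_prod_unfold algebra_simps single_add sum.distrib)
qed

lemma H_mult_zero [simp]: "0 \<otimes>\<^bsub>H\<^esub> f = 0" "f \<otimes>\<^bsub>H\<^esub> 0 = 0"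
  using H_mult_add_left[of 0 0 f] H_mult_add_right[of f 0 0] by simp_all

lemma H_mult_assoc: "(f \<otimes>\<^bsub>H\<^esub> g) \<otimes>\<^bsub>H\<^esub> h = f \<otimes>\<^bsub>H\<^esub> (g \<otimes>\<^bsub>H\<^esub> h)"
  using subset_UNIV[of "Poly_Mapping.keys f"]
proof (induction f rule: poly_mapping_additive_induct)
  case f: (single k c)
  show ?case
    using subset_UNIV[of "Poly_Mapping.keys g"]
  proof (induction g rule: poly_mapping_additive_induct)
    case g: (single l d)
    show ?case
      using subset_UNIV[of "Poly_Mapping.keys h"]
    proof (induction h rule: poly_mapping_additive_induct)
      case (single m e)
      show ?case
        by (cases k; cases l; cases m) (simp add: add.assoc field_simps)
    qed (simp_all add: H_mult_add_right)
  qed (simp_all add: H_mult_add_right H_mult_add_left)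
qed (simp_all add: H_mult_add_left)

lemma H_mult_one: "Poly_Mapping.single (0, 0) 1 \<otimes>\<^bsub>H\<^esub> f = f" "f \<otimes>\<^bsub>H\<^esub> Poly_Mapping.single (0, 0) 1 = f"
proof -
  have "Poly_Mapping.single (0, 0) 1 \<otimes>\<^bsub>H\<^esub> f = f \<and> f \<otimes>\<^bsub>H\<^esub> Poly_Mapping.single (0, 0) 1 = f"
    using subset_UNIV[of "Poly_Mapping.keys f"]
  proof (induction f rule: poly_mapping_additive_induct)
    case (single k c)
    show ?case
      by (cases k) simp
  qed (simp_all add: H_mult_add_left H_mult_add_right)
  then show "Poly_Mapping.single (0, 0) 1 \<otimes>\<^bsub>H\<^esub> f = f" "f \<otimes>\<^bsub>H\<^esub> Poly_Mapping.single (0, 0) 1 = f"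
    by simp_all
qed

lemma ring_H: "ring H"
proof (rule ringI)
  have "\<exists>g. g + f = 0" for f :: "('x \<times> 'y) \<Rightarrow>\<^sub>0 complex"
    by (rule exI[of _ "- f"]) simp
  then show "abelian_group H"
    by (intro abelian_groupI) (auto simp: add.assoc add.commute)
  show "monoid H"
    by (intro monoidI) (auto simp: H_mult_assoc H_mult_one)
qed (auto simp: H_mult_add_left H_mult_add_right)

lemma scalar_central_H: "qt_scalar c \<otimes>\<^bsub>H\<^esub> f = f \<otimes>\<^bsub>H\<^esub> qt_scalar c"
  using subset_UNIV[of "Poly_Mapping.keys f"]
proof (induction f rule: poly_mapping_additive_induct)
  case (single k d)
  show ?case
    by (cases k) (simp add: qt_scalar_def mult.commute)
qed (simp_all add: H_mult_add_left H_mult_add_right)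

lemma group_algebra_add: "f \<in> group_algebra_X \<Longrightarrow> g \<in> group_algebra_X \<Longrightarrow> f + g \<in> group_algebra_X"
  using keys_add[of f g] by (auto simp: group_algebra_X_def)

lemma group_algebra_mult:
  assumes "f \<in> group_algebra_X" "g \<in> group_algebra_X"
  shows "f \<otimes>\<^bsub>H\<^esub> g \<in> group_algebra_X \<and> f \<otimes>\<^bsub>H\<^esub> g = g \<otimes>\<^bsub>H\<^esub> f"
  using assms(1) unfolding group_algebra_X_def[THEN eqset_imp_iff] mem_Collect_eq
proof (induction f rule: poly_mapping_additive_induct)
  case f: (single k c)
  show ?case
    using assms(2) unfolding group_algebra_X_def[THEN eqset_imp_iff] mem_Collect_eq
  proof (induction g rule: poly_mapping_additive_induct)
    case (single l d)
    then show ?case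
      using f by (auto simp: add.commute mult.commute split: if_splits)
  next
    case (add g h)
    then have "Poly_Mapping.single k c \<otimes>\<^bsub>H\<^esub> g + Poly_Mapping.single k c \<otimes>\<^bsub>H\<^esub> h \<in> group_algebra_X"
      by (intro group_algebra_add) (auto simp: group_algebra_X_def)
    then show ?case
      using add by (simp add: H_mult_add_left H_mult_add_right group_algebra_X_def)
  qed simp
next
  case (add f h)
  then have "f \<otimes>\<^bsub>H\<^esub> g + h \<otimes>\<^bsub>H\<^esub> g \<in> group_algebra_X"
    by (intro group_algebra_add) (auto simp: group_algebra_X_def)
  then show ?case
    using add by (simp add: H_mult_add_left H_mult_add_right group_algebra_X_def)
qed simp


subsection \<open>Reduction along a character\<close>

text \<open>The result of writing \<open>h\<close> as a combination of the \<open>e\<^sup>y e\<^sup>x\<close> and replacing each \<open>e\<^sup>x\<close> by the number \<open>t(x)\<close>. Thus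
  \<open>h\<close> and \<open>red t h\<close> act in the same way on a vector of weight \<open>t\<close>.\<close>

definition red :: "('x \<Rightarrow> complex) \<Rightarrow> (('x \<times> 'y) \<Rightarrow>\<^sub>0 complex) \<Rightarrow> (('x \<times> 'y) \<Rightarrow>\<^sub>0 complex)" where
  "red t h = (\<Sum>k\<in>Poly_Mapping.keys h.
     Poly_Mapping.single (0, snd k) (Poly_Mapping.lookup h k * t (fst k) * \<beta> (fst k) (snd k)))"

lemma red_add: "red t (f + g) = red t f + red t g"
  unfolding red_def
  by (rule setsum_keys_plus_distrib[where f = "\<lambda>k c. Poly_Mapping.single (0, snd k) (c * t (fst k) * \<beta> (fst k) (snd k))"])
    (simp_all add: single_add algebra_simps)

lemma red_zero [simp]: "red t 0 = 0"
  by (simp add: red_def)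

lemma red_single [simp]:
  "red t (Poly_Mapping.single (x, y) c) = Poly_Mapping.single (0, y) (c * t x * \<beta> x y)"
  by (simp add: red_def)

lemma keys_red: "Poly_Mapping.keys (red t h) \<subseteq> {0} \<times> UNIV"
  unfolding red_def by (rule order_trans[OF keys_sum]) auto

text \<open>The extension of a character of \<open>X\<close> to the group algebra.\<close>

definition char :: "('x \<Rightarrow> complex) \<Rightarrow> (('x \<times> 'y) \<Rightarrow>\<^sub>0 complex) \<Rightarrow> complex" where
  "char t a = (\<Sum>k\<in>Poly_Mapping.keys a. Poly_Mapping.lookup a k * t (fst k))"

lemma char_eX [simp]: "char t (eX x) = t x"
  by (simp add: char_def)

end


section \<open>Weight vectors\<close>

locale torus_module = quantum_torus_data n r B + left_module "quantum_torus n r B" M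
  for n :: nat and r :: complex and B :: "'x::ab_group_add \<Rightarrow> 'y::ab_group_add \<Rightarrow> rat"
    and M :: "(('x \<times> 'y) \<Rightarrow>\<^sub>0 complex, 'm) module" (structure)

sublocale torus_module \<subseteq> commutative_subalgebra "quantum_torus n r B" M qt_scalar group_algebra_X
proof unfold_locales
  fix c d :: complex and f g :: "('x \<times> 'y) \<Rightarrow>\<^sub>0 complex"
  show "qt_scalar c \<in> carrier H" "group_algebra_X \<subseteq> carrier H"
    by simp_all
  show "qt_scalar (c + d) = (qt_scalar c \<oplus>\<^bsub>H\<^esub> qt_scalar d :: ('x \<times> 'y) \<Rightarrow>\<^sub>0 complex)"
    by (simp add: qt_scalar_def single_add)
  show "qt_scalar (c * d) = (qt_scalar c \<otimes>\<^bsub>H\<^esub> qt_scalar d :: ('x \<times> 'y) \<Rightarrow>\<^sub>0 complex)"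
    by (simp add: qt_scalar_def)
  show "qt_scalar 1 = \<one>\<^bsub>H\<^esub>"
    by (simp add: qt_scalar_def)
  show "qt_scalar c \<otimes>\<^bsub>H\<^esub> f = f \<otimes>\<^bsub>H\<^esub> qt_scalar c"
    by (rule scalar_central_H)
  show "(qt_scalar c :: ('x \<times> 'y) \<Rightarrow>\<^sub>0 complex) \<in> group_algebra_X"
    by (simp add: qt_scalar_def group_algebra_X_def)
  show "f \<oplus>\<^bsub>H\<^esub> g \<in> group_algebra_X" if "f \<in> group_algebra_X" "g \<in> group_algebra_X"
    using that by (simp add: group_algebra_add)
  show "f \<otimes>\<^bsub>H\<^esub> g \<in> group_algebra_X" "f \<otimes>\<^bsub>H\<^esub> g = g \<otimes>\<^bsub>H\<^esub> f"
    if "f \<in> group_algebra_X" "g \<in> group_algebra_X"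
    using group_algebra_mult that by blast+
qed

context torus_module
begin

abbreviation scale :: "complex \<Rightarrow> 'm \<Rightarrow> 'm" (infixr \<open>\<cdot>\<close> 75) where
  "c \<cdot> v \<equiv> qt_scalar c \<odot>\<^bsub>M\<^esub> v"

lemma smult_closed' [simp]: "v \<in> carrier M \<Longrightarrow> h \<odot>\<^bsub>M\<^esub> v \<in> carrier M"
  by (simp add: smult_closed)

lemma smult_plus: "v \<in> carrier M \<Longrightarrow> (f + g) \<odot>\<^bsub>M\<^esub> v = f \<odot>\<^bsub>M\<^esub> v \<oplus>\<^bsub>M\<^esub> g \<odot>\<^bsub>M\<^esub> v"
  using smult_l_distr[of f g v] by simp

lemma smult_mult: "v \<in> carrier M \<Longrightarrow> f \<odot>\<^bsub>M\<^esub> (g \<odot>\<^bsub>M\<^esub> v) = (f \<otimes>\<^bsub>H\<^esub> g) \<odot>\<^bsub>M\<^esub> v"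
  using smult_assoc1[of f g v] by simp

lemma smult_zero [simp]: "v \<in> carrier M \<Longrightarrow> 0 \<odot>\<^bsub>M\<^esub> v = \<zero>\<^bsub>M\<^esub>"
  using smult_l_null[of v] by simp

lemma smult_unit [simp]: "v \<in> carrier M \<Longrightarrow> Poly_Mapping.single (0, 0) 1 \<odot>\<^bsub>M\<^esub> v = v"
  using smult_one[of v] by simp

lemma smult_sum:
  assumes v: "v \<in> carrier M" and "finite I"
  shows "(\<Sum>i\<in>I. h i) \<odot>\<^bsub>M\<^esub> v = (\<Oplus>\<^bsub>M\<^esub>i\<in>I. h i \<odot>\<^bsub>M\<^esub> v)"
  using assms(2) by induction (use v in \<open>simp_all add: smult_plus\<close>)

definition weight_vector_mod :: "'m set \<Rightarrow> ('x \<Rightarrow> complex) \<Rightarrow> 'm \<Rightarrow> bool" where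
  "weight_vector_mod K t v \<longleftrightarrow> v \<in> carrier M \<and> (\<forall>x. eX x \<odot>\<^bsub>M\<^esub> v \<ominus>\<^bsub>M\<^esub> t x \<cdot> v \<in> K)"

lemma weight_vector_mod_mono: "weight_vector_mod K t v \<Longrightarrow> K \<subseteq> L \<Longrightarrow> weight_vector_mod L t v"
  by (auto simp: weight_vector_mod_def)

text \<open>Modulo \<open>K\<close> the vector has only one eigenvalue for each operator, and the operators \<open>e\<^sup>x\<close> multiply like the
  elements of \<open>X\<close>.\<close>

lemma weight_is_character:
  assumes K: "submodule K H M" and v: "weight_vector_mod K t v" "v \<notin> K"
  shows "t \<in> carrier torus_T"
proof -
  have v_M: "v \<in> carrier M" and wt: "eX x \<odot>\<^bsub>M\<^esub> v \<ominus>\<^bsub>M\<^esub> t x \<cdot> v \<in> K" for x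
    using v by (auto simp: weight_vector_mod_def)
  have unique: "c = d" if "u \<in> carrier M" "u \<ominus>\<^bsub>M\<^esub> c \<cdot> v \<in> K" "u \<ominus>\<^bsub>M\<^esub> d \<cdot> v \<in> K" for u c d
  proof (rule ccontr)
    assume "c \<noteq> d"
    have "(u \<ominus>\<^bsub>M\<^esub> d \<cdot> v) \<ominus>\<^bsub>M\<^esub> (u \<ominus>\<^bsub>M\<^esub> c \<cdot> v) = (c - d) \<cdot> v"
      using that v_M by (simp add: cscale_diff a_minus_def M.minus_add M.a_ac M.r_neg1 M.r_neg2)
    then have "(c - d) \<cdot> v \<in> K"
      using submodule_minus[OF K that(3,2)] by simp
    then show False
      using subspace_cscale_iff[OF submodule_subspace[OF K] v_M, of "c - d"] \<open>c \<noteq> d\<close> v(2) by simp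
  qed
  have mult: "t (x + x') = t x * t x'" for x x'
  proof (rule unique)
    show "eX (x + x') \<odot>\<^bsub>M\<^esub> v \<in> carrier M" "eX (x + x') \<odot>\<^bsub>M\<^esub> v \<ominus>\<^bsub>M\<^esub> t (x + x') \<cdot> v \<in> K"
      using v_M wt by simp_all
    have "eX x \<odot>\<^bsub>M\<^esub> (eX x' \<odot>\<^bsub>M\<^esub> v \<ominus>\<^bsub>M\<^esub> t x' \<cdot> v) \<oplus>\<^bsub>M\<^esub> t x' \<cdot> (eX x \<odot>\<^bsub>M\<^esub> v \<ominus>\<^bsub>M\<^esub> t x \<cdot> v) \<in> K"
      using K wt by (simp add: submodule_iff)
    moreover have "eX x \<odot>\<^bsub>M\<^esub> (eX x' \<odot>\<^bsub>M\<^esub> v \<ominus>\<^bsub>M\<^esub> t x' \<cdot> v) = eX (x + x') \<odot>\<^bsub>M\<^esub> v \<ominus>\<^bsub>M\<^esub> t x' \<cdot> (eX x \<odot>\<^bsub>M\<^esub> v)"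
      using v_M by (simp add: smult_r_diff smult_mult qt_scalar_def)
    moreover have "t x' \<cdot> (eX x \<odot>\<^bsub>M\<^esub> v \<ominus>\<^bsub>M\<^esub> t x \<cdot> v) = t x' \<cdot> (eX x \<odot>\<^bsub>M\<^esub> v) \<ominus>\<^bsub>M\<^esub> (t x * t x') \<cdot> v"
      using v_M by (simp add: smult_r_diff mult.commute)
    ultimately show "eX (x + x') \<odot>\<^bsub>M\<^esub> v \<ominus>\<^bsub>M\<^esub> (t x * t x') \<cdot> v \<in> K"
      using v_M by (simp add: a_minus_def M.a_assoc M.r_neg1 M.r_neg2)
  qed
  have "t 0 = 1"
  proof (rule unique)
    show "v \<ominus>\<^bsub>M\<^esub> t 0 \<cdot> v \<in> K"
      using wt[of 0] v_M by simp
    show "v \<ominus>\<^bsub>M\<^esub> 1 \<cdot> v \<in> K"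
      using v_M K by (simp add: a_minus_def M.r_neg submodule_iff)
  qed (rule v_M)
  then have "t x * t (- x) = 1" for x
    using mult[of x "- x"] by simp
  then have "t x \<noteq> 0" for x
    by (metis mult_zero_left zero_neq_one)
  then show ?thesis
    using mult by (simp add: torus_T_def)
qed

lemma smult_red:
  assumes K: "submodule K H M" and v: "weight_vector_mod K t v"
  shows "h \<odot>\<^bsub>M\<^esub> v \<ominus>\<^bsub>M\<^esub> red t h \<odot>\<^bsub>M\<^esub> v \<in> K"
proof -
  have v_M: "v \<in> carrier M" and wt: "eX x \<odot>\<^bsub>M\<^esub> v \<ominus>\<^bsub>M\<^esub> t x \<cdot> v \<in> K" for x
    using v by (auto simp: weight_vector_mod_def)
  show ?thesis
    using subset_UNIV[of "Poly_Mapping.keys h"]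
  proof (induction h rule: poly_mapping_additive_induct)
    case zero
    then show ?case
      using v_M K by (simp add: submodule_iff)
  next
    case (single k c)
    obtain x y where k: "k = (x, y)"
      by fastforce
    \<comment> \<open>\<open>e\<^sup>x e\<^sup>y = \<beta>(x,y) e\<^sup>y e\<^sup>x\<close>\<close>
    let ?e = "Poly_Mapping.single (0, y) (c * \<beta> x y)"
    have "?e \<odot>\<^bsub>M\<^esub> (eX x \<odot>\<^bsub>M\<^esub> v \<ominus>\<^bsub>M\<^esub> t x \<cdot> v) \<in> K"
      using K wt by (simp add: submodule_iff)
    moreover have "?e \<odot>\<^bsub>M\<^esub> (eX x \<odot>\<^bsub>M\<^esub> v \<ominus>\<^bsub>M\<^esub> t x \<cdot> v) =
        Poly_Mapping.single k c \<odot>\<^bsub>M\<^esub> v \<ominus>\<^bsub>M\<^esub> red t (Poly_Mapping.single k c) \<odot>\<^bsub>M\<^esub> v"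
      using v_M by (simp add: k smult_r_diff smult_mult qt_scalar_def ac_simps)
    ultimately show ?case
      by simp
  next
    case (add f g)
    have "(f \<odot>\<^bsub>M\<^esub> v \<ominus>\<^bsub>M\<^esub> red t f \<odot>\<^bsub>M\<^esub> v) \<oplus>\<^bsub>M\<^esub> (g \<odot>\<^bsub>M\<^esub> v \<ominus>\<^bsub>M\<^esub> red t g \<odot>\<^bsub>M\<^esub> v) \<in> K"
      using K add by (simp add: submodule_iff)
    moreover have "(f \<odot>\<^bsub>M\<^esub> v \<ominus>\<^bsub>M\<^esub> red t f \<odot>\<^bsub>M\<^esub> v) \<oplus>\<^bsub>M\<^esub> (g \<odot>\<^bsub>M\<^esub> v \<ominus>\<^bsub>M\<^esub> red t g \<odot>\<^bsub>M\<^esub> v) =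
        (f + g) \<odot>\<^bsub>M\<^esub> v \<ominus>\<^bsub>M\<^esub> red t (f + g) \<odot>\<^bsub>M\<^esub> v"
      using v_M by (simp add: red_add smult_plus a_minus_def M.minus_add M.a_ac)
    ultimately show ?case
      by simp
  qed
qed

text \<open>The annihilator of a weight vector modulo \<open>K\<close> depends on the weight only. Indeed \<open>red t h\<close> sends \<open>v\<close>
  to a sum of multiples of the \<open>e\<^sup>y v\<close>, whose weights are different. If the sum is in \<open>K\<close>, then so is each
  term, and since \<open>e\<^sup>y\<close> is invertible and \<open>v\<close> is not in \<open>K\<close>, all the coefficients vanish.\<close>

theorem smult_mem_iff_red_zero:
  assumes K: "submodule K H M" and v: "weight_vector_mod K t v" "v \<notin> K"
  shows "h \<odot>\<^bsub>M\<^esub> v \<in> K \<longleftrightarrow> red t h = 0"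
proof
  have v_M: "v \<in> carrier M"
    using v by (simp add: weight_vector_mod_def)
  {
    assume "red t h = 0"
    then show "h \<odot>\<^bsub>M\<^esub> v \<in> K"
      using smult_red[OF K v(1), of h] v_M by simp
  }
  assume hv: "h \<odot>\<^bsub>M\<^esub> v \<in> K"
  have t: "t \<in> carrier torus_T"
    using weight_is_character[OF K v] .
  then have t_nz: "t x \<noteq> 0" for x
    by (simp add: torus_T_def)
  let ?g = "red t h"
  let ?w = "\<lambda>k. Poly_Mapping.single k (Poly_Mapping.lookup ?g k) \<odot>\<^bsub>M\<^esub> v"
  \<comment> \<open>The weight of the \<open>k\<close>-th term, where \<open>k = (0, y)\<close>.\<close>
  let ?\<alpha> = "\<lambda>k. char (\<lambda>x. t x * \<beta> x (snd k))"
  have "h \<odot>\<^bsub>M\<^esub> v \<ominus>\<^bsub>M\<^esub> (h \<odot>\<^bsub>M\<^esub> v \<ominus>\<^bsub>M\<^esub> ?g \<odot>\<^bsub>M\<^esub> v) \<in> K"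
    using submodule_minus[OF K hv smult_red[OF K v(1)]] .
  then have g_K: "?g \<odot>\<^bsub>M\<^esub> v \<in> K"
    using v_M by (simp add: a_minus_def M.minus_add M.a_ac M.r_neg1 M.r_neg2)
  have "?g = (\<Sum>k\<in>Poly_Mapping.keys ?g. Poly_Mapping.single k (Poly_Mapping.lookup ?g k))"
    by (rule poly_mapping_eqI)
      (simp add: lookup_sum lookup_single when_def in_keys_iff)
  then have "(\<Oplus>\<^bsub>M\<^esub>k\<in>Poly_Mapping.keys ?g. ?w k) \<in> K"
    using g_K smult_sum[OF v_M, of "Poly_Mapping.keys ?g" "\<lambda>k. Poly_Mapping.single k (Poly_Mapping.lookup ?g k)"]
    by simp
  moreover have "\<exists>a\<in>range eX. ?\<alpha> k a \<noteq> ?\<alpha> l a"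
    if "k \<in> Poly_Mapping.keys ?g" "l \<in> Poly_Mapping.keys ?g" "k \<noteq> l" for k l
  proof -
    have "snd k \<noteq> snd l"
      using that keys_red[of t h] by (cases k; cases l) auto
    then obtain x where "\<beta> x (snd k) \<noteq> \<beta> x (snd l)"
      using \<beta>_separates by blast
    then have "?\<alpha> k (eX x) \<noteq> ?\<alpha> l (eX x)"
      using t_nz[of x] by simp
    then show ?thesis
      by blast
  qed
  moreover have "a \<odot>\<^bsub>M\<^esub> ?w k \<ominus>\<^bsub>M\<^esub> ?\<alpha> k a \<cdot> ?w k \<in> K"
    if k: "k \<in> Poly_Mapping.keys ?g" and a: "a \<in> range eX" for k a
  proof -
    obtain x where x: "a = eX x"
      using a by blast
    obtain y where y: "k = (0, y)"
      using k keys_red[of t h] by auto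
    let ?c = "Poly_Mapping.lookup ?g k"
    let ?e = "Poly_Mapping.single (0, y) (\<beta> x y * ?c)"
    have "?e \<odot>\<^bsub>M\<^esub> (eX x \<odot>\<^bsub>M\<^esub> v \<ominus>\<^bsub>M\<^esub> t x \<cdot> v) \<in> K"
      using K v(1) by (simp add: submodule_iff weight_vector_mod_def)
    moreover have "?e \<odot>\<^bsub>M\<^esub> (eX x \<odot>\<^bsub>M\<^esub> v \<ominus>\<^bsub>M\<^esub> t x \<cdot> v) = a \<odot>\<^bsub>M\<^esub> ?w k \<ominus>\<^bsub>M\<^esub> ?\<alpha> k a \<cdot> ?w k"
      using v_M
      by (simp add: x y smult_r_diff smult_mult qt_scalar_def ac_simps)
    ultimately show ?thesis
      by simp
  qed
  ultimately have w_K: "?w k \<in> K" if "k \<in> Poly_Mapping.keys ?g" for k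
    using weights_separated[OF K, of "range eX" "Poly_Mapping.keys ?g" ?\<alpha> ?w k] that v_M by simp
  show "red t h = 0"
  proof (rule ccontr)
    assume "?g \<noteq> 0"
    then obtain k where k: "k \<in> Poly_Mapping.keys ?g"
      by (metis all_not_in_conv keys_eq_empty)
    then obtain y where y: "k = (0, y)"
      using keys_red[of t h] by auto
    let ?c = "Poly_Mapping.lookup ?g k"
    have "Poly_Mapping.single (0, - y) (1 / ?c) \<odot>\<^bsub>M\<^esub> ?w k \<in> K"
      using w_K[OF k] K by (simp add: submodule_iff)
    moreover have "Poly_Mapping.single (0, - y) (1 / ?c) \<odot>\<^bsub>M\<^esub> ?w k = v"
      using v_M k by (simp add: y smult_mult[of v] in_keys_iff)
    ultimately show False
      using v(2) by simp
  qed
qed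

end


section \<open>Modules generated by weight vectors\<close>

context torus_module
begin

text \<open>If \<open>v\<close> is not in \<open>K\<close>, then \<open>v\<close> is a weight vector modulo \<open>N\<close> and modulo \<open>K\<close>, and the two submodules
  contain the same multiples of \<open>v\<close>.\<close>

lemma weight_vector_extension_maximal:
  assumes N: "submodule N H M" and v: "weight_vector_mod N t v" "v \<notin> N"
    and K: "submodule K H M" "N \<subseteq> K" "K \<subseteq> N <+>\<^bsub>M\<^esub> cyclic v"
  shows "K = N \<or> K = N <+>\<^bsub>M\<^esub> cyclic v"
proof (cases "v \<in> K")
  case True
  then have "cyclic v \<subseteq> K"
    using cyclic_least K(1) by blast
  then have "N <+>\<^bsub>M\<^esub> cyclic v \<subseteq> K"
    using K(1,2) unfolding set_add_def' submodule_iff by blast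
  then show ?thesis
    using K(3) by blast
next
  case False
  have v_M: "v \<in> carrier M"
    using v by (simp add: weight_vector_mod_def)
  have "u \<in> N" if u: "u \<in> K" for u
  proof -
    obtain m h where m: "m \<in> N" and u_eq: "u = m \<oplus>\<^bsub>M\<^esub> h \<odot>\<^bsub>M\<^esub> v"
      using u K(3) by (auto simp: set_add_def' cyclic_def)
    have m_M: "m \<in> carrier M"
      using m submodule_subset[OF N] by blast
    have "u \<ominus>\<^bsub>M\<^esub> m \<in> K"
      using submodule_minus[OF K(1) u] m K(2) by blast
    then have "h \<odot>\<^bsub>M\<^esub> v \<in> K"
      unfolding u_eq using m_M v_M by (simp add: add_diff_cancel_left)
    then have "h \<odot>\<^bsub>M\<^esub> v \<in> N"
      using smult_mem_iff_red_zero[OF K(1) weight_vector_mod_mono[OF v(1) K(2)] False]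
        smult_mem_iff_red_zero[OF N v] by blast
    then show ?thesis
      using m N by (simp add: u_eq submodule_iff)
  qed
  then show ?thesis
    using K(2) by blast
qed

abbreviation weight_vector :: "('x \<Rightarrow> complex) \<Rightarrow> 'm \<Rightarrow> bool" where
  "weight_vector \<equiv> weight_vector_mod {\<zero>\<^bsub>M\<^esub>}"

lemma weight_vectorD: "weight_vector t v \<Longrightarrow> v \<in> carrier M"
  by (simp add: weight_vector_mod_def)

text \<open>The multiples of \<open>v\<close> that lie in \<open>N\<close> are those that lie in the zero submodule.\<close>

lemma weight_vector_disjoint:
  assumes N: "submodule N H M" and v: "weight_vector t v" "v \<notin> N"
  shows "N \<inter> cyclic v = {\<zero>\<^bsub>M\<^esub>}"
proof
  have zero: "\<zero>\<^bsub>M\<^esub> \<in> N"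
    using N by (simp add: submodule_iff)
  show "N \<inter> cyclic v \<subseteq> {\<zero>\<^bsub>M\<^esub>}"
  proof
    fix u assume "u \<in> N \<inter> cyclic v"
    then obtain h where h: "u = h \<odot>\<^bsub>M\<^esub> v" "h \<odot>\<^bsub>M\<^esub> v \<in> N"
      by (auto simp: cyclic_def)
    have "weight_vector_mod N t v"
      using v(1) zero by (auto intro: weight_vector_mod_mono)
    then have "red t h = 0"
      using smult_mem_iff_red_zero[OF N _ v(2)] h(2) by blast
    then show "u \<in> {\<zero>\<^bsub>M\<^esub>}"
      using smult_mem_iff_red_zero[OF zero_submodule v(1)] v(2) zero h(1) by auto
  qed
  show "{\<zero>\<^bsub>M\<^esub>} \<subseteq> N \<inter> cyclic v"
    using zero cyclic_submodule[OF weight_vectorD[OF v(1)]] by (auto simp: submodule_iff)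
qed

lemma weight_vector_cyclic_simple:
  assumes v: "weight_vector t v" "v \<noteq> \<zero>\<^bsub>M\<^esub>"
  shows "simple_module H (M\<lparr>carrier := cyclic v\<rparr>)"
proof -
  have v_M: "v \<in> carrier M"
    using weight_vectorD[OF v(1)] .
  note cyc = cyclic_submodule[OF v_M]
  have "K = {\<zero>\<^bsub>M\<^esub>} \<or> K = cyclic v" if K: "submodule K H M" "K \<subseteq> cyclic v" for K
  proof (cases "v \<in> K")
    case True
    then show ?thesis
      using cyclic_least K by blast
  next
    case False
    then show ?thesis
      using weight_vector_disjoint[OF K(1) v(1)] K(2) by blast
  qed
  moreover have "cyclic v \<noteq> {\<zero>\<^bsub>M\<^esub>}"
    using cyclic_self[OF v_M] v(2) by blast
  ultimately show ?thesis
    using left_module_restrict[OF cyc] by (simp add: simple_module_def submodule_restrict_iff[OF cyc])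
qed

lemma torus_module_restrict: "submodule N H M \<Longrightarrow> torus_module n r B (M\<lparr>carrier := N\<rparr>)"
  by (intro torus_module.intro left_module_restrict quantum_torus_data_axioms)

lemma finite_dim_restrict:
  assumes N: "submodule N H M" and V: "V \<subseteq> N"
  shows "finite_dim qt_scalar (M\<lparr>carrier := N\<rparr>) V \<longleftrightarrow> finite_dim qt_scalar M V"
proof -
  have "(\<Oplus>\<^bsub>M\<lparr>carrier := N\<rparr>\<^esub>s\<in>S. c s \<cdot> s) = (\<Oplus>\<^bsub>M\<^esub>s\<in>S. c s \<cdot> s)" if "S \<subseteq> V" for S c
    using that V N by (intro finsum_restrict) (auto simp: submodule_iff)
  then show ?thesis
    unfolding finite_dim_def by (simp cong: conj_cong)
qed

lemma category_M_cyclic: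
  assumes M: "category_M H qt_scalar group_algebra_X M" and v: "v \<in> carrier M"
  shows "category_M H qt_scalar group_algebra_X (M\<lparr>carrier := cyclic v\<rparr>)"
proof -
  note cyc = cyclic_submodule[OF v]
  have "finitely_generated H (M\<lparr>carrier := cyclic v\<rparr>)"
    unfolding finitely_generated_def submodule_restrict_iff[OF cyc]
    using cyclic_self[OF v] cyclic_least by (intro exI[of _ "{v}"]) auto
  moreover have "finite_dim qt_scalar (M\<lparr>carrier := cyclic v\<rparr>) ((\<lambda>a. a \<odot>\<^bsub>M\<^esub> m) ` group_algebra_X)"
    if m: "m \<in> cyclic v" for m
  proof -
    have "(\<lambda>a. a \<odot>\<^bsub>M\<^esub> m) ` group_algebra_X \<subseteq> cyclic v"
      using m cyc by (auto simp: submodule_iff)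
    then show ?thesis
      using finite_dim_restrict[OF cyc] M m cyc by (auto simp: category_M_def submodule_iff)
  qed
  ultimately show ?thesis
    using left_module_restrict[OF cyc] by (simp add: category_M_def)
qed

lemma locally_finite: "category_M H qt_scalar group_algebra_X M \<Longrightarrow> m \<in> carrier M \<Longrightarrow> finite_dim qt_scalar M (orbit m)"
  by (simp add: category_M_def orbit_def)

lemma weight_vector_exists:
  assumes N: "submodule N H M" and w: "w \<in> carrier M" "w \<notin> N" and fin: "finite_dim qt_scalar M (orbit w)"
  obtains u t where "u \<in> orbit w" "u \<notin> N" "weight_vector_mod N t u"
proof -
  obtain u \<alpha> where u: "u \<in> orbit w" "u \<notin> N"
    and \<alpha>: "\<And>a. a \<in> group_algebra_X \<Longrightarrow> a \<odot>\<^bsub>M\<^esub> u \<ominus>\<^bsub>M\<^esub> \<alpha> a \<cdot> u \<in> N"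
    using eigenvector_exists[OF N w fin] by blast
  have "eX x \<in> group_algebra_X" for x
    by (simp add: group_algebra_X_def)
  then have "weight_vector_mod N (\<lambda>x. \<alpha> (eX x)) u"
    using \<alpha> orbit_closed[OF w(1) u(1)] by (simp add: weight_vector_mod_def)
  then show ?thesis
    using that u by blast
qed

text \<open>As long as a submodule \<open>W\<close> is proper, some generator \<open>g\<close> lies outside \<open>W\<close>, and \<open>A g\<close> contains a weight
  vector modulo \<open>W\<close>. All these vectors lie in the span of the finite dimensional spaces \<open>A g\<close>.\<close>

theorem category_M_finite_length:
  assumes M: "category_M H qt_scalar group_algebra_X M"
  shows "finite_length H M"
proof -
  obtain G where G: "finite G" "G \<subseteq> carrier M" "\<And>N. submodule N H M \<Longrightarrow> G \<subseteq> N \<Longrightarrow> N = carrier M"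
    using M by (auto simp: category_M_def finitely_generated_def)
  have "\<forall>g\<in>G. \<exists>S. finite S \<and> S \<subseteq> orbit g \<and> orbit g \<subseteq> lin S"
    using locally_finite[OF M] G(2) by (auto simp: finite_dim_iff)
  then obtain S where S: "\<And>g. g \<in> G \<Longrightarrow> finite (S g) \<and> S g \<subseteq> orbit g \<and> orbit g \<subseteq> lin (S g)"
    by metis
  let ?S = "\<Union>g\<in>G. S g"
  have fin: "finite ?S"
    using S G(1) by blast
  have S_M: "?S \<subseteq> carrier M"
    using S G(2) orbit_closed by blast
  have "submodule (carrier M) H M \<and> has_composition_series (carrier M)"
    using fin S_M
  proof (induction rule: ascending_induct)
    case (subspace W)
    then show ?case
      using submodule_subspace by blast
  next
    case start
    show "submodule {\<zero>\<^bsub>M\<^esub>} H M \<and> has_composition_series {\<zero>\<^bsub>M\<^esub>}"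
      using zero_submodule has_composition_series_zero by blast
  next
    case (extend W)
    then have W: "submodule W H M" and series: "has_composition_series W"
      by auto
    obtain g where g: "g \<in> G" "g \<notin> W"
      using G(3)[OF W] extend(2) by blast
    then have "g \<in> carrier M"
      using G(2) by blast
    then obtain u t where u: "u \<in> orbit g" "u \<notin> W" "weight_vector_mod W t u"
      using weight_vector_exists[OF W _ g(2)] locally_finite[OF M] by blast
    have u_M: "u \<in> carrier M"
      using u(3) by (simp add: weight_vector_mod_def)
    note cyc = cyclic_submodule[OF u_M]
    let ?W = "W <+>\<^bsub>M\<^esub> cyclic u"
    have W': "submodule ?W H M" "W \<subseteq> ?W" "u \<in> ?W"
      using sum_submodule[OF W cyc] subset_sum_left[OF W cyc] subset_sum_right[OF W cyc]
        cyclic_self[OF u_M] by blast+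
    moreover have "has_composition_series ?W"
      using has_composition_series_extend[OF series W'(1)] W'(2,3) u(2)
        weight_vector_extension_maximal[OF W u(3,2)] by blast
    moreover have "u \<in> lin ?S"
      using u(1) S[OF g(1)] lin_mono[OF fin _ S_M, of "S g"] g(1) by blast
    ultimately show ?case
      using u(2) by blast
  qed
  then show ?thesis
    by (simp add: finite_length_iff)
qed


subsection \<open>The category of weight modules\<close>

lemma weight_space_weight_vector:
  assumes "m \<in> weight_space qt_scalar group_algebra_X M \<alpha>"
  shows "weight_vector (\<lambda>x. \<alpha> (eX x)) m"
proof -
  have "eX x \<in> group_algebra_X" for x
    by (simp add: group_algebra_X_def)
  then show ?thesis
    using assms by (auto simp: weight_vector_mod_def weight_space_def diff_eq_zero_iff)
qed

text \<open>Here the weight vectors come from the finitely many weight components of the generators.\<close>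

lemma category_Mss_decomposition:
  assumes M: "category_Mss H qt_scalar group_algebra_X M"
  shows "\<exists>k U. is_direct_sum (carrier M) k U \<and>
    (\<forall>i<k. \<exists>w t. w \<noteq> \<zero>\<^bsub>M\<^esub> \<and> weight_vector t w \<and> U i = cyclic w)"
proof -
  let ?W = "weights H qt_scalar group_algebra_X" and ?V = "weight_space qt_scalar group_algebra_X M"
  have "finitely_generated H M"
    using M by (simp add: category_Mss_def category_M_def)
  then obtain G where G: "finite G" "G \<subseteq> carrier M" "\<And>N. submodule N H M \<Longrightarrow> G \<subseteq> N \<Longrightarrow> N = carrier M"
    by (auto simp: finitely_generated_def)
  have "\<exists>f. f \<in> (\<Pi>\<^sub>E \<alpha>\<in>?W. ?V \<alpha>) \<and> finite {\<alpha>\<in>?W. f \<alpha> \<noteq> \<zero>\<^bsub>M\<^esub>} \<and>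
      g = (\<Oplus>\<^bsub>M\<^esub>\<alpha>\<in>{\<alpha>\<in>?W. f \<alpha> \<noteq> \<zero>\<^bsub>M\<^esub>}. f \<alpha>)" if "g \<in> G" for g
  proof -
    have "g \<in> carrier M"
      using G(2) that by blast
    then have "\<exists>!f. f \<in> (\<Pi>\<^sub>E \<alpha>\<in>?W. ?V \<alpha>) \<and> finite {\<alpha>\<in>?W. f \<alpha> \<noteq> \<zero>\<^bsub>M\<^esub>} \<and>
        g = (\<Oplus>\<^bsub>M\<^esub>\<alpha>\<in>{\<alpha>\<in>?W. f \<alpha> \<noteq> \<zero>\<^bsub>M\<^esub>}. f \<alpha>)"
      using M by (simp add: category_Mss_def is_internal_direct_sum_def)
    then show ?thesis
      by (rule ex1_implies_ex)
  qed
  then have "\<forall>g\<in>G. \<exists>f. f \<in> (\<Pi>\<^sub>E \<alpha>\<in>?W. ?V \<alpha>) \<and> finite {\<alpha>\<in>?W. f \<alpha> \<noteq> \<zero>\<^bsub>M\<^esub>} \<and>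
      g = (\<Oplus>\<^bsub>M\<^esub>\<alpha>\<in>{\<alpha>\<in>?W. f \<alpha> \<noteq> \<zero>\<^bsub>M\<^esub>}. f \<alpha>)"
    by (rule ballI)
  from bchoice[OF this] obtain f where f: "\<And>g. g \<in> G \<Longrightarrow> f g \<in> (\<Pi>\<^sub>E \<alpha>\<in>?W. ?V \<alpha>)"
      "\<And>g. g \<in> G \<Longrightarrow> finite {\<alpha>\<in>?W. f g \<alpha> \<noteq> \<zero>\<^bsub>M\<^esub>}"
      "\<And>g. g \<in> G \<Longrightarrow> g = (\<Oplus>\<^bsub>M\<^esub>\<alpha>\<in>{\<alpha>\<in>?W. f g \<alpha> \<noteq> \<zero>\<^bsub>M\<^esub>}. f g \<alpha>)"
    by blast
  let ?S = "\<Union>g\<in>G. f g ` {\<alpha>\<in>?W. f g \<alpha> \<noteq> \<zero>\<^bsub>M\<^esub>}"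
  have fin: "finite ?S"
    using f(2) G(1) by blast
  have f_V: "f g \<alpha> \<in> ?V \<alpha>" if "g \<in> G" "\<alpha> \<in> ?W" for g \<alpha>
    using f(1)[OF that(1)] that(2) by blast
  have S_M: "?S \<subseteq> carrier M"
    using f_V by (auto simp: weight_space_def)
  define P where "P W \<longleftrightarrow> submodule W H M \<and> (\<exists>k U. is_direct_sum W k U \<and>
    (\<forall>i<k. \<exists>w t. w \<noteq> \<zero>\<^bsub>M\<^esub> \<and> weight_vector t w \<and> U i = cyclic w))" for W
  have "P (carrier M)"
    using fin S_M
  proof (induction rule: ascending_induct)
    case (subspace W)
    then show ?case
      using submodule_subspace by (simp add: P_def)
  next
    case start
    show "P {\<zero>\<^bsub>M\<^esub>}"
      unfolding P_def using zero_submodule is_direct_sum_zero by blast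
  next
    case (extend W)
    then obtain k U where W: "submodule W H M" and U: "is_direct_sum W k U"
      and U_cyc: "\<And>i. i < k \<Longrightarrow> \<exists>w t. w \<noteq> \<zero>\<^bsub>M\<^esub> \<and> weight_vector t w \<and> U i = cyclic w"
      by (auto simp: P_def)
    obtain g where g: "g \<in> G" "g \<notin> W"
      using G(3)[OF W] extend(2) by blast
    obtain \<alpha> where \<alpha>: "\<alpha> \<in> ?W" "f g \<alpha> \<noteq> \<zero>\<^bsub>M\<^esub>" "f g \<alpha> \<notin> W"
    proof (rule ccontr)
      assume "\<not> thesis"
      then have "f g \<in> {\<alpha>\<in>?W. f g \<alpha> \<noteq> \<zero>\<^bsub>M\<^esub>} \<rightarrow> W"
        using that by blast
      then have "(\<Oplus>\<^bsub>M\<^esub>\<alpha>\<in>{\<alpha>\<in>?W. f g \<alpha> \<noteq> \<zero>\<^bsub>M\<^esub>}. f g \<alpha>) \<in> W"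
        by (rule submodule_finsum[OF W])
      then show False
        using g(2) unfolding f(3)[OF g(1), symmetric] by (rule notE[rotated])
    qed
    let ?u = "f g \<alpha>" and ?t = "\<lambda>x. \<alpha> (eX x)"
    have u: "weight_vector ?t ?u"
      using weight_space_weight_vector f_V[OF g(1) \<alpha>(1)] by blast
    note u_M = weight_vectorD[OF u]
    note cyc = cyclic_submodule[OF u_M]
    let ?W' = "W <+>\<^bsub>M\<^esub> cyclic ?u"
    have W': "submodule ?W' H M" "W \<subseteq> ?W'" "?u \<in> ?W'"
      using sum_submodule[OF W cyc] subset_sum_left[OF W cyc] subset_sum_right[OF W cyc]
        cyclic_self[OF u_M] by blast+
    have "is_direct_sum ?W' (Suc k) (U(k := cyclic ?u))"
      using is_direct_sum_extend[OF W cyc weight_vector_disjoint[OF W u \<alpha>(3)] U] .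
    moreover have "\<exists>w t. w \<noteq> \<zero>\<^bsub>M\<^esub> \<and> weight_vector t w \<and> (U(k := cyclic ?u)) i = cyclic w" if "i < Suc k" for i
    proof (cases "i = k")
      case True
      then show ?thesis
        using u \<alpha>(2) by auto
    next
      case False
      then show ?thesis
        using U_cyc[of i] that by simp
    qed
    ultimately have "P ?W'"
      unfolding P_def using W'(1) by blast
    moreover have "?u \<in> lin ?S"
      using fin S_M g(1) \<alpha> by (intro lin_superset) auto
    ultimately show ?case
      using W' \<alpha>(3) by blast
  qed
  then show ?thesis
    by (simp add: P_def)
qed

text \<open>A submodule contains the weight components of its elements, by separation of weights.\<close>

lemma category_Mss_cyclic:
  assumes M: "category_Mss H qt_scalar group_algebra_X M" and v: "v \<in> carrier M"
  shows "category_Mss H qt_scalar group_algebra_X (M\<lparr>carrier := cyclic v\<rparr>)"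
proof -
  let ?W = "weights H qt_scalar group_algebra_X" and ?V = "weight_space qt_scalar group_algebra_X M"
  let ?N = "cyclic v"
  let ?M = "M\<lparr>carrier := ?N\<rparr>"
  let ?V' = "weight_space qt_scalar group_algebra_X ?M"
  note cyc = cyclic_submodule[OF v]
  interpret N: torus_module n r B ?M
    by (rule torus_module_restrict[OF cyc])
  have N_M: "x \<in> carrier M" if "x \<in> ?N" for x
    using that submodule_subset[OF cyc] by blast
  have V': "?V' \<alpha> = ?V \<alpha> \<inter> ?N" for \<alpha>
    using N_M by (auto simp: weight_space_def)
  have sub: "subspace (?V \<alpha>)" for \<alpha>
    unfolding subspace_def
  proof (intro conjI ballI allI)
    show "\<zero>\<^bsub>M\<^esub> \<in> ?V \<alpha>"
      by (simp add: weight_space_def smult_r_null)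
    show "x \<oplus>\<^bsub>M\<^esub> y \<in> ?V \<alpha>" if "x \<in> ?V \<alpha>" "y \<in> ?V \<alpha>" for x y
      using that by (auto simp: weight_space_def smult_r_distr)
    show "c \<cdot> x \<in> ?V \<alpha>" if "x \<in> ?V \<alpha>" for c x
    proof -
      have x: "x \<in> carrier M" "\<And>a. a \<in> group_algebra_X \<Longrightarrow> a \<odot>\<^bsub>M\<^esub> x = \<alpha> a \<cdot> x"
        using that by (auto simp: weight_space_def)
      have "a \<odot>\<^bsub>M\<^esub> c \<cdot> x = \<alpha> a \<cdot> c \<cdot> x" if "a \<in> group_algebra_X" for a
        using x(1) x(2)[OF that] smult_cscale[of a x c] by (simp add: mult.commute)
      then show ?thesis
        using x(1) by (simp add: weight_space_def)
    qed
  qed (auto simp: weight_space_def)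
  have sub': "subspace (?V' \<alpha>)" for \<alpha>
    using sub[of \<alpha>] submodule_subspace[OF cyc] unfolding V' subspace_def by blast
  have "subgroup (?V' \<alpha>) (add_monoid ?M)" for \<alpha>
  proof (rule N.M.add.subgroupI)
    fix x assume that: "x \<in> ?V' \<alpha>"
    show "\<ominus>\<^bsub>?M\<^esub> x \<in> ?V' \<alpha>"
    proof -
      have x: "x \<in> ?N" "x \<in> carrier M" "\<ominus>\<^bsub>M\<^esub> x \<in> ?V' \<alpha>"
        using that N_M V' subspace_diff[OF sub'[of \<alpha>], of "\<zero>\<^bsub>M\<^esub>" x] sub'[of \<alpha>]
        by (auto simp: subspace_def a_minus_def)
      then have "\<ominus>\<^bsub>?M\<^esub> x = \<ominus>\<^bsub>M\<^esub> x"
        using V' by (intro N.M.minus_equality) (auto simp: M.l_neg)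
      then show ?thesis
        using x(3) by simp
    qed
  qed (use sub'[of \<alpha>] V'[of \<alpha>] in \<open>auto simp: subspace_def\<close>)
  moreover have "\<exists>!f. f \<in> (\<Pi>\<^sub>E \<alpha>\<in>?W. ?V' \<alpha>) \<and> finite {\<alpha>\<in>?W. f \<alpha> \<noteq> \<zero>\<^bsub>?M\<^esub>} \<and>
      m = (\<Oplus>\<^bsub>?M\<^esub>\<alpha>\<in>{\<alpha>\<in>?W. f \<alpha> \<noteq> \<zero>\<^bsub>?M\<^esub>}. f \<alpha>)" if m: "m \<in> ?N" for m
  proof -
    let ?D = "\<lambda>f. f \<in> (\<Pi>\<^sub>E \<alpha>\<in>?W. ?V \<alpha>) \<and> finite {\<alpha>\<in>?W. f \<alpha> \<noteq> \<zero>\<^bsub>M\<^esub>} \<and>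
      m = (\<Oplus>\<^bsub>M\<^esub>\<alpha>\<in>{\<alpha>\<in>?W. f \<alpha> \<noteq> \<zero>\<^bsub>M\<^esub>}. f \<alpha>)"
    have ex1: "\<exists>!f. ?D f"
      using M N_M[OF m] by (simp add: category_Mss_def is_internal_direct_sum_def)
    have sum_eq: "(\<Oplus>\<^bsub>?M\<^esub>\<alpha>\<in>{\<alpha>\<in>?W. f \<alpha> \<noteq> \<zero>\<^bsub>?M\<^esub>}. f \<alpha>) = (\<Oplus>\<^bsub>M\<^esub>\<alpha>\<in>{\<alpha>\<in>?W. f \<alpha> \<noteq> \<zero>\<^bsub>M\<^esub>}. f \<alpha>)"
      if "f \<in> (\<Pi>\<^sub>E \<alpha>\<in>?W. ?V' \<alpha>)" for f
      using that V' finsum_restrict[OF cyc, of f "{\<alpha>\<in>?W. f \<alpha> \<noteq> \<zero>\<^bsub>M\<^esub>}"] by (auto simp: PiE_iff)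
    obtain f where f: "?D f"
      using ex1 by blast
    have f_V: "f \<alpha> \<in> ?V \<alpha>" if "\<alpha> \<in> ?W" for \<alpha>
      using f that by blast
    have "f \<alpha> \<in> ?N" if \<alpha>: "\<alpha> \<in> ?W" for \<alpha>
    proof (cases "f \<alpha> = \<zero>\<^bsub>M\<^esub>")
      case True
      then show ?thesis
        using cyc by (simp add: submodule_iff)
    next
      case False
      let ?I = "{\<alpha>\<in>?W. f \<alpha> \<noteq> \<zero>\<^bsub>M\<^esub>}"
      show ?thesis
      proof (rule weights_separated[OF cyc, of group_algebra_X ?I "\<lambda>\<alpha>. \<alpha>" f \<alpha>])
        show "\<exists>a\<in>group_algebra_X. \<mu> a \<noteq> \<nu> a" if "\<mu> \<in> ?I" "\<nu> \<in> ?I" "\<mu> \<noteq> \<nu>" for \<mu> \<nu>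
          using that extensionalityI[of \<mu> group_algebra_X \<nu>] by (auto simp: weights_def)
        show "a \<odot>\<^bsub>M\<^esub> f \<mu> \<ominus>\<^bsub>M\<^esub> \<mu> a \<cdot> f \<mu> \<in> ?N" if "\<mu> \<in> ?I" "a \<in> group_algebra_X" for \<mu> a
        proof -
          have "a \<odot>\<^bsub>M\<^esub> f \<mu> = \<mu> a \<cdot> f \<mu>" "f \<mu> \<in> carrier M"
            using f_V[of \<mu>] that by (auto simp: weight_space_def)
          then show ?thesis
            using cyc by (simp add: diff_eq_zero_iff[THEN iffD2] submodule_iff)
        qed
        show "(\<Oplus>\<^bsub>M\<^esub>\<mu>\<in>?I. f \<mu>) \<in> ?N"
          using f m by simp
      qed (use f f_V \<alpha> False in \<open>auto simp: weight_space_def\<close>)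
    qed
    then have f_V': "f \<in> (\<Pi>\<^sub>E \<alpha>\<in>?W. ?V' \<alpha>)"
      using f V' by (auto simp: PiE_iff)
    show ?thesis
    proof (rule ex1I[of _ f])
      show "f \<in> (\<Pi>\<^sub>E \<alpha>\<in>?W. ?V' \<alpha>) \<and> finite {\<alpha>\<in>?W. f \<alpha> \<noteq> \<zero>\<^bsub>?M\<^esub>} \<and>
        m = (\<Oplus>\<^bsub>?M\<^esub>\<alpha>\<in>{\<alpha>\<in>?W. f \<alpha> \<noteq> \<zero>\<^bsub>?M\<^esub>}. f \<alpha>)"
        using f f_V' sum_eq[OF f_V'] by simp
      fix g assume g: "g \<in> (\<Pi>\<^sub>E \<alpha>\<in>?W. ?V' \<alpha>) \<and> finite {\<alpha>\<in>?W. g \<alpha> \<noteq> \<zero>\<^bsub>?M\<^esub>} \<and>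
        m = (\<Oplus>\<^bsub>?M\<^esub>\<alpha>\<in>{\<alpha>\<in>?W. g \<alpha> \<noteq> \<zero>\<^bsub>?M\<^esub>}. g \<alpha>)"
      then have "?D g"
        using sum_eq[of g] V' by (auto simp: PiE_iff)
      then show "g = f"
        using ex1 f by blast
    qed
  qed
  moreover have "finite_dim qt_scalar ?M (?V' \<alpha>)" if \<alpha>: "\<alpha> \<in> ?W" for \<alpha>
  proof -
    obtain S where S: "finite S" "S \<subseteq> ?V \<alpha>" "?V \<alpha> \<subseteq> lin S"
      using M \<alpha> unfolding category_Mss_def finite_dim_iff by blast
    then have "finite_dim qt_scalar M (?V' \<alpha>)"
      using sub' V' by (intro finite_dim_subspace[of S]) (auto simp: weight_space_def)
    then show ?thesis
      using finite_dim_restrict[OF cyc] V' by blast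
  qed
  ultimately show ?thesis
    using category_M_cyclic[OF _ v] M by (simp add: category_Mss_def is_internal_direct_sum_def)
qed

end


section \<open>The modules attached to the points of Lambda\<close>

context quantum_torus_data
begin

abbreviation shift :: "('x \<Rightarrow> complex) \<Rightarrow> 'y \<Rightarrow> 'x \<Rightarrow> complex" where
  "shift t y \<equiv> t \<otimes>\<^bsub>torus_T\<^esub> q_exp n r B y"

definition coset :: "('x \<Rightarrow> complex) \<Rightarrow> ('x \<Rightarrow> complex) set" where
  "coset t = range (shift t)"

lemma shift_apply [simp]: "shift t y x = t x * \<beta> x y"
  by (simp add: torus_T_def)

lemma shift_shift: "shift (shift t y) z = shift t (y + z)"
  by (rule ext) simp

lemma shift_zero [simp]: "shift t 0 = t"
  by (rule ext) simp

lemma shift_closed: "t \<in> carrier torus_T \<Longrightarrow> shift t y \<in> carrier torus_T"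
  by (simp add: torus_T_def)

lemma torus_add: "t \<in> carrier torus_T \<Longrightarrow> t (x + x') = t x * t x'"
  by (simp add: torus_T_def)

lemma carrier_Lambda: "carrier (Lambda n r B) = coset ` carrier torus_T"
proof -
  have "range (q_exp n r B) #>\<^bsub>torus_T\<^esub> t = coset t" for t
  proof -
    have "q_exp n r B y \<otimes>\<^bsub>torus_T\<^esub> t = shift t y" for y
      by (simp add: torus_T_def mult.commute)
    then show ?thesis
      by (auto simp: r_coset_def coset_def)
  qed
  then show ?thesis
    by (auto simp: Lambda_def FactGroup_def RCOSETS_def)
qed

lemma coset_eq:
  assumes "s \<in> coset t"
  shows "coset s = coset t"
proof -
  obtain y where y: "s = shift t y"
    using assms by (auto simp: coset_def)
  have "shift s z \<in> coset t" for z
    unfolding y coset_def shift_shift by (rule rangeI)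
  moreover have "shift t z \<in> coset s" for z
  proof -
    have "shift t z = shift s (z - y)"
      unfolding y shift_shift by simp
    then show ?thesis
      unfolding coset_def by (metis rangeI)
  qed
  ultimately show ?thesis
    by (auto simp: coset_def)
qed

lemma coset_self: "t \<in> coset t"
  unfolding coset_def by (rule range_eqI[of _ _ 0]) simp

lemma coset_torus: "t \<in> carrier torus_T \<Longrightarrow> s \<in> coset t \<Longrightarrow> s \<in> carrier torus_T"
  using shift_closed by (auto simp: coset_def)

text \<open>The scalar multiplication of \<^const>\<open>module_M\<close>, which is given by the same formula for all cosets.\<close>

definition act :: "(('x \<times> 'y) \<Rightarrow>\<^sub>0 complex) \<Rightarrow> (('x \<Rightarrow> complex) \<Rightarrow>\<^sub>0 complex) \<Rightarrow> (('x \<Rightarrow> complex) \<Rightarrow>\<^sub>0 complex)" where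
  "act h f = (\<Sum>k\<in>Poly_Mapping.keys h.
     Poly_Mapping.map ((*) (Poly_Mapping.lookup h k)) (act_X (fst k) (act_Y n r B (snd k) f)))"

lemma module_M_simps [simp]:
  "carrier (module_M n r B L) = {f. Poly_Mapping.keys f \<subseteq> L}" "\<zero>\<^bsub>module_M n r B L\<^esub> = 0"
  "f \<oplus>\<^bsub>module_M n r B L\<^esub> g = f + g" "(\<odot>\<^bsub>module_M n r B L\<^esub>) = act"
  by (simp_all add: module_M_def act_def case_prod_unfold fun_eq_iff)

lemma act_X_add: "act_X x (f + g) = act_X x f + act_X x g"
  unfolding act_X_def
  by (rule setsum_keys_plus_distrib[where f = "\<lambda>\<mu> c. Poly_Mapping.single \<mu> (\<mu> x * c)"])
    (simp_all add: single_add algebra_simps)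

lemma act_Y_add: "act_Y n r B y (f + g) = act_Y n r B y f + act_Y n r B y g"
  unfolding act_Y_def
  by (rule setsum_keys_plus_distrib[where f = "\<lambda>\<mu> c. Poly_Mapping.single (shift \<mu> y) c"])
    (simp_all add: single_add)

lemma act_add_right: "act h (f + g) = act h f + act h g"
  by (simp add: act_def act_X_add act_Y_add map_times_add sum.distrib)

lemma act_add_left: "act (h + h') f = act h f + act h' f"
proof -
  let ?F = "\<lambda>k c. Poly_Mapping.map ((*) c) (act_X (fst k) (act_Y n r B (snd k) f))"
  have act: "act h f = (\<Sum>k\<in>Poly_Mapping.keys h. ?F k (Poly_Mapping.lookup h k))" for h
    by (simp add: act_def)
  have zero: "Poly_Mapping.map ((*) 0) g = 0" for g :: "('x \<Rightarrow> complex) \<Rightarrow>\<^sub>0 complex"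
    by (rule poly_mapping_eqI) (simp add: Poly_Mapping.map.rep_eq when_def)
  have add: "Poly_Mapping.map ((*) (c + d)) g = Poly_Mapping.map ((*) c) g + Poly_Mapping.map ((*) d) g"
    for c d and g :: "('x \<Rightarrow> complex) \<Rightarrow>\<^sub>0 complex"
    by (rule poly_mapping_eqI)
      (simp add: Poly_Mapping.map.rep_eq lookup_add when_def algebra_simps)
  show ?thesis
    unfolding act
  proof (rule setsum_keys_plus_distrib[where f = ?F])
    show "?F k 0 = 0" for k
      by (rule zero)
    show "?F k (Poly_Mapping.lookup h k + Poly_Mapping.lookup h' k) =
        ?F k (Poly_Mapping.lookup h k) + ?F k (Poly_Mapping.lookup h' k)" for k
      by (rule add)
  qed
qed

lemma act_single [simp]:
  "act (Poly_Mapping.single (x, y) c) (Poly_Mapping.single \<mu> d) =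
    Poly_Mapping.single (shift \<mu> y) (c * d * (\<mu> x * \<beta> x y))"
  by (simp add: act_def act_X_def act_Y_def map_eq_zero_iff ac_simps)

lemma act_zero [simp]: "act 0 f = 0" "act h 0 = 0"
  using act_add_left[of 0 0 f] act_add_right[of h 0 0] by simp_all

lemma act_closed:
  assumes "Poly_Mapping.keys f \<subseteq> coset t"
  shows "Poly_Mapping.keys (act h f) \<subseteq> coset t"
  using subset_UNIV[of "Poly_Mapping.keys h"]
proof (induction h rule: poly_mapping_additive_induct)
  case h: (single k c)
  obtain x y where k: "k = (x, y)"
    by fastforce
  show ?case
    using assms
  proof (induction f rule: poly_mapping_additive_induct)
    case (single \<mu> d)
    then have "shift \<mu> y \<in> coset t"
      using coset_eq[of \<mu> t] by (auto simp: coset_def)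
    then show ?case
      by (simp add: k)
  next
    case (add f g)
    then show ?case
      using keys_add[of "act (Poly_Mapping.single k c) f" "act (Poly_Mapping.single k c) g"]
      by (auto simp: act_add_right)
  qed simp
next
  case (add g h)
  then show ?case
    using keys_add[of "act g f" "act h f"] by (auto simp: act_add_left)
qed simp

lemma act_assoc:
  assumes "Poly_Mapping.keys f \<subseteq> carrier torus_T"
  shows "act (g \<otimes>\<^bsub>H\<^esub> h) f = act g (act h f)"
  using subset_UNIV[of "Poly_Mapping.keys g"]
proof (induction g rule: poly_mapping_additive_induct)
  case g: (single k c)
  show ?case
    using subset_UNIV[of "Poly_Mapping.keys h"]
  proof (induction h rule: poly_mapping_additive_induct)
    case h: (single l d)
    show ?case
      using assms
    proof (induction f rule: poly_mapping_additive_induct)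
      case (single \<mu> e)
      obtain x y u v where "k = (x, y)" "l = (u, v)"
        by fastforce
      moreover have "c * d / \<beta> u y * e * (\<mu> (x + u) * \<beta> (x + u) (y + v)) =
          c * (d * e * (\<mu> u * \<beta> u v)) * (\<mu> x * \<beta> x v * \<beta> x y)"
        by (simp add: torus_add[OF single] field_simps)
      ultimately show ?case
        by (simp only: H_mult_single act_single shift_shift shift_apply add.commute[of v y])
    qed (simp_all add: act_add_right)
  qed (simp_all add: H_mult_add_right act_add_right act_add_left)
qed (simp_all add: H_mult_add_left act_add_left)

lemma lookup_act_X:
  "Poly_Mapping.lookup (act (Poly_Mapping.single (x, 0) c) f) \<mu> = c * \<mu> x * Poly_Mapping.lookup f \<mu>"
  using subset_UNIV[of "Poly_Mapping.keys f"]
proof (induction f rule: poly_mapping_additive_induct)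
  case (single \<nu> d)
  show ?case
    by (auto simp: lookup_single when_def)
qed (simp_all add: act_add_right lookup_add algebra_simps)

lemma torus_at_zero:
  assumes "t \<in> carrier torus_T"
  shows "t 0 = 1"
proof -
  have "t 0 \<noteq> 0"
    using assms by (simp add: torus_T_def)
  then show ?thesis
    using torus_add[OF assms, of 0 0] by simp
qed

lemma lookup_act_scalar:
  assumes "Poly_Mapping.keys f \<subseteq> carrier torus_T"
  shows "Poly_Mapping.lookup (act (qt_scalar c) f) \<mu> = c * Poly_Mapping.lookup f \<mu>"
proof (cases "\<mu> \<in> Poly_Mapping.keys f")
  case True
  then show ?thesis
    using torus_at_zero assms by (auto simp: qt_scalar_def lookup_act_X)
qed (simp add: qt_scalar_def lookup_act_X in_keys_iff)

lemma act_one: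
  assumes "Poly_Mapping.keys f \<subseteq> carrier torus_T"
  shows "act (Poly_Mapping.single (0, 0) 1) f = f"
  using lookup_act_scalar[OF assms, of 1] by (intro poly_mapping_eqI) (simp add: qt_scalar_def)

lemma torus_module_M:
  assumes t: "t \<in> carrier torus_T"
  shows "torus_module n r B (module_M n r B (coset t))"
proof (intro torus_module.intro left_module.intro ring_H quantum_torus_data_axioms)
  have coset_T: "coset t \<subseteq> carrier torus_T"
    using coset_torus[OF t] by blast
  let ?C = "{f :: ('x \<Rightarrow> complex) \<Rightarrow>\<^sub>0 complex. Poly_Mapping.keys f \<subseteq> coset t}"
  have plus: "f + g \<in> ?C" if "f \<in> ?C" "g \<in> ?C" for f g
    using that keys_add[of f g] by blast
  have uminus: "\<exists>g\<in>?C. g + f = 0" if "f \<in> ?C" for f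
    using that by (intro bexI[of _ "- f"]) auto
  show "abelian_group (module_M n r B (coset t))"
    using plus uminus by (intro abelian_groupI) (simp_all add: add.assoc add.commute)
  show "left_module_axioms H (module_M n r B (coset t))"
    using act_closed act_one[OF order_trans[OF _ coset_T]] act_assoc[OF order_trans[OF _ coset_T]]
    by (intro left_module_axioms.intro) (simp_all add: act_add_left act_add_right)
qed

abbreviation basis_vector :: "('x \<Rightarrow> complex) \<Rightarrow> (('x \<Rightarrow> complex) \<Rightarrow>\<^sub>0 complex)" where
  "basis_vector t \<equiv> Poly_Mapping.single t 1"

lemma basis_vector_weight:
  assumes t: "t \<in> carrier torus_T"
  shows "torus_module.weight_vector_mod (module_M n r B (coset t)) {0} t (basis_vector t)"
proof -
  interpret M: torus_module n r B "module_M n r B (coset t)"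
    by (rule torus_module_M[OF t])
  have "act (eX x) (basis_vector t) \<ominus>\<^bsub>module_M n r B (coset t)\<^esub> act (qt_scalar (t x)) (basis_vector t) = 0" for x
    using M.diff_eq_zero_iff[of "act (eX x) (basis_vector t)" "act (qt_scalar (t x)) (basis_vector t)"]
      coset_self[of t] torus_at_zero[OF t]
    by (simp add: qt_scalar_def act_closed)
  then show ?thesis
    using coset_self[of t] by (simp add: M.weight_vector_mod_def)
qed

lemma basis_vector_generates:
  assumes t: "t \<in> carrier torus_T"
  shows "left_module.cyclic H (module_M n r B (coset t)) (basis_vector t) = carrier (module_M n r B (coset t))"
proof -
  interpret M: torus_module n r B "module_M n r B (coset t)"
    by (rule torus_module_M[OF t])
  have "\<exists>h. f = act h (basis_vector t)" if "Poly_Mapping.keys f \<subseteq> coset t" for f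
    using that
  proof (induction f rule: poly_mapping_additive_induct)
    case zero
    show ?case
      by (rule exI[of _ 0]) simp
  next
    case (single \<mu> c)
    then obtain y where "\<mu> = shift t y"
      by (auto simp: coset_def)
    then have "Poly_Mapping.single \<mu> c = act (Poly_Mapping.single (0, y) c) (basis_vector t)"
      using torus_at_zero[OF t] by simp
    then show ?case
      by blast
  next
    case (add f g)
    then show ?case
      by (metis act_add_left)
  qed
  then have "carrier (module_M n r B (coset t)) \<subseteq> M.cyclic (basis_vector t)"
    by (auto simp: M.cyclic_def image_iff)
  moreover have "M.cyclic (basis_vector t) \<subseteq> carrier (module_M n r B (coset t))"
    using coset_self[of t] M.cyclic_submodule[of "basis_vector t"] by (auto simp: M.submodule_iff)
  ultimately show ?thesis
    by blast
qed

lemma basis_vector_nonzero: "basis_vector t \<noteq> 0"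
  by (metis lookup_single_eq lookup_zero zero_neq_one)

lemma carrier_update_self: "M\<lparr>carrier := carrier M\<rparr> = M"
  by simp

lemma module_M_simple:
  assumes t: "t \<in> carrier torus_T"
  shows "simple_module H (module_M n r B (coset t))"
proof -
  interpret M: torus_module n r B "module_M n r B (coset t)"
    by (rule torus_module_M[OF t])
  have "simple_module H ((module_M n r B (coset t))\<lparr>carrier := M.cyclic (basis_vector t)\<rparr>)"
    using basis_vector_weight[OF t] basis_vector_nonzero
    by (intro M.weight_vector_cyclic_simple[of t]) simp_all
  then show ?thesis
    unfolding basis_vector_generates[OF t] carrier_update_self .
qed

lemma module_M_category_M:
  assumes t: "t \<in> carrier torus_T"
  shows "category_M H qt_scalar group_algebra_X (module_M n r B (coset t))"
proof -
  let ?M = "module_M n r B (coset t)"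
  interpret M: torus_module n r B ?M
    by (rule torus_module_M[OF t])
  have v: "basis_vector t \<in> carrier ?M"
    using coset_self[of t] by simp
  have "finitely_generated H ?M"
    unfolding finitely_generated_def
  proof (intro exI[of _ "{basis_vector t}"] conjI allI impI)
    fix N assume N: "submodule N H ?M \<and> {basis_vector t} \<subseteq> N"
    then have "carrier ?M \<subseteq> N"
      using M.cyclic_least[of N "basis_vector t"] basis_vector_generates[OF t] by simp
    moreover have "N \<subseteq> carrier ?M"
      using N M.submodule_iff[of N] by simp
    ultimately show "N = carrier ?M"
      by simp
  qed (use v in auto)
  moreover have "finite_dim qt_scalar ?M (M.orbit m)" if m: "m \<in> carrier ?M" for m
  proof -
    let ?S = "basis_vector ` Poly_Mapping.keys m"
    have S: "?S \<subseteq> carrier ?M"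
      using m by auto
    have sub: "M.subspace (M.lin ?S)"
      by (rule M.subspace_lin[OF S])
    have in_lin: "f \<in> M.lin ?S" if "Poly_Mapping.keys f \<subseteq> Poly_Mapping.keys m" for f
      using that
    proof (induction f rule: poly_mapping_additive_induct)
      case zero
      show ?case
        using sub by (simp add: M.subspace_def)
    next
      case (single \<mu> c)
      then have "\<mu> \<in> carrier torus_T"
        using m coset_torus[OF t] by auto
      then have "Poly_Mapping.single \<mu> c = act (qt_scalar c) (basis_vector \<mu>)"
        using torus_at_zero[of \<mu>] by (simp add: qt_scalar_def)
      moreover have "basis_vector \<mu> \<in> M.lin ?S"
        using single S by (intro M.lin_superset) auto
      ultimately show ?case
        using sub by (simp add: M.subspace_def)
    next
      case (add f g)
      then show ?case
        using sub by (simp add: M.subspace_def)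
    qed
    have "Poly_Mapping.keys (act a m) \<subseteq> Poly_Mapping.keys m" if "a \<in> group_algebra_X" for a
      using that unfolding group_algebra_X_def mem_Collect_eq
    proof (induction a rule: poly_mapping_additive_induct)
      case (single k c)
      then obtain x where "k = (x, 0)"
        by auto
      then show ?case
        by (auto simp: in_keys_iff lookup_act_X)
    next
      case (add f g)
      then show ?case
        using keys_add[of "act f m" "act g m"] by (auto simp: act_add_left)
    qed simp
    then have "M.orbit m \<subseteq> M.lin ?S"
      using in_lin by (auto simp: M.orbit_def)
    then show ?thesis
      using S M.orbit_subspace[OF m] by (intro M.finite_dim_subspace[of ?S]) auto
  qed
  ultimately show ?thesis
    using M.left_module_axioms by (auto simp: category_M_def M.orbit_def)
qed

text \<open>The weights of the module attached to a coset are the elements of the coset, and an isomorphism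
  preserves weights.\<close>

lemma module_M_isomorphic_imp_coset_eq:
  assumes t: "t \<in> carrier torus_T" and s: "s \<in> carrier torus_T"
    and iso: "module_isomorphic H (module_M n r B (coset t)) (module_M n r B (coset s))"
  shows "coset t = coset s"
proof -
  let ?M = "module_M n r B (coset t)" and ?N = "module_M n r B (coset s)"
  obtain \<phi> where bij: "bij_betw \<phi> (carrier ?M) (carrier ?N)"
    and add: "\<And>f g. f \<in> carrier ?M \<Longrightarrow> g \<in> carrier ?M \<Longrightarrow> \<phi> (f + g) = \<phi> f + \<phi> g"
    and smult: "\<And>h f. f \<in> carrier ?M \<Longrightarrow> \<phi> (act h f) = act h (\<phi> f)"
    using iso by (auto simp: module_isomorphic_def)
  let ?v = "basis_vector t"
  have v: "?v \<in> carrier ?M"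
    using coset_self[of t] by simp
  have "\<phi> 0 = 0"
    using add[of 0 0] by simp
  moreover have "\<phi> ?v \<noteq> \<phi> 0"
    using inj_onD[OF bij_betw_imp_inj_on[OF bij], of ?v 0] v basis_vector_nonzero by auto
  ultimately obtain \<mu> where \<mu>: "\<mu> \<in> Poly_Mapping.keys (\<phi> ?v)"
    by (metis all_not_in_conv keys_eq_empty)
  have keys: "Poly_Mapping.keys (\<phi> ?v) \<subseteq> coset s"
    using bij_betwE[OF bij] v by auto
  then have keys_T: "Poly_Mapping.keys (\<phi> ?v) \<subseteq> carrier torus_T"
    using coset_torus[OF s] by blast
  \<comment> \<open>The image of the basis vector has weight \<open>t\<close>, so \<open>t\<close> is the only possible element of its support.\<close>
  have "\<mu> x = t x" for x
  proof -
    have "act (eX x) ?v = act (qt_scalar (t x)) ?v"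
      using torus_at_zero[OF t] by (simp add: qt_scalar_def)
    then have "act (eX x) (\<phi> ?v) = act (qt_scalar (t x)) (\<phi> ?v)"
      using smult[OF v] by metis
    then have "Poly_Mapping.lookup (act (eX x) (\<phi> ?v)) \<mu> = Poly_Mapping.lookup (act (qt_scalar (t x)) (\<phi> ?v)) \<mu>"
      by simp
    then show ?thesis
      using \<mu> by (simp add: lookup_act_X lookup_act_scalar[OF keys_T] in_keys_iff)
  qed
  then have "t \<in> coset s"
    using \<mu> keys by (metis ext subsetD)
  then show ?thesis
    by (rule coset_eq)
qed

end

context torus_module
begin

text \<open>Both modules are generated by a vector of weight \<open>t\<close>, so these generators have the same annihilator.\<close>

lemma weight_vector_cyclic_isomorphic:
  assumes v: "weight_vector t v" "v \<noteq> \<zero>\<^bsub>M\<^esub>"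
  shows "module_isomorphic H (M\<lparr>carrier := cyclic v\<rparr>) (module_M n r B (coset t))"
proof -
  have t: "t \<in> carrier torus_T"
    using weight_is_character[OF zero_submodule v(1)] v(2) by simp
  have v_M: "v \<in> carrier M"
    using weight_vectorD[OF v(1)] .
  note cyc = cyclic_submodule[OF v_M]
  interpret N: torus_module n r B "M\<lparr>carrier := cyclic v\<rparr>"
    by (rule torus_module_restrict[OF cyc])
  interpret L: torus_module n r B "module_M n r B (coset t)"
    by (rule torus_module_M[OF t])
  show ?thesis
  proof (rule cyclic_modules_isomorphic)
    show "left_module H (M\<lparr>carrier := cyclic v\<rparr>)" "left_module H (module_M n r B (coset t))"
      by (rule N.left_module_axioms L.left_module_axioms)+
    show "v \<in> carrier (M\<lparr>carrier := cyclic v\<rparr>)" "basis_vector t \<in> carrier (module_M n r B (coset t))"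
      using cyclic_self[OF v_M] coset_self[of t] by simp_all
    show "N.cyclic v = carrier (M\<lparr>carrier := cyclic v\<rparr>)"
      unfolding N.cyclic_def by (simp add: cyclic_def)
    show "L.cyclic (basis_vector t) = carrier (module_M n r B (coset t))"
      by (rule basis_vector_generates[OF t])
    show "h \<odot>\<^bsub>M\<lparr>carrier := cyclic v\<rparr>\<^esub> v = \<zero>\<^bsub>M\<lparr>carrier := cyclic v\<rparr>\<^esub> \<longleftrightarrow>
        h \<odot>\<^bsub>module_M n r B (coset t)\<^esub> basis_vector t = \<zero>\<^bsub>module_M n r B (coset t)\<^esub>" for h
    proof -
      have "h \<odot>\<^bsub>M\<^esub> v = \<zero>\<^bsub>M\<^esub> \<longleftrightarrow> red t h = 0"
        using smult_mem_iff_red_zero[OF zero_submodule v(1), of h] v(2) by simp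
      moreover have "act h (basis_vector t) = 0 \<longleftrightarrow> red t h = 0"
        using L.smult_mem_iff_red_zero[OF L.zero_submodule, of t "basis_vector t" h]
          basis_vector_weight[OF t] basis_vector_nonzero by simp
      ultimately show ?thesis
        by simp
    qed
  qed
qed

lemma simple_object_isomorphic:
  assumes M: "simple_object H (category_M H qt_scalar group_algebra_X) M"
  shows "\<exists>L\<in>carrier (Lambda n r B). module_isomorphic H M (module_M n r B L)"
proof -
  have cat: "category_M H qt_scalar group_algebra_X M" and nonzero: "carrier M \<noteq> {\<zero>\<^bsub>M\<^esub>}"
    and simple: "\<And>N. submodule N H M \<Longrightarrow> category_M H qt_scalar group_algebra_X (M\<lparr>carrier := N\<rparr>) \<Longrightarrow>
      N = {\<zero>\<^bsub>M\<^esub>} \<or> N = carrier M"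
    using M by (auto simp: simple_object_def)
  obtain w where w: "w \<in> carrier M" "w \<notin> {\<zero>\<^bsub>M\<^esub>}"
    using nonzero by auto
  obtain u t where u: "u \<notin> {\<zero>\<^bsub>M\<^esub>}" "weight_vector t u"
    using weight_vector_exists[OF zero_submodule w locally_finite[OF cat w(1)]] by blast
  have u_M: "u \<in> carrier M"
    using weight_vectorD[OF u(2)] .
  have "cyclic u = carrier M"
    using simple[OF cyclic_submodule[OF u_M] category_M_cyclic[OF cat u_M]] cyclic_self[OF u_M] u(1) by blast
  then have "module_isomorphic H M (module_M n r B (coset t))"
    using weight_vector_cyclic_isomorphic[OF u(2)] u(1) by simp
  moreover have "t \<in> carrier torus_T"
    using weight_is_character[OF zero_submodule u(2,1)] .
  ultimately show ?thesis
    by (auto simp: carrier_Lambda)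
qed

lemma category_Mss_isomorphic:
  assumes M: "category_Mss H qt_scalar group_algebra_X M"
  shows "\<exists>(k::nat) L. (\<forall>i<k. L i \<in> carrier (Lambda n r B)) \<and>
    module_isomorphic H M (finite_direct_sum k (\<lambda>i. module_M n r B (L i)))"
    and "\<exists>k (Ms :: nat \<Rightarrow> (('x \<times> 'y) \<Rightarrow>\<^sub>0 complex, 'm) module). (\<forall>i<k. simple_object H (category_Mss H qt_scalar group_algebra_X) (Ms i)) \<and>
      module_isomorphic H M (finite_direct_sum k Ms)"
proof -
  obtain k U where U: "is_direct_sum (carrier M) k U"
    and "\<forall>i<k. \<exists>w t. w \<noteq> \<zero>\<^bsub>M\<^esub> \<and> weight_vector t w \<and> U i = cyclic w"
    using category_Mss_decomposition[OF M] by blast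
  then obtain w t where wt: "\<And>i. i < k \<Longrightarrow> w i \<noteq> \<zero>\<^bsub>M\<^esub> \<and> weight_vector (t i) (w i) \<and> U i = cyclic (w i)"
    by metis
  let ?Ms = "\<lambda>i. M\<lparr>carrier := U i\<rparr>"
  have iso: "module_isomorphic H M (finite_direct_sum k ?Ms)"
    by (rule is_direct_sum_isomorphic[OF U])
  have "module_isomorphic H (finite_direct_sum k ?Ms) (finite_direct_sum k (\<lambda>i. module_M n r B (coset (t i))))"
    using wt weight_vector_cyclic_isomorphic by (intro finite_direct_sum_cong) auto
  then have "module_isomorphic H M (finite_direct_sum k (\<lambda>i. module_M n r B (coset (t i))))"
    by (rule module_isomorphic_trans[OF iso])
  moreover have "coset (t i) \<in> carrier (Lambda n r B)" if "i < k" for i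
    using weight_is_character[OF zero_submodule, of "t i" "w i"] wt[OF that] by (simp add: carrier_Lambda)
  ultimately show "\<exists>(k::nat) L. (\<forall>i<k. L i \<in> carrier (Lambda n r B)) \<and>
      module_isomorphic H M (finite_direct_sum k (\<lambda>i. module_M n r B (L i)))"
    by (intro exI[of _ k] exI[of _ "\<lambda>i. coset (t i)"]) simp
  have "simple_object H (category_Mss H qt_scalar group_algebra_X) (?Ms i)" if i: "i < k" for i
    using weight_vector_cyclic_simple[of "t i" "w i"] wt[OF i] weight_vectorD[of "t i" "w i"]
      category_Mss_cyclic[OF M, of "w i"]
    by (auto simp: simple_object_def simple_module_def)
  then show "\<exists>k (Ms :: nat \<Rightarrow> (('x \<times> 'y) \<Rightarrow>\<^sub>0 complex, 'm) module). (\<forall>i<k. simple_object H (category_Mss H qt_scalar group_algebra_X) (Ms i)) \<and>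
      module_isomorphic H M (finite_direct_sum k Ms)"
    using iso by (intro exI[of _ k] exI[of _ ?Ms]) simp
qed

end

theorem proposition2p5:
  fixes n :: nat and q r :: complex
    and B :: "'x::ab_group_add \<Rightarrow> 'y::ab_group_add \<Rightarrow> rat"
  assumes "free_of_finite_rank TYPE('x)" and "free_of_finite_rank TYPE('y)"
    and "n > 0" and "nondegenerate_pairing n B"
    and "q \<noteq> 0" and "\<forall>k::nat. k > 0 \<longrightarrow> q ^ k \<noteq> 1" and "r ^ n = q"
  shows
    \<comment> \<open>(i)\<close>
    "((\<forall>L\<in>carrier (Lambda n r B).
         simple_module (quantum_torus n r B) (module_M n r B L)) \<and>
      (\<forall>L\<in>carrier (Lambda n r B).
         simple_object (quantum_torus n r B)
           (category_M (quantum_torus n r B) qt_scalar group_algebra_X) (module_M n r B L)) \<and>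
      (\<forall>L\<in>carrier (Lambda n r B). \<forall>L'\<in>carrier (Lambda n r B).
         module_isomorphic (quantum_torus n r B) (module_M n r B L) (module_M n r B L')
           \<longrightarrow> L = L') \<and>
      (\<forall>M :: (('x \<times> 'y) \<Rightarrow>\<^sub>0 complex, 'm) module.
         simple_object (quantum_torus n r B)
           (category_M (quantum_torus n r B) qt_scalar group_algebra_X) M \<longrightarrow>
         (\<exists>L\<in>carrier (Lambda n r B).
            module_isomorphic (quantum_torus n r B) M (module_M n r B L)))) \<and>
     \<comment> \<open>(ii)\<close>
     ((\<forall>M :: (('x \<times> 'y) \<Rightarrow>\<^sub>0 complex, 'm) module.
         category_Mss (quantum_torus n r B) qt_scalar group_algebra_X M \<longrightarrow>
         (\<exists>(k::nat) L. (\<forall>i<k. L i \<in> carrier (Lambda n r B)) \<and>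
            module_isomorphic (quantum_torus n r B) M
              (finite_direct_sum k (\<lambda>i. module_M n r B (L i))))) \<and>
      semisimple_category (quantum_torus n r B)
        (category_Mss (quantum_torus n r B) qt_scalar group_algebra_X ::
           (('x \<times> 'y) \<Rightarrow>\<^sub>0 complex, 'm) module \<Rightarrow> bool)) \<and>
     \<comment> \<open>(iii)\<close>
     (\<forall>M :: (('x \<times> 'y) \<Rightarrow>\<^sub>0 complex, 'm) module.
        category_M (quantum_torus n r B) qt_scalar group_algebra_X M \<longrightarrow>
        finite_length (quantum_torus n r B) M)"
proof -
  have r: "r \<noteq> 0"
    using assms by auto
  have r_root: "r ^ k \<noteq> 1" if "k > 0" for k :: nat
  proof
    assume "r ^ k = 1"
    then have "q ^ k = 1"
      using assms(7) by (metis power_mult power_one mult.commute)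
    then show False
      using assms(6) that by blast
  qed
  interpret quantum_torus_data n r B
    using assms r r_root by (intro quantum_torus_data.intro) auto
  have module: "torus_module n r B M" if "left_module H M" for M :: "(('x \<times> 'y) \<Rightarrow>\<^sub>0 complex, 'm) module"
    using that by (intro torus_module.intro quantum_torus_data_axioms)
  have simple: "simple_module H (module_M n r B L)" "category_M H qt_scalar group_algebra_X (module_M n r B L)"
    if "L \<in> carrier (Lambda n r B)" for L
    using that module_M_simple module_M_category_M by (auto simp: carrier_Lambda)
  have "simple_object H (category_M H qt_scalar group_algebra_X) (module_M n r B L)"
    if "L \<in> carrier (Lambda n r B)" for L
    using simple[OF that] by (auto simp: simple_object_def simple_module_def)
  moreover have "L = L'"
    if "L \<in> carrier (Lambda n r B)" "L' \<in> carrier (Lambda n r B)"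
      "module_isomorphic H (module_M n r B L) (module_M n r B L')" for L L'
    using that module_M_isomorphic_imp_coset_eq by (auto simp: carrier_Lambda)
  moreover have "\<exists>L\<in>carrier (Lambda n r B). module_isomorphic H M (module_M n r B L)"
    if "simple_object H (category_M H qt_scalar group_algebra_X) M"
    for M :: "(('x \<times> 'y) \<Rightarrow>\<^sub>0 complex, 'm) module"
    using that module[of M] torus_module.simple_object_isomorphic[of n r B M]
    by (auto simp: simple_object_def category_M_def)
  moreover have "torus_module n r B M" if "category_Mss H qt_scalar group_algebra_X M"
    for M :: "(('x \<times> 'y) \<Rightarrow>\<^sub>0 complex, 'm) module"
    using that module by (simp add: category_Mss_def category_M_def)
  moreover have "finite_length H M" if "category_M H qt_scalar group_algebra_X M"
    for M :: "(('x \<times> 'y) \<Rightarrow>\<^sub>0 complex, 'm) module"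
    using that module[of M] torus_module.category_M_finite_length[of n r B M]
    by (auto simp: category_M_def)
  moreover note simple = simple and torus_module.category_Mss_isomorphic
  ultimately show ?thesis
    unfolding semisimple_category_def by (intro conjI allI ballI impI) blast+
qed

end
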